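(* Let $X$ be a finite collection of hyperspaces of $\mathbb{R}^d$ and let $P(X)$ be the collection of all convex polyhedra in the torus $\mathbb{T}^d=\mathbb{R}^d/\mathbb{Z}^d$ with diameter smaller than $1$ and facets parallel to elements of $X$. Then there exists a constant $c$ such that, given a prime number $m$, there exists a lattice point $g=(g_1,\dots,g_d)$ in $\mathbb{Z}^d$ with $1\le g_j\le m-1$ for all $j$, such that $$\sup_{\Omega\in P(X)}\left|\mu(\Omega)-m^{-1}\sum_{j=1}^m\chi_\Omega(jm^{-1}g)\right|\le c\,m^{-1}\log^d(m).$$
   Context: A hyperspace is a $(d-1)$-dimensional linear subspace of $\mathbb{R}^d$. A convex polyhedron in the torus of diameter smaller than $1$ is the image in $\mathbb{T}^d$ of a convex polyhedron in $\mathbb{R}^d$ (a compact set with nonempty interior that is a finite intersection of closed half-spaces) with Euclidean diameter smaller than $1$; its facets are its $(d-1)$-dimensional faces. $\mu$ is the Lebesgue measure on $\mathbb{T}^d$, $\chi_\Omega$ is the characteristic function of $\Omega$, and the points $jm^{-1}g$ are taken modulo $\mathbb{Z}^d$. The constant $c$ does not depend on $m$. *)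

theory Defs
  imports "HOL-Analysis.Analysis" "HOL-Computational_Algebra.Primes"
begin

definition torus_rel :: "real ^ 'n \<Rightarrow> real ^ 'n \<Rightarrow> bool" where
  "torus_rel x y \<longleftrightarrow> (\<forall>i. x $ i - y $ i \<in> \<int>)"

lemma equivp_torus_rel: "equivp torus_rel"
proof (rule equivpI)
  show "reflp torus_rel"
    by (simp add: reflp_def torus_rel_def)
  show "symp torus_rel"
    unfolding symp_def torus_rel_def by (metis Ints_minus minus_diff_eq)
  show "transp torus_rel"
    unfolding transp_def torus_rel_def
    by (metis Ints_add diff_add_cancel add_diff_eq)
qed

quotient_type 'n torus = "real ^ 'n" / torus_rel
  by (rule equivp_torus_rel)

lift_definition to_torus :: "real ^ 'n \<Rightarrow> 'n torus" is "\<lambda>x. x" .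

definition unit_cell :: "(real ^ 'n) set" where
  "unit_cell = {x. \<forall>i. 0 \<le> x $ i \<and> x $ i < 1}"

text \<open>
  Lebesgue measure on the torus is the image, under the quotient map, of Lebesgue measure on a
  fundamental domain; the measurable sets are those with Lebesgue measurable preimage in the
  whole space.
\<close>

definition torus_lebesgue :: "('n::finite) torus measure" where
  "torus_lebesgue =
     distr (lebesgue_on unit_cell) (sigma UNIV {A. to_torus -` A \<in> sets lebesgue}) to_torus"

lemma unit_cell_lebesgue: "(unit_cell :: (real ^ 'n::finite) set) \<in> sets lebesgue"
proof -
  have "unit_cell = (\<Inter>i\<in>UNIV. {x :: real ^ 'n. 0 \<le> x $ i} \<inter> {x. x $ i < 1})"
    by (auto simp: unit_cell_def)
  also have "\<dots> \<in> sets borel"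
    by measurable
  finally show ?thesis
    by (simp add: sets_completionI_sets)
qed

lemma sets_torus_lebesgue:
  "sets (torus_lebesgue :: 'n::finite torus measure) = {A. to_torus -` A \<in> sets lebesgue}"
proof -
  have "sigma_algebra UNIV {A :: 'n torus set. to_torus -` A \<in> sets lebesgue}"
    by (auto simp: sigma_algebra_iff2 vimage_Compl vimage_UN Compl_eq_Diff_UNIV[symmetric]
          Compl_in_sets_lebesgue)
  then show ?thesis
    by (simp add: torus_lebesgue_def sigma_algebra.sigma_sets_eq)
qed

lemma emeasure_torus_lebesgue:
  fixes A :: "('n::finite) torus set"
  assumes "to_torus -` A \<in> sets lebesgue"
  shows "emeasure torus_lebesgue A = emeasure lebesgue (to_torus -` A \<inter> unit_cell)"
proof -
  let ?N = "sigma UNIV {A :: 'n torus set. to_torus -` A \<in> sets lebesgue}"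
  have N: "sets ?N = {A. to_torus -` A \<in> sets lebesgue}"
    using sets_torus_lebesgue by (simp add: torus_lebesgue_def)
  have "to_torus \<in> measurable (lebesgue_on unit_cell) ?N"
  proof (rule measurableI)
    fix B assume "B \<in> sets ?N"
    then show "to_torus -` B \<inter> space (lebesgue_on unit_cell) \<in> sets (lebesgue_on unit_cell)"
      unfolding N using unit_cell_lebesgue
      by (auto simp: sets_restrict_space space_restrict_space)
  qed simp
  moreover have "emeasure (lebesgue_on unit_cell) (to_torus -` A \<inter> unit_cell) =
      emeasure lebesgue (to_torus -` A \<inter> unit_cell)"
    by (rule emeasure_restrict_space) (use unit_cell_lebesgue in auto)
  ultimately show ?thesis
    using assms N
    by (simp add: torus_lebesgue_def emeasure_distr space_restrict_space)
qed

definition hyperspace :: "(real ^ 'n) set \<Rightarrow> bool" where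
  "hyperspace H \<longleftrightarrow> subspace H \<and> dim H = CARD('n) - 1"

text \<open>The library's \<^term>\<open>polyhedron\<close> need be neither bounded nor full-dimensional.\<close>

definition convex_polyhedron :: "(real ^ 'n) set \<Rightarrow> bool" where
  "convex_polyhedron K \<longleftrightarrow> polyhedron K \<and> compact K \<and> interior K \<noteq> {}"

definition torus_polyhedra :: "(real ^ 'n) set set \<Rightarrow> 'n torus set set" where
  "torus_polyhedra X =
     {to_torus ` K | K. convex_polyhedron K \<and> diameter K < 1 \<and>
        (\<forall>F. F facet_of K \<longrightarrow> (\<exists>H\<in>X. affine_parallel H (affine hull F)))}"

definition int_vec_to_real :: "int ^ 'n \<Rightarrow> real ^ 'n" where
  "int_vec_to_real g = (\<chi> i. of_int (g $ i))"

end

theory Submission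
  imports Defs
begin

text \<open>
  The points \<open>j g / m\<close> together with \<open>\<int>\<^sup>d\<close> form a lattice inside the grid \<open>(1/M) \<int>\<^sup>d\<close>, \<open>M = m\<^sup>5\<close>,
  so the discrepancy of a function against this lattice is, by finite Fourier analysis on the grid, at
  most the sum of its Fourier coefficients over the frequencies \<open>\<xi> \<noteq> 0\<close> with \<open>m dvd \<xi> \<cdot> g\<close>. A
  frequency that is not a multiple of \<open>m\<close> is annihilated by a proportion at most \<open>1 / (m - 1)\<close> of
  the vectors \<open>g\<close>; averaging over \<open>g\<close> therefore gives a good \<open>g\<close> as soon as the Fourier
  coefficients of all admissible polyhedra have a common majorant of total mass \<open>O(log\<^sup>d m)\<close>.

  To get this majorant, write the polyhedron as \<open>{x. a \<bullet> x \<le> b a}\<close> with \<open>a\<close> in a fixed finite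
  set \<open>A\<close>, smooth its indicator at scale \<open>1/m\<close>, and split each factor dyadically according to the
  distance \<open>b a - a \<bullet> x \<approx> 2\<^sup>-\<^sup>k\<^sup>(\<^sup>a\<^sup>)\<close> to the corresponding facet. The tile with exponents \<open>k\<close> is
  smooth at the scale of the body \<open>{x. \<bar>a \<bullet> x\<bar> \<le> 2\<^sup>-\<^sup>k\<^sup>(\<^sup>a\<^sup>)}\<close>, which is comparable to the
  parallelepiped cut out by a basis \<open>I \<subseteq> A\<close> maximizing \<open>\<Sum>i\<in>I. k i\<close>. For a given
  polyhedron boundedly many nonempty tiles share the same basis \<open>I\<close> and the same exponents on \<open>I\<close>, so
  only \<open>O(log\<^sup>d m)\<close> parallelepipeds matter, independently of the polyhedron, and the coefficients
  attached to each of them have bounded sum. Moving the facets by \<open>O(1/m)\<close> in both directions passes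
  from smoothed to sharp indicators at the cost of an error \<open>O(1/m)\<close> in volume.
\<close>

section \<open>Iterated differences and smooth steps\<close>


text \<open>The generator must be fixed before the polyhedron is known; hence a majorant that serves
  every right-hand side \<open>b\<close> at once. On a finite grid all Fourier sums are finite and
  differences take the place of derivatives. Two differences in each of the d dual directions give
  decay 1/(1 + y^2), which is summable over the integers; a single one would give 1/|y| and cost
  additional logarithms. The obstacle is the frequencies with all coordinates divisible by
  \<open>m\<close>: every \<open>g\<close> annihilates them, so averaging gains nothing, and their
  mass has to be bounded by O(log^d m / m) directly. The exponent of the logarithm is a count: each
  of the d members of a basis carries one dyadic exponent between 0 and n, where 2^n is comparable
  to m.\<close>

definition dif :: "'a::ab_group_add \<Rightarrow> ('a \<Rightarrow> real) \<Rightarrow> 'a \<Rightarrow> real" where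
  "dif h u x = u (x + h) - u x"

fun difs :: "'a::ab_group_add list \<Rightarrow> ('a \<Rightarrow> real) \<Rightarrow> 'a \<Rightarrow> real" where
  "difs [] u = u"
| "difs (h # hs) u = difs hs (dif h u)"

text \<open>\<open>diff_bounded C [(h\<^sub>1, s\<^sub>1), \<dots>] u\<close>: every difference of \<open>u\<close> along a sublist of the steps
  \<open>h\<^sub>i\<close> is at most \<open>C\<close> times the product of the corresponding \<open>s\<^sub>i\<close>. Quantifying over sublists makes
  the notion stable under products.\<close>

fun diff_bounded :: "real \<Rightarrow> ('a::ab_group_add \<times> real) list \<Rightarrow> ('a \<Rightarrow> real) \<Rightarrow> bool" where
  "diff_bounded C [] u \<longleftrightarrow> (\<forall>x. \<bar>u x\<bar> \<le> C)"
| "diff_bounded C (p # ps) u \<longleftrightarrow> diff_bounded C ps u \<and> diff_bounded (C * snd p) ps (dif (fst p) u)"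

lemma diff_bounded_difs:
  "diff_bounded C ps u \<Longrightarrow> \<bar>difs (map fst ps) u x\<bar> \<le> C * prod_list (map snd ps)"
  by (induction ps arbitrary: C u) (auto simp: mult.assoc, fastforce)

lemma diff_bounded_mono: "diff_bounded C ps u \<Longrightarrow> C \<le> D \<Longrightarrow> (\<And>p. p \<in> set ps \<Longrightarrow> 0 \<le> snd p) \<Longrightarrow> diff_bounded D ps u"
proof (induction ps arbitrary: C D u)
  case Nil then show ?case by (auto intro: order_trans)
next
  case (Cons p ps)
  have "C * snd p \<le> D * snd p" using Cons.prems by (intro mult_right_mono) auto
  then show ?case using Cons by auto
qed

lemma diff_bounded_shift: "diff_bounded C ps u \<Longrightarrow> diff_bounded C ps (\<lambda>x. u (x + v))"
proof (induction ps arbitrary: C u)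
  case (Cons p ps)
  have "dif (fst p) (\<lambda>x. u (x + v)) = (\<lambda>x. dif (fst p) u (x + v))"
    by (auto simp: dif_def fun_eq_iff ac_simps)
  then show ?case using Cons by auto
qed simp

lemma diff_bounded_add:
  "diff_bounded C ps u \<Longrightarrow> diff_bounded D ps v \<Longrightarrow> diff_bounded (C + D) ps (\<lambda>x. u x + v x)"
proof (induction ps arbitrary: C D u v)
  case Nil then show ?case by (auto intro!: abs_triangle_ineq[THEN order_trans] add_mono)
next
  case (Cons p ps)
  have "dif (fst p) (\<lambda>x. u x + v x) = (\<lambda>x. dif (fst p) u x + dif (fst p) v x)"
    by (auto simp: dif_def fun_eq_iff)
  then show ?case using Cons by (auto simp: distrib_right)
qed

lemma diff_bounded_uminus: "diff_bounded C ps u \<Longrightarrow> diff_bounded C ps (\<lambda>x. - u x)"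
proof (induction ps arbitrary: C u)
  case (Cons p ps)
  have "dif (fst p) (\<lambda>x. - u x) = (\<lambda>x. - dif (fst p) u x)"
    by (auto simp: dif_def fun_eq_iff)
  then show ?case using Cons by auto
qed simp

lemma diff_bounded_diff:
  "diff_bounded C ps u \<Longrightarrow> diff_bounded D ps v \<Longrightarrow> diff_bounded (C + D) ps (\<lambda>x. u x - v x)"
  using diff_bounded_add[of C ps u D "\<lambda>x. - v x"] diff_bounded_uminus[of D ps v] by simp

lemma diff_bounded_nonneg: "diff_bounded C ps u \<Longrightarrow> 0 \<le> C"
  by (induction ps arbitrary: u) (auto intro: order_trans[OF abs_ge_zero])

text \<open>Discrete Leibniz rule: each step splits the product into two terms, hence the factor
  \<open>2 ^ length ps\<close>. Each factor of the product receives only some of the steps, which is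
  why bounds over all sublists are required.\<close>

lemma diff_bounded_mult:
  "diff_bounded C ps u \<Longrightarrow> diff_bounded D ps v \<Longrightarrow> (\<And>p. p \<in> set ps \<Longrightarrow> 0 \<le> snd p) \<Longrightarrow>
    diff_bounded (2 ^ length ps * (C * D)) ps (\<lambda>x. u x * v x)"
proof (induction ps arbitrary: C D u v)
  case Nil
  then show ?case by (auto simp: abs_mult intro!: mult_mono intro: order_trans[OF abs_ge_zero])
next
  case (Cons p ps)
  have eq: "dif (fst p) (\<lambda>x. u x * v x) = (\<lambda>x. dif (fst p) u x * v (x + fst p) + u x * dif (fst p) v x)"
    by (auto simp: dif_def fun_eq_iff algebra_simps)
  have b: "diff_bounded (2 ^ length ps * (C * D)) ps (\<lambda>x. u x * v x)"
    using Cons by auto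
  have "0 \<le> 2 ^ length ps * (C * D)"
    using b by (rule diff_bounded_nonneg)
  then have 1: "diff_bounded (2 ^ length (p # ps) * (C * D)) ps (\<lambda>x. u x * v x)"
    by (intro diff_bounded_mono[OF b] mult_right_mono)
      (use Cons.prems diff_bounded_nonneg in \<open>auto intro!: mult_nonneg_nonneg\<close>)
  have "diff_bounded (2 ^ length ps * ((C * snd p) * D) + 2 ^ length ps * (C * (D * snd p))) ps
     (dif (fst p) (\<lambda>x. u x * v x))"
    unfolding eq by (rule diff_bounded_add; rule Cons.IH) (use Cons.prems in \<open>auto intro: diff_bounded_shift\<close>)
  then show ?case using 1 by (simp add: algebra_simps)
qed

lemma diff_bounded_zero: "0 \<le> C \<Longrightarrow> (\<And>p. p \<in> set ps \<Longrightarrow> 0 \<le> snd p) \<Longrightarrow> diff_bounded C ps (\<lambda>_. 0)"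
  by (induction ps arbitrary: C) (auto simp: dif_def[abs_def])

lemma diff_bounded_one: "(\<And>p. p \<in> set ps \<Longrightarrow> 0 \<le> snd p) \<Longrightarrow> diff_bounded 1 ps (\<lambda>_. 1)"
  by (induction ps) (auto simp: dif_def[abs_def] intro!: diff_bounded_zero)

lemma diff_bounded_prod:
  assumes "finite A" and "\<And>p. p \<in> set ps \<Longrightarrow> 0 \<le> snd p"
    and "\<And>a. a \<in> A \<Longrightarrow> diff_bounded C ps (u a)"
  shows "diff_bounded ((2 ^ length ps * C) ^ card A) ps (\<lambda>x. \<Prod>a\<in>A. u a x)"
  using assms
proof (induction A)
  case empty
  then show ?case by (simp add: diff_bounded_one)
next
  case (insert a A)
  then have "diff_bounded (2 ^ length ps * (C * (2 ^ length ps * C) ^ card A)) ps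
      (\<lambda>x. u a x * (\<Prod>a\<in>A. u a x))"
    by (intro diff_bounded_mult) auto
  with insert.hyps show ?case by (simp add: mult.assoc)
qed

text \<open>Carries one-variable smoothness over to the grid: along an additive \<open>L\<close>, a
  step h acts on \<open>u\<close> as the real step L h, and any size that dominates |L h| may be
  recorded for it.\<close>

lemma diff_bounded_compose:
  fixes L :: "'a::ab_group_add \<Rightarrow> real"
  assumes L: "\<And>x y. L (x + y) = L x + L y"
  shows "diff_bounded C (map (\<lambda>p. (L (fst p), \<bar>L (fst p)\<bar>)) ps) u \<Longrightarrow>
    (\<And>p. p \<in> set ps \<Longrightarrow> \<bar>L (fst p)\<bar> \<le> snd p) \<Longrightarrow> diff_bounded C ps (\<lambda>x. u (L x + c))"
proof (induction ps arbitrary: C u)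
  case (Cons p ps)
  have nn: "\<And>q. q \<in> set ps \<Longrightarrow> 0 \<le> snd q"
    using Cons.prems(2) by (meson abs_ge_zero list.set_intros(2) order_trans)
  have eq: "dif (fst p) (\<lambda>x. u (L x + c)) = (\<lambda>x. dif (L (fst p)) u (L x + c))"
    by (auto simp: dif_def fun_eq_iff L algebra_simps)
  have "diff_bounded (C * \<bar>L (fst p)\<bar>) ps (\<lambda>x. dif (L (fst p)) u (L x + c))"
    using Cons by auto
  moreover have "C * \<bar>L (fst p)\<bar> \<le> C * snd p"
    using Cons.prems diff_bounded_nonneg by (intro mult_left_mono) auto
  ultimately have "diff_bounded (C * snd p) ps (\<lambda>x. dif (L (fst p)) u (L x + c))"
    using nn by (rule diff_bounded_mono)
  then show ?case using Cons by (auto simp: eq)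
qed simp

text \<open>Plays the role of bounded derivatives up to order \<open>P\<close>, with differences of
  arbitrary real steps in their place.\<close>

definition smooth_upto :: "nat \<Rightarrow> real \<Rightarrow> (real \<Rightarrow> real) \<Rightarrow> bool" where
  "smooth_upto P C u \<longleftrightarrow> (\<forall>ts. length ts \<le> P \<longrightarrow> diff_bounded C (map (\<lambda>t. (t, \<bar>t\<bar>)) ts) u)"

text \<open>The mean value theorem produces the factor |t| when no further step is left; the
  remaining differences commute with \<open>dif t\<close> and with differentiation, so the induction
  passes to \<open>dif (fst p) u\<close> and its derivative.\<close>

lemma diff_bounded_derivative:
  fixes u :: "real \<Rightarrow> real"
  assumes "\<And>x. (u has_real_derivative u' x) (at x)"
    and "diff_bounded C ps u'"
  shows "diff_bounded (C * \<bar>t\<bar>) ps (dif t u)"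
  using assms
proof (induction ps arbitrary: C u u')
  case Nil
  have "\<bar>dif t u x\<bar> \<le> C * \<bar>t\<bar>" for x
    using field_differentiable_bound[of UNIV u u' C x "x + t"] Nil
    by (simp add: dif_def field_differentiable_def)
  then show ?case by simp
next
  case (Cons p ps)
  have "(dif (fst p) u has_real_derivative dif (fst p) u' x) (at x)" for x
    unfolding dif_def[abs_def]
    using Cons.prems(1) by (auto intro!: derivative_eq_intros DERIV_shift[THEN iffD1])
  moreover have "diff_bounded (C * snd p) ps (dif (fst p) u')" using Cons.prems(2) by simp
  ultimately have "diff_bounded (C * snd p * \<bar>t\<bar>) ps (dif t (dif (fst p) u))"
    by (rule Cons.IH)
  moreover have "dif t (dif (fst p) u) = dif (fst p) (dif t u)"
    by (auto simp: dif_def fun_eq_iff ac_simps)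
  moreover have "diff_bounded (C * \<bar>t\<bar>) ps (dif t u)"
    using Cons by (auto intro: Cons.IH)
  ultimately show ?case by (simp add: ac_simps)
qed

lemma continuous_antiderivative:
  fixes u :: "real \<Rightarrow> real"
  assumes "continuous_on UNIV u"
  obtains U where "\<And>x. (U has_real_derivative u x) (at x)"
proof -
  have "\<exists>F. \<forall>x. -\<infinity> < ereal x \<longrightarrow> ereal x < \<infinity> \<longrightarrow> (F has_vector_derivative u x) (at x)"
    using assms by (intro einterval_antiderivative) (auto simp: continuous_on_eq_continuous_at)
  then show thesis using that by (auto simp: has_real_derivative_iff_has_vector_derivative)
qed

text \<open>Averaging over a unit interval turns a bounded function with controlled differences of order
  \<open>P\<close> into one of order \<open>P + 1\<close>.\<close>

lemma smooth_step_exists: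
  "\<exists>S C. smooth_upto P C S \<and> continuous_on UNIV S \<and> (\<forall>t. 0 \<le> S t \<and> S t \<le> 1) \<and>
    (\<forall>t\<le>0. S t = 0) \<and> (\<forall>t\<ge>real P + 1. S t = 1)"
proof (induction P)
  case 0
  show ?case
    by (intro exI[of _ "\<lambda>t. max 0 (min 1 t)"] exI[of _ 1])
      (auto simp: smooth_upto_def intro!: continuous_intros)
next
  case (Suc P)
  then obtain S C where S: "smooth_upto P C S" "continuous_on UNIV S" "\<And>t. 0 \<le> S t" "\<And>t. S t \<le> 1"
    "\<And>t. t \<le> 0 \<Longrightarrow> S t = 0" "\<And>t. t \<ge> real P + 1 \<Longrightarrow> S t = 1" by blast
  obtain U where U: "\<And>x. (U has_real_derivative S x) (at x)"
    using continuous_antiderivative S(2) by blast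
  define T where "T t = U t - U (t - 1)" for t
  have T': "(T has_real_derivative S t - S (t - 1)) (at t)" for t
    unfolding T_def[abs_def]
    using DERIV_diff[OF U[of t] DERIV_shift[THEN iffD1, of U "S (t - 1)" t "-1"]] U by simp
  \<comment> \<open>\<open>T t\<close> is a value of \<open>S\<close> in (t - 1, t). This transfers
    the range and both constant pieces; the right one starts one unit later, at P + 2.\<close>
  have mv: "\<exists>s. t - 1 < s \<and> s < t \<and> T t = S s" for t
    using MVT2[of "t - 1" t U S] U unfolding T_def by force
  \<comment> \<open>The 1 bounds \<open>T\<close> itself, and \<open>2 * C\<close> bounds its
    derivative S t - S (t - 1).\<close>
  have "diff_bounded (max 1 (2 * C)) (map (\<lambda>t. (t, \<bar>t\<bar>)) ts) T" if "length ts \<le> Suc P" for ts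
    using that
  proof (induction ts)
    case Nil
    have "\<bar>T x\<bar> \<le> 1" for x using mv[of x] S(3,4) by (metis abs_of_nonneg)
    then show ?case by (simp add: le_max_iff_disj)
  next
    case (Cons t ts)
    have "diff_bounded C (map (\<lambda>t. (t, \<bar>t\<bar>)) ts) S"
      using Cons.prems S(1) by (simp add: smooth_upto_def)
    then have "diff_bounded (C + C) (map (\<lambda>t. (t, \<bar>t\<bar>)) ts) (\<lambda>t. S t - S (t - 1))"
      by (intro diff_bounded_diff) (use diff_bounded_shift[of C _ S "-1"] in auto)
    then have "diff_bounded (max 1 (2 * C)) (map (\<lambda>t. (t, \<bar>t\<bar>)) ts) (\<lambda>t. S t - S (t - 1))"
      by (rule diff_bounded_mono) auto
    then have "diff_bounded (max 1 (2 * C) * \<bar>t\<bar>) (map (\<lambda>t. (t, \<bar>t\<bar>)) ts) (dif t T)"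
      by (rule diff_bounded_derivative[OF T'])
    then show ?case using Cons by simp
  qed
  then have "smooth_upto (Suc P) (max 1 (2 * C)) T" by (simp add: smooth_upto_def)
  moreover have "continuous_on UNIV T"
    using T' by (meson DERIV_isCont continuous_at_imp_continuous_on)
  moreover have "0 \<le> T t \<and> T t \<le> 1" for t using mv[of t] S(3,4) by metis
  moreover have "T t = 0" if "t \<le> 0" for t using mv[of t] S(5) that by force
  moreover have "T t = 1" if "t \<ge> real (Suc P) + 1" for t using mv[of t] S(6) that by force
  ultimately show ?case by blast
qed

text \<open>For rescaled arguments such as \<open>th (2 * t)\<close>: stretching all steps by
  \<open>c\<close> costs at most one factor \<open>c\<close> per step.\<close>

lemma diff_bounded_scale:
  "diff_bounded C (map (\<lambda>p. (fst p, c * snd p)) ps) u \<Longrightarrow> 1 \<le> c \<Longrightarrow> (\<And>p. p \<in> set ps \<Longrightarrow> 0 \<le> snd p) \<Longrightarrow>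
    diff_bounded (C * c ^ length ps) ps u"
proof (induction ps arbitrary: C u)
  case (Cons p ps)
  have "diff_bounded (C * c ^ length ps) ps u" using Cons by auto
  moreover have "C * c ^ length ps \<le> C * c ^ length (p # ps)"
    using Cons.prems diff_bounded_nonneg by (intro mult_left_mono power_increasing) auto
  ultimately have 1: "diff_bounded (C * c ^ length (p # ps)) ps u"
    by (rule diff_bounded_mono) (use Cons.prems in auto)
  have "diff_bounded (C * (c * snd p) * c ^ length ps) ps (dif (fst p) u)"
    using Cons by auto
  with 1 show ?case by (simp add: ac_simps)
qed simp

section \<open>Fourier analysis on the grid\<close>


abbreviation rvec :: "int ^ 'n \<Rightarrow> real ^ 'n" where
  "rvec \<equiv> int_vec_to_real"

definition zdot :: "int ^ 'n \<Rightarrow> int ^ 'n \<Rightarrow> int" where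
  "zdot \<xi> z = (\<Sum>i\<in>UNIV. \<xi> $ i * z $ i)"

lemma zdot_diff_right: "zdot \<xi> (y - z) = zdot \<xi> y - zdot \<xi> z"
  by (simp add: zdot_def right_diff_distrib sum_subtractf)

lemma int_vec_to_real_add: "rvec (y + z) = rvec y + rvec z"
  by (simp add: int_vec_to_real_def vec_eq_iff)

lemma int_vec_to_real_nth [simp]: "rvec z $ i = real_of_int (z $ i)"
  by (simp add: int_vec_to_real_def)

lemma zdot_inner: "real_of_int (zdot \<xi> z) = rvec \<xi> \<bullet> rvec z"
  by (simp add: zdot_def inner_vec_def)

section \<open>Additive characters modulo M and their orthogonality\<close>

definition zchar :: "nat \<Rightarrow> int \<Rightarrow> complex" where
  "zchar M t = cis (2 * pi * real_of_int t / real M)"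

lemma zchar_0 [simp]: "zchar M 0 = 1"
  by (simp add: zchar_def)

lemma norm_zchar [simp]: "norm (zchar M t) = 1"
  by (simp add: zchar_def)

lemma zchar_add: "zchar M (s + t) = zchar M s * zchar M t"
  by (simp add: zchar_def cis_mult distrib_left add_divide_distrib)

lemma zchar_sum: "finite A \<Longrightarrow> zchar M (\<Sum>x\<in>A. f x) = (\<Prod>x\<in>A. zchar M (f x))"
  by (induction A rule: finite_induct) (auto simp: zchar_add)

lemma zchar_eq_1_iff:
  assumes "M > 0" shows "zchar M t = 1 \<longleftrightarrow> int M dvd t"
proof -
  have "zchar M t = 1 \<longleftrightarrow> (\<exists>n. 2 * pi * real_of_int t / real M = of_int (2 * n) * pi)"
    by (simp add: zchar_def cis_conv_exp exp_eq_1 mult.commute mult.left_commute)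
  also have "\<dots> \<longleftrightarrow> (\<exists>n. real_of_int t = real_of_int (int M * n))"
    using assms by (simp add: field_simps)
  also have "\<dots> \<longleftrightarrow> int M dvd t" unfolding dvd_def of_int_eq_iff ..
  finally show ?thesis .
qed

lemma zchar_cong: "M > 0 \<Longrightarrow> int M dvd s - t \<Longrightarrow> zchar M s = zchar M t"
  using zchar_add[of M "s - t" t] zchar_eq_1_iff[of M "s - t"] by simp

lemma zchar_scale: "m > 0 \<Longrightarrow> q > 0 \<Longrightarrow> zchar (m * q) (int q * s) = zchar m s"
  by (simp add: zchar_def mult.assoc)

text \<open>Multiplication by \<open>zchar M t\<close> shifts the summation window by one, and the
  two end terms agree modulo \<open>M\<close>. The free left end \<open>l\<close> covers both the
  centred frequencies and the indices 1, ..., m.\<close>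

lemma sum_zchar:
  assumes "M > 0"
  shows "(\<Sum>x\<in>{l..<l + int M}. zchar M (x * t)) = (if int M dvd t then of_nat M else 0)"
proof (cases "int M dvd t")
  case True
  then have "zchar M (x * t) = 1" for x using assms by (simp add: zchar_eq_1_iff)
  then show ?thesis using True by simp
next
  case False
  let ?S = "\<Sum>x\<in>{l..<l + int M}. zchar M (x * t)"
  have "?S * zchar M t = (\<Sum>x\<in>{l..<l + int M}. zchar M ((x + 1) * t))"
    by (simp add: sum_distrib_right distrib_right zchar_add)
  also have "\<dots> = (\<Sum>x\<in>{l+1..<l + int M + 1}. zchar M (x * t))"
    by (rule sum.reindex_bij_witness[of _ "\<lambda>x. x - 1" "\<lambda>x. x + 1"]) auto
  finally have e: "?S * zchar M t = (\<Sum>x\<in>{l+1..<l + int M + 1}. zchar M (x * t))" .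
  have "{l..<l + int M} = insert l {l+1..<l + int M}" "{l+1..<l + int M + 1} = insert (l + int M) {l+1..<l + int M}"
    using assms by auto
  moreover have "zchar M ((l + int M) * t) = zchar M (l * t)"
    using assms by (intro zchar_cong) (auto simp: algebra_simps)
  ultimately have "?S * zchar M t = ?S" using e by simp
  then show ?thesis using False zchar_eq_1_iff[OF assms] by simp
qed

text \<open>Centred residues modulo \<open>M\<close>: they keep \<xi>_j / M in [-1/2, 1/2], where
  the distance of a character value from 1 is at least |\<xi>_j / M|.\<close>

definition freq_box :: "nat \<Rightarrow> (int ^ 'n) set" where
  "freq_box M = {\<xi>. \<forall>i. \<xi> $ i \<in> {- int (M div 2)..<- int (M div 2) + int M}}"

lemma finite_sum_vec_box:
  fixes B :: "'n::finite \<Rightarrow> int set" and f :: "'n \<Rightarrow> int \<Rightarrow> 'b::comm_semiring_1"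
  assumes "\<And>i. finite (B i)"
  shows "finite {\<xi>. \<forall>i. \<xi> $ i \<in> B i}"
    and "(\<Sum>\<xi> | \<forall>i. \<xi> $ i \<in> B i. \<Prod>i\<in>UNIV. f i (\<xi> $ i)) = (\<Prod>i\<in>UNIV. \<Sum>x\<in>B i. f i x)"
    and "card {\<xi>. \<forall>i. \<xi> $ i \<in> B i} = (\<Prod>i\<in>UNIV. card (B i))"
proof -
  have b: "bij_betw (\<lambda>h. \<chi> i. h i) (PiE UNIV B) {\<xi>. \<forall>i. \<xi> $ i \<in> B i}"
    by (rule bij_betw_byWitness[where f' = "($)"]) auto
  then show "finite {\<xi>. \<forall>i. \<xi> $ i \<in> B i}"
    using bij_betw_finite finite_PiE[of UNIV B] assms by auto
  show "card {\<xi>. \<forall>i. \<xi> $ i \<in> B i} = (\<Prod>i\<in>UNIV. card (B i))"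
    using bij_betw_same_card[OF b] by (simp add: card_PiE)
  have "(\<Sum>\<xi> | \<forall>i. \<xi> $ i \<in> B i. \<Prod>i\<in>UNIV. f i (\<xi> $ i)) = (\<Sum>h\<in>PiE UNIV B. \<Prod>i\<in>UNIV. f i (h i))"
    using sum.reindex_bij_betw[OF b, of "\<lambda>\<xi>. \<Prod>i\<in>UNIV. f i (\<xi> $ i)"] by simp
  also have "\<dots> = (\<Prod>i\<in>UNIV. \<Sum>x\<in>B i. f i x)"
    using prod_sum_PiE[of UNIV B f] assms by simp
  finally show "(\<Sum>\<xi> | \<forall>i. \<xi> $ i \<in> B i. \<Prod>i\<in>UNIV. f i (\<xi> $ i)) = (\<Prod>i\<in>UNIV. \<Sum>x\<in>B i. f i x)" .
qed

lemma finite_freq_box: "finite (freq_box M)"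
  unfolding freq_box_def by (rule finite_sum_vec_box) auto

lemma card_freq_box: "card (freq_box M :: (int ^ 'n) set) = M ^ CARD('n)"
  unfolding freq_box_def by (subst finite_sum_vec_box) auto

lemma zero_in_freq_box: "M > 0 \<Longrightarrow> 0 \<in> freq_box M"
  by (auto simp: freq_box_def)

lemma freq_box_bound: "\<xi> \<in> freq_box M \<Longrightarrow> \<bar>real_of_int (\<xi> $ i)\<bar> \<le> real M / 2"
proof -
  assume "\<xi> \<in> freq_box M"
  then have "- int (M div 2) \<le> \<xi> $ i" "\<xi> $ i < - int (M div 2) + int M"
    by (auto simp: freq_box_def)
  then have "2 * \<bar>\<xi> $ i\<bar> \<le> int M" by linarith
  then have "real_of_int (2 * \<bar>\<xi> $ i\<bar>) \<le> real_of_int (int M)" by (simp only: of_int_le_iff)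
  then show ?thesis by simp
qed

lemma sum_zchar_freq_box:
  assumes "M > 0"
  shows "(\<Sum>\<xi>\<in>freq_box M. zchar M (zdot \<xi> (t :: int ^ 'n))) =
    (if \<forall>i. int M dvd t $ i then of_nat (M ^ CARD('n)) else 0)"
proof -
  have "(\<Sum>\<xi>\<in>freq_box M. zchar M (zdot \<xi> t)) =
    (\<Prod>i\<in>UNIV. \<Sum>x\<in>{- int (M div 2)..<- int (M div 2) + int M}. zchar M (x * t $ i))"
    unfolding zdot_def freq_box_def zchar_sum[OF finite] by (rule finite_sum_vec_box(2)) simp
  also have "\<dots> = (\<Prod>i\<in>UNIV. if int M dvd t $ i then of_nat M else 0)"
    by (intro prod.cong refl sum_zchar assms)
  also have "\<dots> = (if \<forall>i. int M dvd t $ i then of_nat (M ^ CARD('n)) else 0)"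
    by (auto simp: prod_zero_iff)
  finally show ?thesis .
qed

text \<open>Multiplicity of the grid point z / M, with M = m q, among the points j g / m modulo Z^d;
  clearing denominators turns it into a divisibility condition.\<close>

definition lat_count :: "nat \<Rightarrow> nat \<Rightarrow> int ^ 'n \<Rightarrow> int ^ 'n \<Rightarrow> nat" where
  "lat_count m q g z = card {j\<in>{1..m}. \<forall>i. int (m * q) dvd int j * int q * g $ i - z $ i}"

text \<open>The condition m | \<xi> . g is itself an average of characters over j. After exchanging
  the sums, the sum over the frequency box detects exactly the j with j q g = z modulo m q.\<close>

lemma sum_zchar_annihilator:
  assumes "m > 0" "q > 0"
  shows "(\<Sum>\<xi> | \<xi> \<in> freq_box (m * q) \<and> int m dvd zdot \<xi> g. zchar (m * q) (- zdot \<xi> (z :: int ^ 'n))) =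
    of_nat ((m * q) ^ CARD('n)) / of_nat m * of_nat (lat_count m q g z)"
proof -
  let ?M = "m * q"
  have M: "?M > 0" using assms by simp
  have one: "(\<Sum>j\<in>{1..m}. zchar ?M (int j * int q * s)) = (if int m dvd s then of_nat m else 0)" for s
  proof -
    have "(\<Sum>j\<in>{1..m}. zchar ?M (int j * int q * s)) = (\<Sum>j\<in>{1..m}. zchar m (int j * s))"
      using assms by (intro sum.cong refl) (metis zchar_scale mult.assoc mult.left_commute)
    also have "\<dots> = (\<Sum>x\<in>{1..<1 + int m}. zchar m (x * s))"
      by (rule sum.reindex_bij_witness[of _ nat int]) auto
    finally show ?thesis using sum_zchar[OF assms(1)] by simp
  qed
  have "(\<Sum>\<xi> | \<xi> \<in> freq_box ?M \<and> int m dvd zdot \<xi> g. zchar ?M (- zdot \<xi> z)) =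
    (\<Sum>\<xi>\<in>freq_box ?M. if int m dvd zdot \<xi> g then zchar ?M (- zdot \<xi> z) else 0)"
    by (simp add: sum.inter_filter[symmetric] finite_freq_box)
  also have "\<dots> = (\<Sum>\<xi>\<in>freq_box ?M. (1 / of_nat m) *
      (\<Sum>j\<in>{1..m}. zchar ?M (zdot \<xi> ((\<chi> i. int j * int q * g $ i) - z))))"
  proof (intro sum.cong refl)
    fix \<xi>
    have eq: "zdot \<xi> ((\<chi> i. int j * int q * g $ i) - z) = int j * int q * zdot \<xi> g + - zdot \<xi> z" for j
      by (simp add: zdot_diff_right) (simp add: zdot_def sum_distrib_left ac_simps)
    show "(if int m dvd zdot \<xi> g then zchar ?M (- zdot \<xi> z) else 0) = (1 / of_nat m) *
      (\<Sum>j\<in>{1..m}. zchar ?M (zdot \<xi> ((\<chi> i. int j * int q * g $ i) - z)))"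
      unfolding eq zchar_add sum_distrib_right[symmetric] one using assms by simp
  qed
  also have "\<dots> = (1 / of_nat m) *
      (\<Sum>j\<in>{1..m}. \<Sum>\<xi>\<in>freq_box ?M. zchar ?M (zdot \<xi> ((\<chi> i. int j * int q * g $ i) - z)))"
    by (simp only: sum_distrib_left[symmetric]) (subst sum.swap, rule refl)
  also have "\<dots> = (1 / of_nat m) * (\<Sum>j\<in>{1..m}.
      if \<forall>i. int ?M dvd int j * int q * g $ i - z $ i then of_nat (?M ^ CARD('n)) else 0)"
    by (subst sum_zchar_freq_box[OF M]) simp
  also have "\<dots> = (1 / of_nat m) * (of_nat (lat_count m q g z) * of_nat (?M ^ CARD('n)))"
    by (subst sum.inter_filter[symmetric]) (simp_all add: lat_count_def)
  finally show ?thesis by simp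
qed

text \<open>Fourier transform modulo \<open>M\<close> of the periodization of \<open>F\<close>,
  without the factor M^(-d). As \<open>F\<close> lives on all of Z^d, a polyhedron crossing the
  boundary of a unit cell needs no cutting.\<close>

definition ghat :: "nat \<Rightarrow> (int ^ 'n \<Rightarrow> real) \<Rightarrow> int ^ 'n \<Rightarrow> complex" where
  "ghat M F \<xi> = (\<Sum>z | F z \<noteq> 0. of_real (F z) * zchar M (- zdot \<xi> z))"

lemma ghat_superset:
  assumes "finite A" "{z. F z \<noteq> 0} \<subseteq> A"
  shows "ghat M F \<xi> = (\<Sum>z\<in>A. of_real (F z) * zchar M (- zdot \<xi> z))"
  unfolding ghat_def by (rule sum.mono_neutral_left) (use assms in auto)

lemma norm_ghat_le:
  assumes "finite A" "{z. F z \<noteq> 0} \<subseteq> A" "\<And>z. \<bar>F z\<bar> \<le> B"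
  shows "norm (ghat M F \<xi>) \<le> B * card A"
proof -
  have "norm (ghat M F \<xi>) \<le> (\<Sum>z\<in>A. B)"
    unfolding ghat_superset[OF assms(1,2)] using assms(3)
    by (intro order_trans[OF norm_sum] sum_mono) (simp add: norm_mult)
  then show ?thesis by (simp add: mult.commute)
qed

lemma finite_support_shift:
  fixes F :: "'a::ab_group_add \<Rightarrow> real"
  assumes "finite {z. F z \<noteq> 0}"
  shows "finite {z. F (z + h) \<noteq> 0}"
  using finite_vimageI[OF assms, of "\<lambda>z. z + h"] by (simp add: vimage_def inj_def)

lemma finite_support_dif:
  fixes F :: "'a::ab_group_add \<Rightarrow> real"
  assumes "finite {z. F z \<noteq> 0}"
  shows "finite {z. dif h F z \<noteq> 0}"
  by (rule finite_subset[of _ "{z. F z \<noteq> 0} \<union> {z. F (z + h) \<noteq> 0}"])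
    (use assms finite_support_shift[OF assms] in \<open>auto simp: dif_def\<close>)

text \<open>Summation by parts; dividing by the factor \<open>zchar M (zdot \<xi> h) - 1\<close> is
  the source of all decay estimates below.\<close>

lemma ghat_dif:
  assumes "finite {z. F z \<noteq> 0}"
  shows "ghat M (dif h F) \<xi> = (zchar M (zdot \<xi> h) - 1) * ghat M F \<xi>"
proof -
  let ?A = "{z. F z \<noteq> 0} \<union> {z. F (z + h) \<noteq> 0}"
  have A: "finite ?A" using assms finite_support_shift[OF assms] by auto
  have 1: "(\<Sum>z\<in>?A. of_real (F (z + h)) * zchar M (- zdot \<xi> z)) = zchar M (zdot \<xi> h) * ghat M F \<xi>"
  proof -
    have "(\<Sum>z\<in>?A. of_real (F (z + h)) * zchar M (- zdot \<xi> z)) =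
      (\<Sum>z\<in>{z. F (z + h) \<noteq> 0}. of_real (F (z + h)) * zchar M (- zdot \<xi> z))"
      by (rule sum.mono_neutral_right) (use A in auto)
    also have "\<dots> = (\<Sum>z | F z \<noteq> 0. of_real (F z) * zchar M (- zdot \<xi> (z - h)))"
      by (rule sum.reindex_bij_witness[of _ "\<lambda>z. z - h" "\<lambda>z. z + h"]) auto
    also have "\<dots> = zchar M (zdot \<xi> h) * ghat M F \<xi>"
    proof -
      have "zchar M (- zdot \<xi> (z - h)) = zchar M (zdot \<xi> h) * zchar M (- zdot \<xi> z)" for z
        by (simp add: zdot_diff_right flip: zchar_add)
      then show ?thesis by (simp add: ghat_def sum_distrib_left ac_simps)
    qed
    finally show ?thesis .
  qed
  have "ghat M (dif h F) \<xi> = (\<Sum>z\<in>?A. of_real (dif h F z) * zchar M (- zdot \<xi> z))"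
    by (rule ghat_superset) (use A in \<open>auto simp: dif_def\<close>)
  also have "\<dots> = (\<Sum>z\<in>?A. of_real (F (z + h)) * zchar M (- zdot \<xi> z)) -
      (\<Sum>z\<in>?A. of_real (F z) * zchar M (- zdot \<xi> z))"
    by (simp add: dif_def sum_subtractf left_diff_distrib)
  also have "(\<Sum>z\<in>?A. of_real (F z) * zchar M (- zdot \<xi> z)) = ghat M F \<xi>"
    by (rule ghat_superset[symmetric]) (use A in auto)
  finally show ?thesis unfolding 1 by (simp add: left_diff_distrib)
qed

lemma ghat_difs:
  assumes "finite {z. F z \<noteq> 0}"
  shows "norm (ghat M (difs hs F) \<xi>) = (\<Prod>h\<leftarrow>hs. norm (zchar M (zdot \<xi> h) - 1)) * norm (ghat M F \<xi>)"
  using assms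
proof (induction hs arbitrary: F)
  case (Cons h hs)
  then show ?case using Cons.IH[OF finite_support_dif[OF Cons.prems]]
    by (simp add: ghat_dif norm_mult)
qed simp

text \<open>The witness \<open>v\<close> is the sum of some of the steps. Bounding every additive
  \<open>L\<close> on the same \<open>v\<close> allows the slabs of a whole basis to be treated
  together.\<close>

lemma support_difs:
  fixes F :: "'a::ab_group_add \<Rightarrow> real"
  assumes "difs hs F z \<noteq> 0"
  shows "\<exists>v. F (z + v) \<noteq> 0 \<and>
    (\<forall>L :: 'a \<Rightarrow> real. (\<forall>x y. L (x + y) = L x + L y) \<longrightarrow> \<bar>L v\<bar> \<le> (\<Sum>h\<leftarrow>hs. \<bar>L h\<bar>))"
  using assms
proof (induction hs arbitrary: F)
  case Nil
  have "L 0 = 0" if "\<forall>x y. L (x + y) = L x + L y" for L :: "'a \<Rightarrow> real"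
    using that[rule_format, of 0 0] by simp
  then show ?case using Nil by (intro exI[of _ 0]) auto
next
  case (Cons h hs)
  then obtain v where v: "dif h F (z + v) \<noteq> 0"
    "\<And>L :: 'a \<Rightarrow> real. (\<forall>x y. L (x + y) = L x + L y) \<Longrightarrow> \<bar>L v\<bar> \<le> (\<Sum>h\<leftarrow>hs. \<bar>L h\<bar>)"
    by force
  from v(1) consider "F (z + v) \<noteq> 0" | "F (z + (v + h)) \<noteq> 0" by (force simp: dif_def add.assoc)
  then show ?case
  proof cases
    case 1
    then show ?thesis using v(2) by (intro exI[of _ v]) (force intro: order_trans)
  next
    case 2
    have "\<bar>L (v + h)\<bar> \<le> (\<Sum>h\<leftarrow>h # hs. \<bar>L h\<bar>)" if "\<forall>x y. L (x + y) = L x + L y" for L :: "'a \<Rightarrow> real"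
      using v(2)[OF that] that by (simp add: abs_le_iff) (smt (verit))
    then show ?thesis using 2 by blast
  qed
qed

text \<open>Poisson summation: adding \<open>ghat\<close> over the frequencies with m | \<xi> . g
  recovers the lattice sum times M^d / m. The zero frequency is the plain grid sum, and the triangle
  inequality bounds the rest.\<close>

lemma grid_poisson_bound:
  fixes F :: "int ^ 'n \<Rightarrow> real"
  assumes fin: "finite {z. F z \<noteq> 0}" and "m > 0" "q > 0"
  shows "\<bar>(\<Sum>z | F z \<noteq> 0. F z * lat_count m q g z) / m - (\<Sum>z | F z \<noteq> 0. F z) / (m * q) ^ CARD('n)\<bar>
    \<le> (\<Sum>\<xi> | \<xi> \<in> freq_box (m * q) - {0} \<and> int m dvd zdot \<xi> g. norm (ghat (m * q) F \<xi>)) / (m * q) ^ CARD('n)"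
proof -
  let ?M = "m * q" and ?S = "{z. F z \<noteq> 0}"
  let ?X = "{\<xi>. \<xi> \<in> freq_box ?M \<and> int m dvd zdot \<xi> g}"
  let ?Y = "{\<xi>. \<xi> \<in> freq_box ?M - {0} \<and> int m dvd zdot \<xi> g}"
  let ?P = "real (?M ^ CARD('n))"
  have P: "?P > 0" using assms by simp
  have "(\<Sum>\<xi>\<in>?X. ghat ?M F \<xi>) = (\<Sum>z\<in>?S. of_real (F z) * (\<Sum>\<xi>\<in>?X. zchar ?M (- zdot \<xi> z)))"
    unfolding ghat_def by (subst sum.swap) (simp add: sum_distrib_left)
  also have "\<dots> = (\<Sum>z\<in>?S. of_real (F z) * (of_nat (?M ^ CARD('n)) / of_nat m * of_nat (lat_count m q g z)))"
    by (subst sum_zchar_annihilator) (use assms in auto)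
  also have "\<dots> = of_real (?P * ((\<Sum>z\<in>?S. F z * lat_count m q g z) / m))"
    by (simp add: sum_distrib_left sum_divide_distrib ac_simps)
  finally have 1: "(\<Sum>\<xi>\<in>?X. ghat ?M F \<xi>) = of_real (?P * ((\<Sum>z\<in>?S. F z * lat_count m q g z) / m))" .
  have "?X = insert 0 ?Y"
    using zero_in_freq_box[of ?M] assms by (auto simp: zdot_def)
  moreover have "finite ?Y" using finite_freq_box by (rule rev_finite_subset) auto
  ultimately have 2: "(\<Sum>\<xi>\<in>?X. ghat ?M F \<xi>) = ghat ?M F 0 + (\<Sum>\<xi>\<in>?Y. ghat ?M F \<xi>)"
    by (metis (no_types, lifting) DiffD2 mem_Collect_eq singletonI sum.insert)
  have 3: "ghat ?M F 0 = of_real (\<Sum>z\<in>?S. F z)"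
    by (simp add: ghat_def zdot_def)
  define a where "a = (\<Sum>z\<in>?S. F z * lat_count m q g z) / m"
  define b where "b = (\<Sum>z\<in>?S. F z)"
  define c where "c = (\<Sum>\<xi>\<in>?Y. ghat ?M F \<xi>)"
  have "complex_of_real (?P * a) = of_real b + c"
    using trans[OF 1[symmetric] 2[unfolded 3]] by (simp only: a_def b_def c_def)
  then have "of_real (?P * a - b) = c"
    by (simp only: of_real_diff add_diff_cancel_left')
  then have "\<bar>?P * a - b\<bar> = norm c" by (metis norm_of_real)
  also have "\<dots> \<le> (\<Sum>\<xi>\<in>?Y. norm (ghat ?M F \<xi>))" unfolding c_def by (rule norm_sum)
  finally have "\<bar>?P * a - b\<bar> / ?P \<le> (\<Sum>\<xi>\<in>?Y. norm (ghat ?M F \<xi>)) / ?P"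
    using P by (intro divide_right_mono) auto
  moreover have "\<bar>?P * a - b\<bar> / ?P = \<bar>a - b / ?P\<bar>"
  proof -
    have "\<bar>?P * a - b\<bar> / ?P = \<bar>(?P * a - b) / ?P\<bar>" using P by (simp add: abs_divide)
    also have "(?P * a - b) / ?P = a - b / ?P" using P by (simp add: diff_divide_distrib del: of_nat_power of_nat_mult)
    finally show ?thesis .
  qed
  ultimately have "\<bar>a - b / ?P\<bar> \<le> (\<Sum>\<xi>\<in>?Y. norm (ghat ?M F \<xi>)) / ?P" by simp
  then show ?thesis unfolding a_def b_def .
qed

section \<open>Counting integer points\<close>


text \<open>Each axis vector is a fixed combination of the \<open>w a\<close>, so each coordinate is
  bounded by the sum of the absolute coefficients.\<close>

lemma span_family_coordinate_bound:
  fixes w :: "'b \<Rightarrow> real ^ 'n"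
  assumes "finite I" "span (w ` I) = UNIV"
  shows "\<exists>R\<ge>0. \<forall>x B. (\<forall>a\<in>I. \<bar>w a \<bullet> x\<bar> \<le> B) \<longrightarrow> (\<forall>i. \<bar>x $ i\<bar> \<le> R * B)"
proof -
  have "\<exists>c. \<forall>x B. (\<forall>a\<in>I. \<bar>w a \<bullet> x\<bar> \<le> B) \<longrightarrow> \<bar>x $ i\<bar> \<le> (\<Sum>a\<in>w ` I. \<bar>c a\<bar>) * B" for i
  proof -
    have "axis i 1 \<in> span (w ` I)" using assms by simp
    then obtain c where c: "axis i 1 = (\<Sum>a\<in>w ` I. c a *\<^sub>R a)"
      using assms(1) by (auto simp: span_finite)
    have "\<bar>x $ i\<bar> \<le> (\<Sum>a\<in>w ` I. \<bar>c a\<bar>) * B" if "\<forall>a\<in>I. \<bar>w a \<bullet> x\<bar> \<le> B" for x B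
    proof -
      have "x $ i = axis i 1 \<bullet> x" by (simp add: inner_axis' )
      also have "\<dots> = (\<Sum>a\<in>w ` I. c a * (a \<bullet> x))" by (simp add: c inner_sum_left)
      finally have "\<bar>x $ i\<bar> \<le> (\<Sum>a\<in>w ` I. \<bar>c a\<bar> * \<bar>a \<bullet> x\<bar>)"
        by (metis (no_types, lifting) abs_mult sum.cong sum_abs)
      also have "\<dots> \<le> (\<Sum>a\<in>w ` I. \<bar>c a\<bar> * B)"
        using that by (intro sum_mono mult_left_mono) auto
      finally show ?thesis by (simp add: sum_distrib_right)
    qed
    then show ?thesis by blast
  qed
  then obtain c where c: "\<And>i x B. (\<forall>a\<in>I. \<bar>w a \<bullet> x\<bar> \<le> B) \<Longrightarrow> \<bar>x $ i\<bar> \<le> (\<Sum>a\<in>w ` I. \<bar>c i a\<bar>) * B"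
    by metis
  define R where "R = (\<Sum>i\<in>UNIV. \<Sum>a\<in>w ` I. \<bar>c i a\<bar>)"
  \<comment> \<open>Nonemptiness forces B \<ge> 0, which lets one constant \<open>R\<close> dominate
    the constants of all coordinates.\<close>
  have I: "I \<noteq> {}"
  proof
    assume "I = {}"
    then have "span ({} :: (real ^ 'n) set) = UNIV" using assms(2) by simp
    then have "axis undefined 1 = (0 :: real ^ 'n)" by (simp add: span_empty) blast
    then show False by simp
  qed
  have "\<bar>x $ i\<bar> \<le> R * B" if "\<forall>a\<in>I. \<bar>w a \<bullet> x\<bar> \<le> B" for x B i
  proof -
    have "B \<ge> 0" using that I by (metis abs_ge_zero all_not_in_conv order_trans)
    moreover have "(\<Sum>a\<in>w ` I. \<bar>c i a\<bar>) \<le> R"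
      unfolding R_def by (rule member_le_sum) (auto intro: sum_nonneg)
    ultimately show ?thesis using c[OF that, of i] by (meson mult_right_mono order_trans)
  qed
  moreover have "R \<ge> 0" unfolding R_def by (intro sum_nonneg) auto
  ultimately show ?thesis by blast
qed

text \<open>Two points with equal floors differ by at most 1 in every \<open>w a\<close>, so the
  coordinate bound confines a fibre to a cube whose side does not depend on
  \<open>s\<close>.\<close>

lemma floor_fibre_card:
  fixes w :: "'b \<Rightarrow> real ^ 'n"
  assumes "finite I" "span (w ` I) = UNIV"
  shows "\<exists>C. \<forall>s. finite {z. \<forall>a\<in>I. \<lfloor>w a \<bullet> rvec z\<rfloor> = s a} \<and>
    card {z. \<forall>a\<in>I. \<lfloor>w a \<bullet> rvec z\<rfloor> = s a} \<le> C"
proof -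
  obtain R where R: "R \<ge> 0" "\<And>x B i. (\<forall>a\<in>I. \<bar>w a \<bullet> x\<bar> \<le> B) \<Longrightarrow> \<bar>x $ i\<bar> \<le> R * B"
    using span_family_coordinate_bound[OF assms] by blast
  define D where "D = nat \<lceil>R\<rceil>"
  have "finite F \<and> card F \<le> (2 * D + 1) ^ CARD('n)"
    if F: "F = {z. \<forall>a\<in>I. \<lfloor>w a \<bullet> rvec z\<rfloor> = s a}" for s F
  proof (cases "F = {}")
    case False
    then obtain y where y: "y \<in> F" by blast
    have "z \<in> {z. \<forall>i. z $ i \<in> {y $ i - int D..y $ i + int D}}" if z: "z \<in> F" for z
    proof -
      have "\<bar>w a \<bullet> (rvec z - rvec y)\<bar> \<le> 1" if "a \<in> I" for a
      proof -
        have "\<lfloor>w a \<bullet> rvec z\<rfloor> = \<lfloor>w a \<bullet> rvec y\<rfloor>" using y z that F by auto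
        then show ?thesis by (simp add: inner_diff_right) linarith
      qed
      then have "\<bar>(rvec z - rvec y) $ i\<bar> \<le> R * 1" for i using R(2) by blast
      then have "\<bar>real_of_int (z $ i - y $ i)\<bar> \<le> real_of_int (int D)" for i
        using R(1) by (simp add: D_def order_trans[OF _ le_of_int_ceiling])
      then have "\<bar>z $ i - y $ i\<bar> \<le> int D" for i
        unfolding of_int_abs[symmetric] of_int_le_iff by blast
      then show ?thesis by (auto simp: abs_le_iff algebra_simps)
    qed
    then have sub: "F \<subseteq> {z. \<forall>i. z $ i \<in> {y $ i - int D..y $ i + int D}}" by blast
    have fin: "finite {z :: int ^ 'n. \<forall>i. z $ i \<in> {y $ i - int D..y $ i + int D}}"
      by (rule finite_sum_vec_box) auto
    have "card {z :: int ^ 'n. \<forall>i. z $ i \<in> {y $ i - int D..y $ i + int D}} = (2 * D + 1) ^ CARD('n)"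
    proof (subst finite_sum_vec_box)
      have "nat (2 * int D + 1) = 2 * D + 1" by linarith
      then show "(\<Prod>i\<in>UNIV. card {y $ i - int D..y $ i + int D}) = (2 * D + 1) ^ CARD('n)" by simp
    qed simp
    then show ?thesis using finite_subset[OF sub fin] card_mono[OF fin sub] by simp
  qed auto
  then show ?thesis by (intro exI[of _ "(2 * D + 1) ^ CARD('n)"]) blast
qed

text \<open>Replacing integer points by their tuples of floors, at bounded multiplicity, turns a sum
  of products into a product of one-dimensional sums. It serves both for counting points (p = 1) and
  for decaying weights.\<close>

lemma sum_floor_prod_le:
  fixes w :: "'b \<Rightarrow> real ^ 'n"
  assumes I: "finite I" "span (w ` I) = UNIV"
  shows "\<exists>C\<ge>0. \<forall>Z p S. finite Z \<longrightarrow> (\<forall>a\<in>I. finite (S a)) \<longrightarrow>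
    (\<forall>z\<in>Z. \<forall>a\<in>I. \<lfloor>w a \<bullet> rvec z\<rfloor> \<in> S a) \<longrightarrow> (\<forall>a\<in>I. \<forall>s. 0 \<le> p a s) \<longrightarrow>
    (\<Sum>z\<in>Z. \<Prod>a\<in>I. p a \<lfloor>w a \<bullet> rvec z\<rfloor>) \<le> C * (\<Prod>a\<in>I. \<Sum>s\<in>S a. p a s :: real)"
proof -
  obtain C where C: "\<And>s. finite {z. \<forall>a\<in>I. \<lfloor>w a \<bullet> rvec z\<rfloor> = s a}"
    "\<And>s. card {z. \<forall>a\<in>I. \<lfloor>w a \<bullet> rvec z\<rfloor> = s a} \<le> C"
    using floor_fibre_card[OF I] by blast
  have "(\<Sum>z\<in>Z. \<Prod>a\<in>I. p a \<lfloor>w a \<bullet> rvec z\<rfloor>) \<le> real C * (\<Prod>a\<in>I. \<Sum>s\<in>S a. p a s)"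
    if Z: "finite Z" and S: "\<forall>a\<in>I. finite (S a)"
      and ZS: "\<forall>z\<in>Z. \<forall>a\<in>I. \<lfloor>w a \<bullet> rvec z\<rfloor> \<in> S a" and p: "\<forall>a\<in>I. \<forall>s. 0 \<le> p a s"
    for Z and p :: "'b \<Rightarrow> int \<Rightarrow> real" and S
  proof -
    define \<phi> where "\<phi> z = restrict (\<lambda>a. \<lfloor>w a \<bullet> rvec z\<rfloor>) I" for z
    have nn: "0 \<le> (\<Prod>a\<in>I. p a (s a))" for s using p by (intro prod_nonneg) auto
    have fib: "card {z\<in>Z. \<phi> z = s} \<le> C" for s
    proof -
      have "{z\<in>Z. \<phi> z = s} \<subseteq> {z. \<forall>a\<in>I. \<lfloor>w a \<bullet> rvec z\<rfloor> = s a}"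
        by (auto simp: \<phi>_def)
      then show ?thesis using C by (meson card_mono order_trans)
    qed
    have "(\<Sum>z\<in>Z. \<Prod>a\<in>I. p a \<lfloor>w a \<bullet> rvec z\<rfloor>) = (\<Sum>z\<in>Z. \<Prod>a\<in>I. p a (\<phi> z a))"
      by (simp add: \<phi>_def)
    also have "\<dots> = (\<Sum>s\<in>\<phi> ` Z. \<Sum>z\<in>{z\<in>Z. \<phi> z = s}. \<Prod>a\<in>I. p a (\<phi> z a))"
      by (rule sum.image_gen[OF Z])
    also have "\<dots> = (\<Sum>s\<in>\<phi> ` Z. real (card {z\<in>Z. \<phi> z = s}) * (\<Prod>a\<in>I. p a (s a)))"
      by simp
    also have "\<dots> \<le> (\<Sum>s\<in>\<phi> ` Z. real C * (\<Prod>a\<in>I. p a (s a)))"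
      using fib nn by (intro sum_mono mult_right_mono) auto
    also have "\<dots> \<le> (\<Sum>s\<in>PiE I S. real C * (\<Prod>a\<in>I. p a (s a)))"
      using I S ZS nn by (intro sum_mono2 finite_PiE) (auto simp: \<phi>_def)
    also have "\<dots> = real C * (\<Prod>a\<in>I. \<Sum>s\<in>S a. p a s)"
      using I S by (subst prod_sum_PiE) (auto simp: sum_distrib_left)
    finally show ?thesis .
  qed
  then show ?thesis by (intro exI[of _ "real C"]) auto
qed

lemma finite_floor_in:
  fixes w :: "'b \<Rightarrow> real ^ 'n"
  assumes I: "finite I" "span (w ` I) = UNIV" and S: "\<And>a. a \<in> I \<Longrightarrow> finite (S a)"
  shows "finite {z. \<forall>a\<in>I. \<lfloor>w a \<bullet> rvec z\<rfloor> \<in> S a}"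
proof -
  have "{z. \<forall>a\<in>I. \<lfloor>w a \<bullet> rvec z\<rfloor> \<in> S a} \<subseteq>
    (\<Union>s\<in>PiE I S. {z. \<forall>a\<in>I. \<lfloor>w a \<bullet> rvec z\<rfloor> = s a})"
  proof
    fix z assume "z \<in> {z. \<forall>a\<in>I. \<lfloor>w a \<bullet> rvec z\<rfloor> \<in> S a}"
    then show "z \<in> (\<Union>s\<in>PiE I S. {z. \<forall>a\<in>I. \<lfloor>w a \<bullet> rvec z\<rfloor> = s a})"
      by (intro UN_I[of "restrict (\<lambda>a. \<lfloor>w a \<bullet> rvec z\<rfloor>) I"]) auto
  qed
  moreover have "finite (\<Union>s\<in>PiE I S. {z. \<forall>a\<in>I. \<lfloor>w a \<bullet> rvec z\<rfloor> = s a})"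
    using floor_fibre_card[OF I] S I by (intro finite_UN_I finite_PiE) blast+
  ultimately show ?thesis by (rule finite_subset)
qed

text \<open>An interval of length \<open>W a\<close> meets at most \<open>W a + 2\<close> of the
  cells [s, s + 1); this explains the additive 2.\<close>

lemma card_integer_points_slabs:
  fixes w :: "'b \<Rightarrow> real ^ 'n"
  assumes I: "finite I" "span (w ` I) = UNIV"
  shows "\<exists>C\<ge>0::real. \<forall>l (W :: 'b \<Rightarrow> real). (\<forall>a\<in>I. 0 \<le> W a) \<longrightarrow>
    finite {z. \<forall>a\<in>I. l a \<le> w a \<bullet> rvec z \<and> w a \<bullet> rvec z \<le> l a + W a} \<and>
    card {z. \<forall>a\<in>I. l a \<le> w a \<bullet> rvec z \<and> w a \<bullet> rvec z \<le> l a + W a} \<le> C * (\<Prod>a\<in>I. W a + 2)"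
proof -
  obtain C where C: "C \<ge> 0" "\<And>Z p S. finite Z \<Longrightarrow> (\<forall>a\<in>I. finite (S a)) \<Longrightarrow>
    (\<forall>z\<in>Z. \<forall>a\<in>I. \<lfloor>w a \<bullet> rvec z\<rfloor> \<in> S a) \<Longrightarrow> (\<forall>a\<in>I. \<forall>s. 0 \<le> p a s) \<Longrightarrow>
    (\<Sum>z\<in>Z. \<Prod>a\<in>I. p a \<lfloor>w a \<bullet> rvec z\<rfloor>) \<le> C * (\<Prod>a\<in>I. \<Sum>s\<in>S a. p a s :: real)"
    using sum_floor_prod_le[OF I] by blast
  have "finite Z \<and> card Z \<le> C * (\<Prod>a\<in>I. W a + 2)"
    if W: "\<forall>a\<in>I. 0 \<le> W a"
      and Z: "Z = {z. \<forall>a\<in>I. l a \<le> w a \<bullet> rvec z \<and> w a \<bullet> rvec z \<le> l a + W a}"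
    for l and W :: "'b \<Rightarrow> real" and Z
  proof -
    let ?S = "\<lambda>a. {\<lfloor>l a\<rfloor>..\<lfloor>l a + W a\<rfloor>}"
    have sub: "\<forall>z\<in>Z. \<forall>a\<in>I. \<lfloor>w a \<bullet> rvec z\<rfloor> \<in> ?S a"
      by (auto simp: Z intro!: floor_mono)
    have fin: "finite Z"
      by (rule finite_subset[OF _ finite_floor_in[OF I, of ?S]]) (use sub in auto)
    have "real (card Z) = (\<Sum>z\<in>Z. \<Prod>a\<in>I. (\<lambda>_ _. 1) a \<lfloor>w a \<bullet> rvec z\<rfloor>)" by simp
    also have "\<dots> \<le> C * (\<Prod>a\<in>I. \<Sum>s\<in>?S a. 1)"
      using C(2)[OF fin _ sub, of "\<lambda>_ _. 1"] by simp
    also have "\<dots> \<le> C * (\<Prod>a\<in>I. W a + 2)"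
    proof (intro mult_left_mono prod_mono conjI C(1))
      fix a assume a: "a \<in> I"
      have "\<lfloor>l a\<rfloor> \<le> \<lfloor>l a + W a\<rfloor>" using W a by (intro floor_mono) auto
      then have "(\<Sum>s\<in>?S a. 1) = real_of_int (\<lfloor>l a + W a\<rfloor> - \<lfloor>l a\<rfloor> + 1)"
        by simp
      also have "\<dots> \<le> W a + 2" by linarith
      finally show "(\<Sum>s\<in>?S a. 1) \<le> W a + 2" .
    qed (auto intro: sum_nonneg)
    finally show ?thesis using fin by blast
  qed
  then show ?thesis by (intro exI[of _ C] conjI[OF C(1)] allI impI) blast
qed

section \<open>The decay kernel 1/(1 + y^2) and its sums over integer points\<close>

definition phi :: "real \<Rightarrow> real" where
  "phi y = 1 / (1 + y\<^sup>2)"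

lemma phi_pos: "phi y > 0"
  by (simp add: phi_def add_pos_nonneg)

text \<open>Slow variation, which permits rounding the argument at the cost of a constant. The
  square (v - 2 u)^2 \<ge> 0 encodes v^2 \<le> 2 u^2 + 2 (v - u)^2.\<close>

lemma phi_near: "\<bar>u - v\<bar> \<le> 1 \<Longrightarrow> phi u \<le> 3 * phi v"
proof -
  assume "\<bar>u - v\<bar> \<le> 1"
  then have "(v - u)\<^sup>2 \<le> 1" by (simp add: abs_square_le_1 abs_minus_commute)
  moreover have "(v - 2 * u)\<^sup>2 \<ge> 0" by simp
  moreover have "(v - 2 * u)\<^sup>2 = 2 * u\<^sup>2 + 2 * (v - u)\<^sup>2 - v\<^sup>2"
    by (simp add: power2_eq_square algebra_simps)
  moreover have "u\<^sup>2 \<ge> 0" by simp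
  ultimately have *: "1 + v\<^sup>2 \<le> 3 * (1 + u\<^sup>2)" by argo
  have "0 < 1 + v\<^sup>2" "0 < 1 + u\<^sup>2" by (auto intro: add_pos_nonneg)
  then show ?thesis using * by (simp add: phi_def divide_simps)
qed

lemma phi_scale: "0 < c \<Longrightarrow> c \<le> 1 \<Longrightarrow> c * \<bar>u\<bar> \<le> \<bar>v\<bar> \<Longrightarrow> phi v \<le> phi u / c\<^sup>2"
proof -
  assume c: "0 < c" "c \<le> 1" "c * \<bar>u\<bar> \<le> \<bar>v\<bar>"
  have "(c * \<bar>u\<bar>)\<^sup>2 \<le> \<bar>v\<bar>\<^sup>2" using c by (intro power_mono) auto
  then have "c\<^sup>2 * u\<^sup>2 \<le> v\<^sup>2" by (simp add: power_mult_distrib)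
  moreover have "c\<^sup>2 \<le> 1" using c by (simp add: power_le_one)
  ultimately have *: "c\<^sup>2 * (1 + u\<^sup>2) \<le> 1 + v\<^sup>2" by (simp add: distrib_left)
  have "0 < 1 + v\<^sup>2" "0 < c\<^sup>2 * (1 + u\<^sup>2)" using c by (auto intro!: add_pos_nonneg mult_pos_pos)
  then have "1 / (1 + v\<^sup>2) \<le> 1 / (c\<^sup>2 * (1 + u\<^sup>2))" using * by (intro divide_left_mono) auto
  then show ?thesis by (simp add: phi_def mult.commute)
qed

lemma sum_phi_int: "finite T \<Longrightarrow> (\<Sum>t\<in>T. phi (real_of_int t)) \<le> 5"
proof -
  \<comment> \<open>The defect 4/(N + 1) makes the induction close: the two new terms add up to at
    most 4/(N + 1) - 4/(N + 2), and the bound starts with equality at N = 0.\<close>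
  have *: "(\<Sum>t\<in>{- int N..int N}. phi (real_of_int t)) \<le> 5 - 4 / (real N + 1)" for N
  proof (induction N)
    case 0 then show ?case by (simp add: phi_def)
  next
    case (Suc N)
    have "{- int (Suc N)..int (Suc N)} = insert (int N + 1) (insert (- int N - 1) {- int N..int N})" by auto
    then have "(\<Sum>t\<in>{- int (Suc N)..int (Suc N)}. phi (real_of_int t)) =
      phi (real N + 1) + (phi (- real N - 1) + (\<Sum>t\<in>{- int N..int N}. phi (real_of_int t)))"
      by simp
    also have "\<dots> \<le> 2 * phi (real N + 1) + (5 - 4 / (real N + 1))"
      using Suc by (simp add: phi_def power2_eq_square algebra_simps)
    also have "2 * phi (real N + 1) \<le> 4 / (real N + 1) - 4 / (real N + 2)"
    proof -
      have "4 / (real N + 1) - 4 / (real N + 2) = 4 / ((real N + 1) * (real N + 2))"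
        by (simp add: field_simps)
      moreover have "(real N + 1) * (real N + 2) \<le> 2 * (1 + (real N + 1)\<^sup>2)"
        by (simp add: power2_eq_square algebra_simps)
      moreover have "(real N + 1) * (real N + 2) > 0" "1 + (real N + 1)\<^sup>2 > 0" by (auto intro: add_pos_nonneg)
      ultimately show ?thesis by (simp add: phi_def divide_simps)
    qed
    finally show ?case by (simp add: add.commute)
  qed
  assume T: "finite T"
  define N where "N = nat (Max (insert 0 (abs ` T)))"
  have "T \<subseteq> {- int N..int N}"
  proof
    fix t assume "t \<in> T"
    then have "\<bar>t\<bar> \<le> Max (insert 0 (abs ` T))" using T by (intro Max_ge) auto
    then show "t \<in> {- int N..int N}" by (auto simp: N_def)
  qed
  then have "(\<Sum>t\<in>T. phi (real_of_int t)) \<le> (\<Sum>t\<in>{- int N..int N}. phi (real_of_int t))"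
    using phi_pos by (intro sum_mono2) (auto intro: less_imp_le)
  also have "\<dots> \<le> 5" using *[of N] by (smt (verit) divide_nonneg_nonneg of_nat_0_le_iff)
  finally show ?thesis .
qed

text \<open>Blocks of 2^k consecutive integers: in a block the argument stays within 1 of the block
  index. The 15 is 3 from \<open>phi_near\<close> times 5 from \<open>sum_phi_int\<close>.\<close>

lemma sum_phi_scaled:
  assumes "finite S"
  shows "(\<Sum>s\<in>S. phi (real_of_int s / 2 ^ k)) \<le> 15 * 2 ^ k"
proof -
  let ?K = "2 ^ k :: int"
  have "(\<Sum>s\<in>S. phi (real_of_int s / 2 ^ k)) \<le> (\<Sum>s\<in>S. 3 * phi (real_of_int (s div ?K)))"
  proof (intro sum_mono phi_near)
    fix s
    have "s div ?K = \<lfloor>real_of_int s / 2 ^ k\<rfloor>" 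
      using floor_divide_of_int_eq[of s ?K, where 'a = real] by simp
    then show "\<bar>real_of_int s / 2 ^ k - real_of_int (s div ?K)\<bar> \<le> 1" by linarith
  qed
  also have "\<dots> = (\<Sum>t\<in>(\<lambda>s. s div ?K) ` S. \<Sum>s\<in>{s\<in>S. s div ?K = t}. 3 * phi (real_of_int (s div ?K)))"
    by (rule sum.image_gen[OF assms])
  also have "\<dots> = (\<Sum>t\<in>(\<lambda>s. s div ?K) ` S. real (card {s\<in>S. s div ?K = t}) * (3 * phi (real_of_int t)))"
    by simp
  also have "\<dots> \<le> (\<Sum>t\<in>(\<lambda>s. s div ?K) ` S. 2 ^ k * (3 * phi (real_of_int t)))"
  proof (intro sum_mono mult_right_mono)
    fix t
    have "{s\<in>S. s div ?K = t} \<subseteq> {t * ?K..<t * ?K + ?K}"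
    proof
      fix s assume "s \<in> {s\<in>S. s div ?K = t}"
      then have "s = t * ?K + s mod ?K" using div_mult_mod_eq[of s ?K] by auto
      moreover have "0 \<le> s mod ?K" "s mod ?K < ?K" by auto
      ultimately show "s \<in> {t * ?K..<t * ?K + ?K}" by (metis atLeastLessThan_iff add_less_cancel_left le_add_same_cancel1)
    qed
    then have "card {s\<in>S. s div ?K = t} \<le> card {t * ?K..<t * ?K + ?K}"
      by (rule card_mono[rotated]) simp
    also have "\<dots> = 2 ^ k" by (simp add: nat_power_eq)
    finally show "real (card {s\<in>S. s div ?K = t}) \<le> 2 ^ k"
      by (metis of_nat_le_iff of_nat_numeral of_nat_power)
  qed (use phi_pos in \<open>auto intro: less_imp_le\<close>)
  also have "\<dots> = 3 * 2 ^ k * (\<Sum>t\<in>(\<lambda>s. s div ?K) ` S. phi (real_of_int t))"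
    by (simp add: sum_distrib_left ac_simps)
  also have "\<dots> \<le> 3 * 2 ^ k * 5"
    using sum_phi_int[of "(\<lambda>s. s div ?K) ` S"] assms by (intro mult_left_mono) auto
  finally show ?thesis by simp
qed

text \<open>The constant per direction is 45 = 3 * 15: 3 for rounding
  \<open>w a \<bullet> rvec z\<close> to an integer, 15 for the scaled one-dimensional sum.\<close>

lemma sum_prod_phi_le:
  fixes w :: "'b \<Rightarrow> real ^ 'n"
  assumes I: "finite I" "span (w ` I) = UNIV"
  shows "\<exists>C\<ge>0. \<forall>Z k. finite Z \<longrightarrow>
    (\<Sum>z\<in>Z. \<Prod>a\<in>I. phi (w a \<bullet> rvec z / 2 ^ k a)) \<le> C * (\<Prod>a\<in>I. 2 ^ k a)"
proof -
  obtain C where C: "C \<ge> 0" "\<And>Z p S. finite Z \<Longrightarrow> (\<forall>a\<in>I. finite (S a)) \<Longrightarrow>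
    (\<forall>z\<in>Z. \<forall>a\<in>I. \<lfloor>w a \<bullet> rvec z\<rfloor> \<in> S a) \<Longrightarrow> (\<forall>a\<in>I. \<forall>s. 0 \<le> p a s) \<Longrightarrow>
    (\<Sum>z\<in>Z. \<Prod>a\<in>I. p a \<lfloor>w a \<bullet> rvec z\<rfloor>) \<le> C * (\<Prod>a\<in>I. \<Sum>s\<in>S a. p a s :: real)"
    using sum_floor_prod_le[OF I] by blast
  have "(\<Sum>z\<in>Z. \<Prod>a\<in>I. phi (w a \<bullet> rvec z / 2 ^ k a)) \<le> (C * 45 ^ card I) * (\<Prod>a\<in>I. 2 ^ k a)"
    if Z: "finite Z" for Z and k :: "'b \<Rightarrow> nat"
  proof -
    let ?S = "\<lambda>a. (\<lambda>z. \<lfloor>w a \<bullet> rvec z\<rfloor>) ` Z"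
    have "(\<Sum>z\<in>Z. \<Prod>a\<in>I. phi (w a \<bullet> rvec z / 2 ^ k a)) \<le>
        (\<Sum>z\<in>Z. \<Prod>a\<in>I. 3 * phi (real_of_int \<lfloor>w a \<bullet> rvec z\<rfloor> / 2 ^ k a))"
    proof (intro sum_mono prod_mono conjI phi_near)
      fix z a
      have "\<bar>w a \<bullet> rvec z - real_of_int \<lfloor>w a \<bullet> rvec z\<rfloor>\<bar> \<le> 1" by linarith
      also have "\<dots> \<le> 2 ^ k a" by simp
      finally show "\<bar>w a \<bullet> rvec z / 2 ^ k a - real_of_int \<lfloor>w a \<bullet> rvec z\<rfloor> / 2 ^ k a\<bar> \<le> 1"
        by (simp add: diff_divide_distrib[symmetric] abs_divide)
    qed (use phi_pos in \<open>auto intro: less_imp_le\<close>)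
    also have "\<dots> \<le> C * (\<Prod>a\<in>I. \<Sum>s\<in>?S a. 3 * phi (real_of_int s / 2 ^ k a))"
      by (rule C(2)) (use Z phi_pos in \<open>auto intro: less_imp_le\<close>)
    also have "\<dots> \<le> C * (\<Prod>a\<in>I. 45 * 2 ^ k a)"
    proof (intro mult_left_mono prod_mono conjI C(1))
      fix a
      show "(\<Sum>s\<in>?S a. 3 * phi (real_of_int s / 2 ^ k a)) \<le> 45 * 2 ^ k a"
        using sum_phi_scaled[of "?S a" "k a"] Z by (simp add: sum_distrib_left[symmetric])
    qed (use phi_pos in \<open>auto intro!: sum_nonneg intro: less_imp_le\<close>)
    finally show ?thesis by (simp add: prod.distrib ac_simps)
  qed
  then show ?thesis using C(1) by (intro exI[of _ "C * 45 ^ card I"]) auto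
qed

section \<open>Dyadic tiles\<close>


text \<open>The entry bound gives |a . x| \<le> max |x_j|, so moving a point by s in every
  coordinate moves every slab value by at most s.\<close>

locale frame =
  fixes A :: "(real ^ 'n) set"
  assumes finite_A: "finite A" and span_A: "span A = UNIV"
    and entry_A: "\<And>a i. a \<in> A \<Longrightarrow> \<bar>a $ i\<bar> \<le> 1 / real CARD('n)"
begin

definition bases :: "(real ^ 'n) set set" where
  "bases = {I. I \<subseteq> A \<and> independent I \<and> span I = UNIV}"

text \<open>The dual basis vector of \<open>a\<close>, assembled from its coordinates: its inner
  product with x is the coefficient of \<open>a\<close> in the expansion of x along
  \<open>I\<close>.\<close>

definition dual :: "(real ^ 'n) set \<Rightarrow> real ^ 'n \<Rightarrow> real ^ 'n" where
  "dual I a = (\<chi> i. representation I (axis i 1) a)"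

lemma finite_bases: "finite bases"
  by (rule finite_subset[of _ "Pow A"]) (auto simp: bases_def finite_A)

lemma basesD: "I \<in> bases \<Longrightarrow> I \<subseteq> A" "I \<in> bases \<Longrightarrow> finite I" "I \<in> bases \<Longrightarrow> independent I"
  "I \<in> bases \<Longrightarrow> span I = UNIV"
  using finite_A by (auto simp: bases_def intro: finite_subset)

lemma card_basis: "I \<in> bases \<Longrightarrow> card I = CARD('n)"
  using basesD[of I] by (metis DIM_cart DIM_real dim_UNIV dim_span_eq_card_independent mult.right_neutral)

lemma inner_dual: "I \<in> bases \<Longrightarrow> x \<bullet> dual I a = representation I x a"
proof -
  assume I: "I \<in> bases"
  have x: "x = (\<Sum>i\<in>UNIV. x $ i *\<^sub>R axis i 1)"
    by (simp add: vec_eq_iff axis_def if_distrib cong: if_cong)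
  have "representation I x a = representation I (\<Sum>i\<in>UNIV. x $ i *\<^sub>R axis i 1) a"
    using x by simp
  also have "\<dots> = (\<Sum>i\<in>UNIV. x $ i * representation I (axis i 1) a)"
    using basesD[OF I] by (subst representation_sum) (auto simp: representation_scale)
  finally show ?thesis by (simp add: inner_vec_def dual_def)
qed

lemma dual_expand: "I \<in> bases \<Longrightarrow> (\<Sum>a\<in>I. (x \<bullet> dual I a) *\<^sub>R a) = x"
  using basesD[of I] by (simp add: inner_dual sum_representation_eq)

lemma dual_delta: "I \<in> bases \<Longrightarrow> a \<in> I \<Longrightarrow> a \<bullet> dual I i = (if i = a then 1 else 0)"
  using basesD[of I] by (simp add: inner_dual representation_basis)

lemma inner_expand: "I \<in> bases \<Longrightarrow> x \<bullet> y = (\<Sum>a\<in>I. (x \<bullet> dual I a) * (a \<bullet> y))"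
  by (subst dual_expand[symmetric, of I x], assumption) (simp add: inner_sum_left)

lemma span_dual: "I \<in> bases \<Longrightarrow> span (dual I ` I) = UNIV"
proof -
  assume I: "I \<in> bases"
  have "y \<in> span (dual I ` I)" for y
  proof -
    have "(\<Sum>a\<in>I. (a \<bullet> y) *\<^sub>R dual I a) = y"
    proof (rule vector_eq_rdot[THEN iffD1], rule allI)
      fix z
      show "(\<Sum>a\<in>I. (a \<bullet> y) *\<^sub>R dual I a) \<bullet> z = y \<bullet> z"
        using inner_expand[OF I, of z y]
        by (simp add: inner_sum_left inner_commute[of y z] inner_commute[of "dual I _" z] mult.commute)
    qed
    moreover have "(\<Sum>a\<in>I. (a \<bullet> y) *\<^sub>R dual I a) \<in> span (dual I ` I)"
      by (intro span_sum span_scale span_base) auto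
    ultimately show ?thesis by simp
  qed
  then show ?thesis by auto
qed

text \<open>If \<open>I\<close> is optimal for \<open>k\<close>, then every \<open>a \<in> A\<close> is a combination of elements of \<open>I\<close> whose slabs
  are at least as thin, so the slab of \<open>a\<close> is redundant up to a constant.\<close>

definition optimal :: "(real ^ 'n \<Rightarrow> nat) \<Rightarrow> (real ^ 'n) set \<Rightarrow> bool" where
  "optimal k I \<longleftrightarrow> I \<in> bases \<and> (\<forall>a\<in>A. \<forall>i\<in>I. a \<bullet> dual I i \<noteq> 0 \<longrightarrow> k a \<le> k i)"

lemma bases_nonempty: "bases \<noteq> {}"
proof -
  obtain B where "B \<subseteq> A" "independent B" "A \<subseteq> span B"
    using maximal_independent_subset[of A] by blast
  moreover have "span B = UNIV"
    using \<open>A \<subseteq> span B\<close> span_A by (metis span_mono span_span top.extremum_uniqueI)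
  ultimately show ?thesis by (auto simp: bases_def)
qed

text \<open>Exchange argument: take a basis of largest total exponent. If \<open>a\<close> involved
  some \<open>i\<close> with k i < k a, replacing \<open>i\<close> by \<open>a\<close> would give a
  basis of larger total.\<close>

lemma optimal_exists: "\<exists>I. optimal k I"
proof -
  have "\<exists>I\<in>bases. \<forall>J\<in>bases. (\<Sum>i\<in>J. k i) \<le> (\<Sum>i\<in>I. k i)"
  proof -
    let ?f = "\<lambda>J. \<Sum>i\<in>J. k i"
    have "Max (?f ` bases) \<in> ?f ` bases" using finite_bases bases_nonempty by (intro Max_in) auto
    then obtain I where "I \<in> bases" "?f I = Max (?f ` bases)" by force
    moreover have "?f J \<le> Max (?f ` bases)" if "J \<in> bases" for J
      using finite_bases that by (intro Max_ge) auto
    ultimately show ?thesis by (intro bexI[of _ I]) simp_all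
  qed
  then obtain I where I: "I \<in> bases" "\<And>J. J \<in> bases \<Longrightarrow> (\<Sum>i\<in>J. k i) \<le> (\<Sum>i\<in>I. k i)" by blast
  note I' = basesD[OF I(1)]
  have "k a \<le> k i" if a: "a \<in> A" and i: "i \<in> I" and ne: "a \<bullet> dual I i \<noteq> 0" for a i
  proof (rule ccontr)
    assume lt: "\<not> k a \<le> k i"
    have aI: "a \<notin> I" using dual_delta[OF I(1), of a i] ne lt by (auto split: if_splits)
    have notin: "a \<notin> span (I - {i})"
    proof
      assume *: "a \<in> span (I - {i})"
      have "representation I a = representation (I - {i}) a"
        using I' * by (intro representation_extend) auto
      then show False
        using ne representation_ne_zero[of "I - {i}" a i] I(1) by (auto simp: inner_dual)
    qed
    let ?J = "insert a (I - {i})"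
    have "independent ?J"
    proof -
      have "independent (I - {i})" using I'(3) by (rule independent_mono) auto
      then show ?thesis using notin by (simp add: independent_insert)
    qed
    moreover have "i \<in> span ?J"
    proof (rule in_span_insert[OF _ notin])
      have "insert i (I - {i}) = I" using i by auto
      then show "a \<in> span (insert i (I - {i}))" using I'(4) by simp
    qed
    then have "I \<subseteq> span ?J" by (auto intro: span_base)
    then have "span ?J = UNIV" using I'(4) by (metis span_mono span_span top.extremum_uniqueI)
    ultimately have "?J \<in> bases" using a I' by (auto simp: bases_def)
    then have "(\<Sum>i\<in>?J. k i) \<le> (\<Sum>i\<in>I. k i)" by (rule I(2))
    moreover have "(\<Sum>i\<in>?J. k i) = k a + (\<Sum>i\<in>I - {i}. k i)" using aI I' by simp
    moreover have "(\<Sum>i\<in>I. k i) = k i + (\<Sum>i\<in>I - {i}. k i)" using i I' by (simp add: sum.remove)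
    ultimately show False using lt by simp
  qed
  then show ?thesis using I(1) by (auto simp: optimal_def)
qed

definition opt_basis :: "(real ^ 'n \<Rightarrow> nat) \<Rightarrow> (real ^ 'n) set" where
  "opt_basis k = (SOME I. optimal k I)"

lemma optimal_opt_basis: "optimal k (opt_basis k)"
  unfolding opt_basis_def by (rule someI_ex[OF optimal_exists])

lemma opt_basis_in: "opt_basis k \<in> bases"
  using optimal_opt_basis optimal_def by blast

lemma dual_bounds:
  "\<exists>B\<ge>1. \<forall>I\<in>bases. \<forall>i\<in>I. (\<forall>a\<in>A. \<bar>a \<bullet> dual I i\<bar> \<le> B) \<and> (\<forall>j. \<bar>dual I i $ j\<bar> \<le> B)"
proof -
  let ?P = "SIGMA I:bases. I"
  have fin: "finite ?P" using finite_bases basesD by auto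
  define B where "B = 1 + (\<Sum>(I,i)\<in>?P. (\<Sum>a\<in>A. \<bar>a \<bullet> dual I i\<bar>) + (\<Sum>j\<in>UNIV. \<bar>dual I i $ j\<bar>))"
  have *: "(\<Sum>a\<in>A. \<bar>a \<bullet> dual I i\<bar>) + (\<Sum>j\<in>UNIV. \<bar>dual I i $ j\<bar>) \<le> B" if "I \<in> bases" "i \<in> I" for I i
  proof -
    have "(case (I, i) of (I, i) \<Rightarrow> (\<Sum>a\<in>A. \<bar>a \<bullet> dual I i\<bar>) + (\<Sum>j\<in>UNIV. \<bar>dual I i $ j\<bar>)) \<le>
       (\<Sum>(I,i)\<in>?P. (\<Sum>a\<in>A. \<bar>a \<bullet> dual I i\<bar>) + (\<Sum>j\<in>UNIV. \<bar>dual I i $ j\<bar>))"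
      by (rule member_le_sum) (use that fin in \<open>auto intro!: add_nonneg_nonneg sum_nonneg\<close>)
    then show ?thesis by (simp add: B_def)
  qed
  have "B \<ge> 1" unfolding B_def by (auto intro!: sum_nonneg add_nonneg_nonneg)
  moreover have "\<bar>a \<bullet> dual I i\<bar> \<le> B" if "I \<in> bases" "i \<in> I" "a \<in> A" for I i a
  proof -
    have "\<bar>a \<bullet> dual I i\<bar> \<le> (\<Sum>a\<in>A. \<bar>a \<bullet> dual I i\<bar>)"
      by (rule member_le_sum) (use that finite_A in auto)
    moreover have "(\<Sum>j\<in>UNIV. \<bar>dual I i $ j\<bar>) \<ge> 0" by (intro sum_nonneg) auto
    ultimately show ?thesis using *[OF that(1,2)] by linarith
  qed
  moreover have "\<bar>dual I i $ j\<bar> \<le> B" if "I \<in> bases" "i \<in> I" for I i j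
  proof -
    have "\<bar>dual I i $ j\<bar> \<le> (\<Sum>j\<in>UNIV. \<bar>dual I i $ j\<bar>)"
      by (rule member_le_sum) auto
    moreover have "(\<Sum>a\<in>A. \<bar>a \<bullet> dual I i\<bar>) \<ge> 0" by (intro sum_nonneg) auto
    ultimately show ?thesis using *[OF that] by linarith
  qed
  ultimately show ?thesis by blast
qed

end

text \<open>\<open>th\<close> is a smooth step with transition interval [1, 2]. The order 2 d allows
  two differences in each of the d dual directions, or 2 d differences along one axis for high
  frequencies.\<close>

locale step_frame = frame A for A :: "(real ^ 'n) set" +
  fixes th :: "real \<Rightarrow> real" and Cth :: real
  assumes th_0: "\<And>t. t \<le> 1 \<Longrightarrow> th t = 0" and th_1: "\<And>t. 2 \<le> t \<Longrightarrow> th t = 1"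
    and th_range: "\<And>t. 0 \<le> th t \<and> th t \<le> 1"
    and th_smooth: "smooth_upto (2 * CARD('n)) Cth th"
begin

text \<open>A telescoping bump: the values psi (2^j t) for j = 0, ..., n add up to
  \<open>th (2 ^ Suc n * t) - th t\<close>, a dyadic partition of the distance t.\<close>

definition psi :: "real \<Rightarrow> real" where
  "psi t = th (2 * t) - th t"

lemma psi_support: "psi t \<noteq> 0 \<Longrightarrow> 1 / 2 < t \<and> t < 2"
  using th_0[of t] th_0[of "2 * t"] th_1[of t] th_1[of "2 * t"] unfolding psi_def by linarith

definition tile :: "(real ^ 'n \<Rightarrow> nat) \<Rightarrow> (real ^ 'n \<Rightarrow> real) \<Rightarrow> real ^ 'n \<Rightarrow> real" where
  "tile k b x = (\<Prod>a\<in>A. psi (2 ^ k a * (b a - a \<bullet> x)))"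

lemma tile_support:
  assumes "tile k b x \<noteq> 0" "a \<in> A"
  shows "1 / (2 * 2 ^ k a) < b a - a \<bullet> x" "b a - a \<bullet> x < 2 / 2 ^ k a"
proof -
  have "psi (2 ^ k a * (b a - a \<bullet> x)) \<noteq> 0"
    using assms finite_A by (auto simp: tile_def)
  from psi_support[OF this] show "1 / (2 * 2 ^ k a) < b a - a \<bullet> x" "b a - a \<bullet> x < 2 / 2 ^ k a"
    by (simp_all add: field_simps)
qed

text \<open>In each direction i of \<open>I\<close> the points x and x' are within 2 / 2^k(i). As
  \<open>I\<close> is optimal for k', this gives a . (x' - x) = O(2^-k'(a)), so the distance of x to
  facet a is O(2^-k'(a)), while the tile k makes it at least 2^-k(a) / 2.\<close>

lemma tile_scales_close:
  "\<exists>D. \<forall>k k' b x x' I. tile k b x \<noteq> 0 \<longrightarrow> tile k' b x' \<noteq> 0 \<longrightarrow> I \<in> bases \<longrightarrow> optimal k' I \<longrightarrow>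
    (\<forall>i\<in>I. k i = k' i) \<longrightarrow> (\<forall>a\<in>A. k' a \<le> k a + D)"
proof -
  obtain B where B: "B \<ge> 1" "\<And>I i a. I \<in> bases \<Longrightarrow> i \<in> I \<Longrightarrow> a \<in> A \<Longrightarrow> \<bar>a \<bullet> dual I i\<bar> \<le> B"
    using dual_bounds by blast
  let ?d = "real CARD('n)"
  obtain D where D: "4 + 4 * ?d * B < 2 ^ D" using real_arch_pow[of 2 "4 + 4 * ?d * B"] by auto
  have "k' a \<le> k a + D" if t: "tile k b x \<noteq> 0" "tile k' b x' \<noteq> 0" and I: "I \<in> bases" "optimal k' I"
    and eq: "\<forall>i\<in>I. k i = k' i" and a: "a \<in> A" for k k' b x x' I a
  proof -
    have "a \<bullet> (x' - x) = (\<Sum>i\<in>I. (a \<bullet> dual I i) * (i \<bullet> (x' - x)))"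
      by (rule inner_expand[OF I(1)])
    also have "\<dots> \<le> (\<Sum>i\<in>I. B * (2 / 2 ^ k' a))"
    proof (intro sum_mono)
      fix i assume i: "i \<in> I"
      then have iA: "i \<in> A" using basesD(1)[OF I(1)] by auto
      show "(a \<bullet> dual I i) * (i \<bullet> (x' - x)) \<le> B * (2 / 2 ^ k' a)"
      proof (cases "a \<bullet> dual I i = 0")
        case False
        then have "k' a \<le> k' i" using I(2) a i by (auto simp: optimal_def)
        then have le: "2 / 2 ^ k' i \<le> 2 / (2 ^ k' a :: real)" by (intro divide_left_mono power_increasing) auto
        have "\<bar>i \<bullet> (x' - x)\<bar> \<le> 2 / 2 ^ k' i"
        proof -
          have "0 < 1 / (2 * 2 ^ k' i :: real)" by simp
          then show ?thesis
            using tile_support[OF t(1) iA] tile_support[OF t(2) iA] eq i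
            by (simp add: inner_diff_right abs_le_iff)
        qed
        then have "\<bar>i \<bullet> (x' - x)\<bar> \<le> 2 / 2 ^ k' a" using le by linarith
        then have "\<bar>a \<bullet> dual I i\<bar> * \<bar>i \<bullet> (x' - x)\<bar> \<le> B * (2 / 2 ^ k' a)"
          using B I(1) i a by (intro mult_mono) auto
        then show ?thesis by (metis abs_le_D1 abs_mult)
      qed (use B in auto)
    qed
    also have "\<dots> = 2 * ?d * B / 2 ^ k' a" using card_basis[OF I(1)] by simp
    finally have "1 / (2 * 2 ^ k a) < 2 / 2 ^ k' a + 2 * ?d * B / 2 ^ k' a"
      using tile_support[OF t(1) a] tile_support[OF t(2) a] by (simp add: inner_diff_right)
    then have "1 / (2 * 2 ^ k a) < (2 + 2 * ?d * B) / 2 ^ k' a" by (simp add: add_divide_distrib)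
    then have "2 ^ k' a < (4 + 4 * ?d * B) * 2 ^ k a" by (simp add: field_simps)
    also have "\<dots> \<le> 2 ^ D * 2 ^ k a" using D by (intro mult_right_mono) auto
    finally have "(2::real) ^ k' a < 2 ^ (k a + D)" by (simp add: power_add mult.commute)
    then show ?thesis by simp
  qed
  then show ?thesis by blast
qed

text \<open>By \<open>tile_scales_close\<close>, applied in both directions, two nonempty tiles of
  one polyhedron with equal basis and equal exponents on it differ by at most D in every exponent; a
  fibre therefore has at most (2 D + 1)^card A members. The right-hand side no longer depends on
  \<open>b\<close>.\<close>

lemma sum_over_tiles_le:
  "\<exists>C\<ge>0. \<forall>b n G. (\<forall>I\<in>bases. \<forall>\<kappa>. 0 \<le> G I \<kappa>) \<longrightarrow>
    (\<Sum>k | k \<in> A \<rightarrow>\<^sub>E {0..n} \<and> (\<exists>x. tile k b x \<noteq> 0). G (opt_basis k) (restrict k (opt_basis k))) \<le>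
      C * (\<Sum>I\<in>bases. \<Sum>\<kappa>\<in>I \<rightarrow>\<^sub>E {0..n}. G I \<kappa> :: real)"
proof -
  from tile_scales_close obtain D where
    D: "\<forall>k k' b x x' I. tile k b x \<noteq> 0 \<longrightarrow> tile k' b x' \<noteq> 0 \<longrightarrow> I \<in> bases \<longrightarrow> optimal k' I \<longrightarrow>
    (\<forall>i\<in>I. k i = k' i) \<longrightarrow> (\<forall>a\<in>A. k' a \<le> k a + D)" ..
  define C where "C = (2 * D + 1) ^ card A"
  have "(\<Sum>k\<in>T. G (opt_basis k) (restrict k (opt_basis k))) \<le> real C * (\<Sum>I\<in>bases. \<Sum>\<kappa>\<in>I \<rightarrow>\<^sub>E {0..n}. G I \<kappa>)"
    if G: "\<forall>I\<in>bases. \<forall>\<kappa>. 0 \<le> G I \<kappa>" and T: "T = {k. k \<in> A \<rightarrow>\<^sub>E {0..n} \<and> (\<exists>x. tile k b x \<noteq> 0)}"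
    for b n T and G :: "(real ^ 'n) set \<Rightarrow> (real ^ 'n \<Rightarrow> nat) \<Rightarrow> real"
  proof -
    let ?f = "\<lambda>k. (opt_basis k, restrict k (opt_basis k))"
    let ?S = "SIGMA I:bases. I \<rightarrow>\<^sub>E {0..n}"
    have finT: "finite T"
      by (rule finite_subset[of _ "A \<rightarrow>\<^sub>E {0..n}"]) (auto simp: T finite_A intro: finite_PiE)
    have finS: "finite ?S" using finite_bases basesD by (auto intro!: finite_SigmaI finite_PiE)
    have im: "?f ` T \<subseteq> ?S"
      using opt_basis_in basesD(1) by (fastforce simp: T)
    have fib: "card {k\<in>T. ?f k = p} \<le> C" for p
    proof (cases "{k\<in>T. ?f k = p} = {}")
      case False
      then obtain k0 where k0: "k0 \<in> T" "?f k0 = p" by blast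
      have "{k\<in>T. ?f k = p} \<subseteq> (\<Pi>\<^sub>E a\<in>A. {k0 a - D..k0 a + D})"
      proof
        fix k assume k: "k \<in> {k\<in>T. ?f k = p}"
        then have e: "opt_basis k = opt_basis k0" "restrict k (opt_basis k) = restrict k0 (opt_basis k)"
          using k0 by auto
        then have eq: "\<forall>i\<in>opt_basis k. k i = k0 i" by (metis restrict_apply')
        obtain x x0 where x: "tile k b x \<noteq> 0" "tile k0 b x0 \<noteq> 0" using k k0 by (auto simp: T)
        have o: "optimal k0 (opt_basis k)" using optimal_opt_basis[of k0] e(1) by simp
        have 1: "k a \<le> k0 a + D" if "a \<in> A" for a
          by (rule D[rule_format, OF x(2) x(1) opt_basis_in[of k] optimal_opt_basis _ that]) (use eq in simp)
        have 2: "k0 a \<le> k a + D" if "a \<in> A" for a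
          by (rule D[rule_format, OF x opt_basis_in[of k] o _ that]) (use eq in simp)
        have 3: "k \<in> A \<rightarrow>\<^sub>E {0..n}" using k T by blast
        show "k \<in> (\<Pi>\<^sub>E a\<in>A. {k0 a - D..k0 a + D})"
        proof (rule PiE_I)
          fix a assume "a \<in> A"
          from 1[OF this] 2[OF this] show "k a \<in> {k0 a - D..k0 a + D}" by simp
        qed (rule PiE_arb[OF 3])
      qed
      then have "card {k\<in>T. ?f k = p} \<le> card (\<Pi>\<^sub>E a\<in>A. {k0 a - D..k0 a + D})"
        by (rule card_mono[rotated]) (auto simp: finite_A intro: finite_PiE)
      also have "\<dots> = (\<Prod>a\<in>A. card {k0 a - D..k0 a + D})" by (simp add: card_PiE finite_A)
      also have "\<dots> \<le> (\<Prod>a\<in>A. 2 * D + 1)" by (intro prod_mono) auto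
      finally show ?thesis by (simp add: C_def)
    qed (simp only: card.empty)
    have "(\<Sum>k\<in>T. G (opt_basis k) (restrict k (opt_basis k))) = (\<Sum>k\<in>T. (\<lambda>(I,\<kappa>). G I \<kappa>) (?f k))" by simp
    also have "\<dots> = (\<Sum>p\<in>?f ` T. \<Sum>k\<in>{k\<in>T. ?f k = p}. (\<lambda>(I,\<kappa>). G I \<kappa>) (?f k))"
      by (rule sum.image_gen[OF finT])
    also have "\<dots> = (\<Sum>p\<in>?f ` T. real (card {k\<in>T. ?f k = p}) * (\<lambda>(I,\<kappa>). G I \<kappa>) p)"
    proof (intro sum.cong refl)
      fix p
      have "(\<Sum>k\<in>{k\<in>T. ?f k = p}. (\<lambda>(I,\<kappa>). G I \<kappa>) (?f k)) = (\<Sum>k\<in>{k\<in>T. ?f k = p}. (\<lambda>(I,\<kappa>). G I \<kappa>) p)"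
        by (rule sum.cong) (simp_all only: mem_Collect_eq)
      then show "(\<Sum>k\<in>{k\<in>T. ?f k = p}. (\<lambda>(I,\<kappa>). G I \<kappa>) (?f k)) = real (card {k\<in>T. ?f k = p}) * (\<lambda>(I,\<kappa>). G I \<kappa>) p"
        by (simp only: sum_constant)
    qed
    also have "\<dots> \<le> (\<Sum>p\<in>?f ` T. real C * (\<lambda>(I,\<kappa>). G I \<kappa>) p)"
      using fib G im by (intro sum_mono mult_right_mono) (auto simp: of_nat_le_iff)
    also have "\<dots> \<le> (\<Sum>p\<in>?S. real C * (\<lambda>(I,\<kappa>). G I \<kappa>) p)"
      using im finS G by (intro sum_mono2) auto
    also have "\<dots> = real C * (\<Sum>I\<in>bases. \<Sum>\<kappa>\<in>I \<rightarrow>\<^sub>E {0..n}. G I \<kappa>)"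
      using finite_bases basesD
      by (subst sum.Sigma) (auto simp: sum_distrib_left intro!: finite_PiE)
    finally show ?thesis .
  qed
  then show ?thesis by (intro exI[of _ "real C"] conjI allI impI) auto
qed

end

section \<open>Fourier coefficients of tiles\<close>


text \<open>Near s = 1/2 the point lies in the closed left half plane, at distance at least 1 from
  1.\<close>

lemma norm_cis_minus_one_mid:
  assumes "\<bar>s - 1 / 2\<bar> \<le> 1 / 4"
  shows "1 \<le> norm (cis (2 * pi * s) - 1)"
proof -
  have "\<bar>2 * pi * (s - 1 / 2)\<bar> \<le> pi / 2"
    using mult_left_mono[OF assms, of "2 * pi"] by (simp add: abs_mult)
  then have "0 \<le> cos (2 * pi * (s - 1 / 2))" by (intro cos_ge_zero; linarith)
  also have "2 * pi * (s - 1 / 2) = 2 * pi * s - pi" by (simp add: algebra_simps)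
  finally have "1 \<le> \<bar>Re (cis (2 * pi * s) - 1)\<bar>" by (simp add: cos_diff)
  also have "\<dots> \<le> norm (cis (2 * pi * s) - 1)" by (rule abs_Re_le_cmod)
  finally show ?thesis .
qed

text \<open>A weak form of Jordan's inequality. Up to pi/3 the cosine is at least 1/2, which gives x
  / 2; beyond it the sine is at least 1/2.\<close>

lemma sin_lower_bound:
  assumes "0 \<le> x" "x \<le> pi / 2"
  shows "x / pi \<le> sin x"
proof (cases "x \<le> pi / 3")
  case True
  have "\<exists>y\<in>{0..x}. sin x - sin 0 = cos y * (x - 0)" if "0 < x"
    using MVT2[of 0 x sin cos] that by (force intro: derivative_eq_intros)
  moreover have "1 / 2 \<le> cos y" if "y \<in> {0..x}" for y
  proof -
    have "cos (pi / 3) \<le> cos y" using that True by (intro cos_monotone_0_pi_le) auto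
    then show ?thesis by (simp add: cos_60)
  qed
  ultimately have "0 < x \<longrightarrow> x * (1 / 2) \<le> sin x"
    using assms by (metis diff_zero mult.commute mult_right_mono sin_zero)
  moreover have "x / pi \<le> x / 2" using assms pi_ge_two by (intro divide_left_mono) auto
  ultimately show ?thesis using assms by (cases "x = 0") (simp, linarith)
next
  case False
  have "sin (pi / 6) \<le> sin x" using False assms by (intro sin_monotone_2pi_le) auto
  then have "1 / 2 \<le> sin x" by (simp add: sin_30)
  moreover have "x / pi \<le> 1 / 2" using assms by (simp add: field_simps)
  ultimately show ?thesis by linarith
qed

lemma norm_cis_minus_one_lower:
  assumes "\<bar>s\<bar> \<le> 1 / 2"
  shows "\<bar>s\<bar> \<le> norm (cis (2 * pi * s) - 1)"
proof -
  have "\<bar>s\<bar> * pi / pi \<le> sin (\<bar>s\<bar> * pi)"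
    using assms by (intro sin_lower_bound) auto
  also have "\<dots> \<le> \<bar>sin (s * pi)\<bar>" by (simp add: abs_if)
  finally have "2 * \<bar>s\<bar> \<le> 2 * \<bar>sin (2 * pi * s / 2)\<bar>" by (simp add: mult.commute)
  also have "\<dots> = norm (cis (2 * pi * s) - 1)"
    unfolding cis_conv_exp dist_exp_i_1[symmetric] by simp
  finally show ?thesis by linarith
qed

definition pt :: "nat \<Rightarrow> int ^ 'n \<Rightarrow> real ^ 'n" where
  "pt M z = (1 / real M) *\<^sub>R rvec z"

lemma pt_add: "pt M (y + z) = pt M y + pt M z"
  by (simp add: pt_def int_vec_to_real_add scaleR_add_right)

context frame begin

lemma inner_A_le:
  assumes "a \<in> A" "\<And>j. \<bar>x $ j\<bar> \<le> B"
  shows "\<bar>a \<bullet> x\<bar> \<le> B"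
proof -
  have "\<bar>a \<bullet> x\<bar> \<le> (\<Sum>j\<in>UNIV. \<bar>a $ j\<bar> * \<bar>x $ j\<bar>)"
    unfolding inner_vec_def by (rule order_trans[OF sum_abs]) (simp add: abs_mult)
  also have "\<dots> \<le> (\<Sum>j\<in>(UNIV :: 'n set). 1 / real CARD('n) * B)"
    using assms entry_A by (intro sum_mono mult_mono) auto
  finally show ?thesis by simp
qed

text \<open>There are finitely many bases, so the sum of their constants serves all of them.\<close>

lemma bases_uniform:
  assumes "\<And>I. I \<in> bases \<Longrightarrow> \<exists>C\<ge>0. P I (C :: real)"
    and mono: "\<And>I C D. I \<in> bases \<Longrightarrow> P I C \<Longrightarrow> C \<le> D \<Longrightarrow> P I D"
  shows "\<exists>C\<ge>0. \<forall>I\<in>bases. P I C"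
proof -
  from assms(1) have "\<forall>I\<in>bases. \<exists>C\<ge>0. P I C" by blast
  then obtain C where C: "\<forall>I\<in>bases. 0 \<le> C I \<and> P I (C I)" by (rule bchoice[THEN exE])
  have "P I (\<Sum>I\<in>bases. C I)" if "I \<in> bases" for I
    by (rule mono[OF that, of "C I"]) (use C that finite_bases in \<open>auto intro!: member_le_sum\<close>)
  moreover have "0 \<le> (\<Sum>I\<in>bases. C I)" using C by (auto intro: sum_nonneg)
  ultimately show ?thesis by blast
qed

end

section \<open>Differences of tiles on the grid\<close>

context step_frame begin

text \<open>Every factor of a tile is one fixed bump evaluated at an affine function. Step sizes are
  measured relative to the tile, by 2^k(a) (a . h), so that a single constant serves all scales, all
  \<open>b\<close> and all grids.\<close>

lemma tile_diff_bounded: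
  "\<exists>K\<ge>0. \<forall>k b M ps. length ps \<le> 2 * CARD('n) \<longrightarrow>
    (\<forall>p\<in>set ps. 0 \<le> snd p \<and> (\<forall>a\<in>A. \<bar>2 ^ k a * (a \<bullet> pt M (fst p))\<bar> \<le> snd p)) \<longrightarrow>
    diff_bounded K ps (\<lambda>z. tile k b (pt M z))"
proof -
  let ?P = "2 * CARD('n)"
  define K1 where "K1 = Cth * 2 ^ ?P + Cth"
  have C0: "0 \<le> Cth" using th_smooth[unfolded smooth_upto_def, rule_format, of "[]"] by (auto intro: diff_bounded_nonneg)
  then have K1: "0 \<le> K1" by (simp add: K1_def)
  have "diff_bounded ((2 ^ ?P * K1) ^ card A) ps (\<lambda>z. tile k b (pt M z))"
    if len: "length ps \<le> ?P" and ps: "\<forall>p\<in>set ps. 0 \<le> snd p \<and> (\<forall>a\<in>A. \<bar>2 ^ k a * (a \<bullet> pt M (fst p))\<bar> \<le> snd p)"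
    for k b M and ps :: "((int ^ 'n) \<times> real) list"
  proof -
    have nn: "\<And>p. p \<in> set ps \<Longrightarrow> 0 \<le> snd p" using ps by blast
    have "diff_bounded K1 ps (\<lambda>z. psi (2 ^ k a * (b a - a \<bullet> pt M z)))" if a: "a \<in> A" for a
    proof -
      let ?L = "\<lambda>z. - (2 ^ k a * (a \<bullet> pt M z))"
      have sm: "diff_bounded Cth (map (\<lambda>p. (L (fst p), \<bar>L (fst p)\<bar>)) qs) th"
        if "length qs \<le> ?P" for L :: "int ^ 'n \<Rightarrow> real" and qs :: "((int ^ 'n) \<times> real) list"
      proof -
        have "diff_bounded Cth (map (\<lambda>t. (t, \<bar>t\<bar>)) (map (\<lambda>p. L (fst p)) qs)) th"
          using th_smooth that unfolding smooth_upto_def by (metis length_map)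
        then show ?thesis by (simp add: comp_def)
      qed
      have 1: "diff_bounded Cth ps (\<lambda>z. th (?L z + 2 ^ k a * b a))"
        by (rule diff_bounded_compose[OF _ sm[OF len]])
          (use ps a in \<open>auto simp: pt_add inner_add_right distrib_left\<close>)
      \<comment> \<open>The term \<open>th (2 * t)\<close> of \<open>psi\<close> sees every step
        doubled; \<open>diff_bounded_scale\<close> moves this into the constant.\<close>
      let ?qs = "map (\<lambda>p. (fst p, 2 * snd p)) ps"
      have 2: "diff_bounded Cth ?qs (\<lambda>z. th (2 * ?L z + 2 * 2 ^ k a * b a))"
        by (rule diff_bounded_compose[OF _ sm])
          (use ps a len in \<open>auto simp: pt_add inner_add_right distrib_left abs_mult\<close>)
      have "diff_bounded (Cth * 2 ^ length ps) ps (\<lambda>z. th (2 * ?L z + 2 * 2 ^ k a * b a))"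
        by (rule diff_bounded_scale[OF 2]) (use nn in auto)
      then have "diff_bounded (Cth * 2 ^ ?P) ps (\<lambda>z. th (2 * ?L z + 2 * 2 ^ k a * b a))"
        by (rule diff_bounded_mono) (use nn len C0 in \<open>auto intro!: mult_left_mono power_increasing\<close>)
      from diff_bounded_diff[OF this 1] show ?thesis
        by (simp add: psi_def K1_def algebra_simps)
    qed
    then have "diff_bounded ((2 ^ length ps * K1) ^ card A) ps (\<lambda>z. tile k b (pt M z))"
      unfolding tile_def using finite_A nn by (intro diff_bounded_prod) auto
    then show ?thesis
      by (rule diff_bounded_mono)
        (use nn len K1 in \<open>auto intro!: power_mono mult_right_mono power_increasing\<close>)
  qed
  then show ?thesis using K1 by (intro exI[of _ "(2 ^ ?P * K1) ^ card A"]) auto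
qed

text \<open>Differencing widens each slab of the basis by a bounded multiple of its own width. The
  condition 2^k(i) \<le> Q M keeps the slabs from being much thinner than the grid, so the additive
  2 of the integer count is absorbed into the volume.\<close>

lemma card_tile_difs_support:
  fixes S Q :: real
  assumes "0 \<le> S" "1 \<le> Q"
  shows "\<exists>K\<ge>0. \<forall>I\<in>bases. \<forall>k b M hs. 1 \<le> M \<longrightarrow> length hs \<le> 2 * CARD('n) \<longrightarrow>
    (\<forall>h\<in>set hs. \<forall>i\<in>I. \<bar>2 ^ k i * (i \<bullet> pt M h)\<bar> \<le> S) \<longrightarrow> (\<forall>i\<in>I. 2 ^ k i \<le> Q * real M) \<longrightarrow>
    finite {z. difs hs (\<lambda>z. tile k b (pt M z)) z \<noteq> 0} \<and>
    card {z. difs hs (\<lambda>z. tile k b (pt M z)) z \<noteq> 0} \<le> K * (real M ^ CARD('n) * (\<Prod>i\<in>I. 1 / 2 ^ k i))"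
  (is "\<exists>K\<ge>0. \<forall>I\<in>bases. ?P I K")
proof (rule bases_uniform)
  fix I assume I: "I \<in> bases"
  let ?d = "CARD('n)"
  note I' = basesD[OF I]
  have "span (id ` I) = UNIV" using I' by simp
  from card_integer_points_slabs[OF I'(2) this] obtain C :: real where C: "0 \<le> C"
    "\<And>l W. \<forall>a\<in>I. 0 \<le> W a \<Longrightarrow>
    finite {z. \<forall>a\<in>I. l a \<le> a \<bullet> rvec z \<and> a \<bullet> rvec z \<le> l a + W a} \<and>
    card {z. \<forall>a\<in>I. l a \<le> a \<bullet> rvec z \<and> a \<bullet> rvec z \<le> l a + W a} \<le> C * (\<Prod>a\<in>I. W a + 2)"
    by auto
  \<comment> \<open>In units of M / 2^k: width 2 of the tile, a spread of 2 d S on either side, and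
    2 Q to absorb the additive 2 of the count.\<close>
  define E where "E = 2 + 4 * ?d * S + 2 * Q"
  have E: "0 \<le> E" using assms by (simp add: E_def)
  have "finite Z \<and> card Z \<le> (C * E ^ ?d) * (real M ^ ?d * (\<Prod>i\<in>I. 1 / 2 ^ k i))"
    if M: "1 \<le> M" and len: "length hs \<le> 2 * ?d" and hs: "\<forall>h\<in>set hs. \<forall>i\<in>I. \<bar>2 ^ k i * (i \<bullet> pt M h)\<bar> \<le> S"
      and kM: "\<forall>i\<in>I. 2 ^ k i \<le> Q * real M" and Z: "Z = {z. difs hs (\<lambda>z. tile k b (pt M z)) z \<noteq> 0}"
    for k b M hs Z
  proof -
    define l where "l i = M * (b i - (2 + 2 * ?d * S) / 2 ^ k i)" for i
    define W where "W i = M * ((2 + 4 * ?d * S) / 2 ^ k i)" for i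
    let ?B = "{z. \<forall>a\<in>I. l a \<le> a \<bullet> rvec z \<and> a \<bullet> rvec z \<le> l a + W a}"
    have W0: "\<forall>a\<in>I. 0 \<le> W a" using assms by (simp add: W_def)
    have "Z \<subseteq> ?B"
    proof (intro subsetI CollectI ballI)
      fix z i assume z: "z \<in> Z" and i: "i \<in> I"
      obtain v where v: "tile k b (pt M (z + v)) \<noteq> 0"
        "\<And>L :: int ^ 'n \<Rightarrow> real. (\<forall>x y. L (x + y) = L x + L y) \<Longrightarrow> \<bar>L v\<bar> \<le> (\<Sum>h\<leftarrow>hs. \<bar>L h\<bar>)"
        using support_difs[of hs "\<lambda>z. tile k b (pt M z)" z] z Z by auto
      have "\<bar>2 ^ k i * (i \<bullet> pt M v)\<bar> \<le> (\<Sum>h\<leftarrow>hs. \<bar>2 ^ k i * (i \<bullet> pt M h)\<bar>)"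
        by (rule v(2)) (simp add: pt_add inner_add_right distrib_left)
      also have "\<dots> \<le> (\<Sum>h\<leftarrow>hs. S)" using hs i by (intro sum_list_mono) auto
      also have "\<dots> = length hs * S" by (simp add: sum_list_triv)
      also have "\<dots> \<le> 2 * ?d * S" using len assms by (intro mult_right_mono) linarith+
      finally have "\<bar>i \<bullet> pt M v\<bar> \<le> 2 * ?d * S / 2 ^ k i"
        by (simp add: abs_mult field_simps)
      moreover have "0 < 1 / (2 * 2 ^ k i :: real)" by simp
      moreover have "i \<in> A" using i I' by auto
      note tile_support[OF v(1) this]
      ultimately have "b i - 2 / 2 ^ k i - 2 * ?d * S / 2 ^ k i \<le> i \<bullet> pt M z"
        "i \<bullet> pt M z \<le> b i + 2 * ?d * S / 2 ^ k i"
        by (simp_all add: pt_add inner_add_right abs_le_iff)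
      then have *: "b i - (2 + 2 * ?d * S) / 2 ^ k i \<le> i \<bullet> pt M z"
        "i \<bullet> pt M z \<le> (b i - (2 + 2 * ?d * S) / 2 ^ k i) + (2 + 4 * ?d * S) / 2 ^ k i"
      proof -
        have "(2 + 2 * ?d * S) / 2 ^ k i = 2 / 2 ^ k i + 2 * ?d * S / 2 ^ k i"
          "(2 + 4 * ?d * S) / 2 ^ k i = 2 / 2 ^ k i + 2 * (2 * ?d * S / 2 ^ k i)"
          by (simp_all add: add_divide_distrib)
        then show "b i - (2 + 2 * ?d * S) / 2 ^ k i \<le> i \<bullet> pt M z"
          "i \<bullet> pt M z \<le> (b i - (2 + 2 * ?d * S) / 2 ^ k i) + (2 + 4 * ?d * S) / 2 ^ k i"
          using \<open>b i - 2 / 2 ^ k i - 2 * ?d * S / 2 ^ k i \<le> i \<bullet> pt M z\<close>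
            \<open>i \<bullet> pt M z \<le> b i + 2 * ?d * S / 2 ^ k i\<close> by linarith+
      qed
      have "i \<bullet> rvec z = M * (i \<bullet> pt M z)" using M by (simp add: pt_def)
      then show "l i \<le> i \<bullet> rvec z \<and> i \<bullet> rvec z \<le> l i + W i"
        using * M unfolding l_def W_def distrib_left[symmetric] by (auto intro!: mult_left_mono)
    qed
    then have finZ: "finite Z" and "card Z \<le> card ?B"
      using C(2)[OF W0, of l] by (auto intro: finite_subset card_mono)
    moreover have "card ?B \<le> C * (\<Prod>a\<in>I. W a + 2)" using C(2)[OF W0] by blast
    moreover have "(\<Prod>a\<in>I. W a + 2) \<le> (\<Prod>a\<in>I. E * (M * (1 / 2 ^ k a)))"
    proof (intro prod_mono conjI)
      fix a assume a: "a \<in> I"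
      show "0 \<le> W a + 2" using W0 a by (simp add: add_nonneg_nonneg)
      have "1 \<le> Q * (M * (1 / 2 ^ k a))" using kM a by (simp add: field_simps)
      moreover have "W a = (2 + 4 * ?d * S) * (M * (1 / 2 ^ k a))" by (simp add: W_def)
      moreover have "E * (M * (1 / 2 ^ k a)) =
        (2 + 4 * ?d * S) * (M * (1 / 2 ^ k a)) + 2 * (Q * (M * (1 / 2 ^ k a)))"
        unfolding E_def by (simp only: distrib_right mult.assoc)
      ultimately show "W a + 2 \<le> E * (M * (1 / 2 ^ k a))" by linarith
    qed
    then have "C * (\<Prod>a\<in>I. W a + 2) \<le> C * (\<Prod>a\<in>I. E * (M * (1 / 2 ^ k a)))"
      using C(1) by (rule mult_left_mono)
    moreover have "C * (\<Prod>a\<in>I. E * (M * (1 / 2 ^ k a))) = C * E ^ ?d * (real M ^ ?d * (\<Prod>i\<in>I. 1 / 2 ^ k i))"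
      unfolding prod.distrib using card_basis[OF I] by simp
    ultimately have "card Z \<le> (C * E ^ ?d) * (real M ^ ?d * (\<Prod>i\<in>I. 1 / 2 ^ k i))"
      by linarith
    with finZ show ?thesis by simp
  qed
  then show "\<exists>C\<ge>0. ?P I C" using C(1) E by (intro exI[of _ "C * E ^ ?d"]) auto
next
  fix I and C D :: real assume *: "I \<in> bases" "?P I C" "C \<le> D"
  show "?P I D"
  proof (intro allI impI)
    fix k b and M :: nat and hs :: "(int ^ 'n) list"
    assume a: "1 \<le> M" "length hs \<le> 2 * CARD('n)"
      "\<forall>h\<in>set hs. \<forall>i\<in>I. \<bar>2 ^ k i * (i \<bullet> pt M h)\<bar> \<le> S" "\<forall>i\<in>I. 2 ^ k i \<le> Q * real M"
    have "C * (real M ^ CARD('n) * (\<Prod>i\<in>I. 1 / 2 ^ k i)) \<le> D * (real M ^ CARD('n) * (\<Prod>i\<in>I. 1 / 2 ^ k i))"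
      using *(3) by (intro mult_right_mono mult_nonneg_nonneg prod_nonneg) auto
    then show "finite {z. difs hs (\<lambda>z. tile k b (pt M z)) z \<noteq> 0} \<and>
      card {z. difs hs (\<lambda>z. tile k b (pt M z)) z \<noteq> 0} \<le> D * (real M ^ CARD('n) * (\<Prod>i\<in>I. 1 / 2 ^ k i))"
      using *(2)[rule_format, OF a(1,2), of k b] a(3,4) by (auto intro: order_trans)
  qed
qed

end


section \<open>Decay of the Fourier coefficients of one tile\<close>

context step_frame begin

text \<open>Combines the pointwise bound for the differences with the size of their support.
  Dividing by the character factors is postponed because the steps will be chosen according to
  \<xi>.\<close>

lemma tile_ghat_steps:
  fixes S Q :: real
  assumes "0 \<le> S" "1 \<le> Q"
  shows "\<exists>K\<ge>0. \<forall>I\<in>bases. \<forall>k b M ps \<xi>. 1 \<le> M \<longrightarrow> length ps \<le> 2 * CARD('n) \<longrightarrow>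
    (\<forall>p\<in>set ps. 0 \<le> snd p \<and> snd p \<le> S \<and> (\<forall>a\<in>A. \<bar>2 ^ k a * (a \<bullet> pt M (fst p))\<bar> \<le> snd p)) \<longrightarrow>
    (\<forall>i\<in>I. 2 ^ k i \<le> Q * real M) \<longrightarrow>
    (\<Prod>p\<leftarrow>ps. norm (zchar M (zdot \<xi> (fst p)) - 1)) * norm (ghat M (\<lambda>z. tile k b (pt M z)) \<xi>) \<le>
      K * (real M ^ CARD('n) * (\<Prod>i\<in>I. 1 / 2 ^ k i)) * prod_list (map snd ps)"
proof -
  obtain K1 where K1: "0 \<le> K1" "\<And>k b M ps. length ps \<le> 2 * CARD('n) \<Longrightarrow>
    (\<forall>p\<in>set ps. 0 \<le> snd p \<and> (\<forall>a\<in>A. \<bar>2 ^ k a * (a \<bullet> pt M (fst p))\<bar> \<le> snd p)) \<Longrightarrow>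
    diff_bounded K1 ps (\<lambda>z. tile k b (pt M z))"
    using tile_diff_bounded by blast
  from card_tile_difs_support[OF assms] obtain K2 where K2: "0 \<le> K2"
    and K2': "\<forall>I\<in>bases. \<forall>k b M hs. 1 \<le> M \<longrightarrow> length hs \<le> 2 * CARD('n) \<longrightarrow>
    (\<forall>h\<in>set hs. \<forall>i\<in>I. \<bar>2 ^ k i * (i \<bullet> pt M h)\<bar> \<le> S) \<longrightarrow> (\<forall>i\<in>I. 2 ^ k i \<le> Q * real M) \<longrightarrow>
    finite {z. difs hs (\<lambda>z. tile k b (pt M z)) z \<noteq> 0} \<and>
    card {z. difs hs (\<lambda>z. tile k b (pt M z)) z \<noteq> 0} \<le> K2 * (real M ^ CARD('n) * (\<Prod>i\<in>I. 1 / 2 ^ k i))"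
    by blast
  show ?thesis
  proof (intro exI[of _ "K1 * K2"] conjI ballI allI impI)
    show "0 \<le> K1 * K2" using K1 K2 by simp
    fix I k b M and \<xi> :: "int ^ 'n" and ps :: "((int ^ 'n) \<times> real) list"
    assume I: "I \<in> bases" and M: "1 \<le> M" and len: "length ps \<le> 2 * CARD('n)"
      and ps: "\<forall>p\<in>set ps. 0 \<le> snd p \<and> snd p \<le> S \<and> (\<forall>a\<in>A. \<bar>2 ^ k a * (a \<bullet> pt M (fst p))\<bar> \<le> snd p)"
      and kM: "\<forall>i\<in>I. 2 ^ k i \<le> Q * real M"
    let ?F = "\<lambda>z. tile k b (pt M z)" and ?hs = "map fst ps"
    let ?V = "real M ^ CARD('n) * (\<Prod>i\<in>I. 1 / 2 ^ k i)"
    have "finite {z. difs [] ?F z \<noteq> 0}"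
      using K2'[rule_format, OF I M, of "[]" k b] kM by simp
    then have fin: "finite {z. ?F z \<noteq> 0}" by simp
    have hs: "\<forall>h\<in>set ?hs. \<forall>i\<in>I. \<bar>2 ^ k i * (i \<bullet> pt M h)\<bar> \<le> S"
      using ps basesD(1)[OF I] by fastforce
    have cnt: "finite {z. difs ?hs ?F z \<noteq> 0}" "card {z. difs ?hs ?F z \<noteq> 0} \<le> K2 * ?V"
      using K2'[rule_format, OF I M, of ?hs k b] len hs kM by simp_all
    have "diff_bounded K1 ps ?F" using K1(2)[OF len] ps by blast
    from diff_bounded_difs[OF this]
    have "norm (ghat M (difs ?hs ?F) \<xi>) \<le> (K1 * prod_list (map snd ps)) * card {z. difs ?hs ?F z \<noteq> 0}"
      by (intro norm_ghat_le[OF cnt(1)]) auto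
    also have "\<dots> \<le> (K1 * prod_list (map snd ps)) * (K2 * ?V)"
      using cnt(2) K1(1) ps by (intro mult_left_mono mult_nonneg_nonneg prod_list_nonneg) auto
    finally show "(\<Prod>p\<leftarrow>ps. norm (zchar M (zdot \<xi> (fst p)) - 1)) * norm (ghat M ?F \<xi>) \<le>
        K1 * K2 * ?V * prod_list (map snd ps)"
      unfolding ghat_difs[OF fin] by (simp add: comp_def mult_ac)
  qed
qed

text \<open>The ideal step is the real vector on which the frequency takes the value \<open>1/2\<close>; rounding it to
  the grid moves that value by at most \<open>1/4\<close> because the frequency is low.\<close>

lemma low_frequency_step:
  fixes Q B :: real
  assumes I: "optimal k I" "i \<in> I" and m: "1 \<le> m" and Q: "1 \<le> Q" and B: "1 \<le> B"
    and dual_B: "\<And>a. a \<in> A \<Longrightarrow> \<bar>a \<bullet> dual I i\<bar> \<le> B" "\<And>j. \<bar>dual I i $ j\<bar> \<le> B"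
    and k: "\<And>a. a \<in> A \<Longrightarrow> 2 ^ k a \<le> Q * real m" and M: "1 \<le> M"
    and low: "\<And>j. \<bar>real_of_int (\<xi> $ j)\<bar> \<le> real M / (2 * real CARD('n) * real m)"
    and large: "1 / 2 < \<bar>dual I i \<bullet> rvec \<xi> / 2 ^ k i\<bar>"
  shows "\<exists>h. 1 \<le> norm (zchar M (zdot \<xi> h) - 1) \<and> (\<forall>a\<in>A. \<bar>2 ^ k a * (a \<bullet> pt M h)\<bar> \<le>
    (B + Q * B) * (1 / (2 * \<bar>dual I i \<bullet> rvec \<xi> / 2 ^ k i\<bar>)))"
proof -
  let ?d = "real CARD('n)"
  define y where "y = dual I i \<bullet> rvec \<xi>"
  have y0: "y \<noteq> 0" using large by (auto simp: y_def)
  define v where "v = (1 / (2 * y)) *\<^sub>R dual I i"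
  define h :: "int ^ 'n" where "h = (\<chi> j. round (real M * v $ j))"
  define e where "e = pt M h - v"
  have e: "\<bar>e $ j\<bar> \<le> 1 / (2 * real M)" for j
  proof -
    have "\<bar>real_of_int (h $ j) - real M * v $ j\<bar> \<le> 1 / 2"
      using of_int_round_abs_le[of "real M * v $ j"] by (simp add: h_def)
    moreover have "real M * e $ j = real_of_int (h $ j) - real M * v $ j"
      using M by (simp add: e_def pt_def field_simps)
    ultimately have "real M * \<bar>e $ j\<bar> \<le> 1 / 2" by (metis abs_mult abs_of_nat)
    then show ?thesis using M by (simp add: field_simps)
  qed
  have pt: "pt M h = v + e" by (simp add: e_def)
  have "real_of_int (zdot \<xi> h) / real M = rvec \<xi> \<bullet> pt M h"
    by (simp add: zdot_inner pt_def)
  also have "\<dots> = 1 / 2 + rvec \<xi> \<bullet> e"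
    using y0 by (simp add: pt inner_add_right v_def y_def inner_commute)
  finally have s: "real_of_int (zdot \<xi> h) / real M = 1 / 2 + rvec \<xi> \<bullet> e" .
  have "\<bar>rvec \<xi> \<bullet> e\<bar> \<le> (\<Sum>j\<in>UNIV. \<bar>real_of_int (\<xi> $ j)\<bar> * \<bar>e $ j\<bar>)"
    unfolding inner_vec_def by (rule order_trans[OF sum_abs]) (simp add: abs_mult)
  also have "\<dots> \<le> (\<Sum>j\<in>(UNIV :: 'n set). real M / (2 * ?d * real m) * (1 / (2 * real M)))"
    using low e by (intro sum_mono mult_mono) auto
  also have "\<dots> = 1 / (4 * real m)" using M by simp
  also have "\<dots> \<le> 1 / 4" using m by simp
  finally have "1 \<le> norm (cis (2 * pi * (real_of_int (zdot \<xi> h) / real M)) - 1)"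
    unfolding s by (intro norm_cis_minus_one_mid) simp
  then have 1: "1 \<le> norm (zchar M (zdot \<xi> h) - 1)" by (simp add: zchar_def)
  \<comment> \<open>The low frequency keeps y small, so the size \<sigma> of the step is at least m
    / (B M); this is what dominates the rounding error e.\<close>
  have yB: "\<bar>y\<bar> \<le> B * real M / (2 * real m)"
  proof -
    have "\<bar>y\<bar> \<le> (\<Sum>j\<in>UNIV. \<bar>dual I i $ j\<bar> * \<bar>real_of_int (\<xi> $ j)\<bar>)"
      unfolding y_def inner_vec_def by (rule order_trans[OF sum_abs]) (simp add: abs_mult)
    also have "\<dots> \<le> (\<Sum>j\<in>(UNIV :: 'n set). B * (real M / (2 * ?d * real m)))"
      using low dual_B B by (intro sum_mono mult_mono) auto
    finally show ?thesis by simp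
  qed
  define \<sigma> where "\<sigma> = 1 / (2 * \<bar>y / 2 ^ k i\<bar>)"
  have \<sigma>: "\<sigma> = 2 ^ k i / (2 * \<bar>y\<bar>)" using y0 by (simp add: \<sigma>_def)
  have \<sigma>0: "0 \<le> \<sigma>" by (simp add: \<sigma>_def)
  have 2: "\<bar>2 ^ k a * (a \<bullet> pt M h)\<bar> \<le> (B + Q * B) * \<sigma>" if a: "a \<in> A" for a
  proof -
    have "2 ^ k a * \<bar>a \<bullet> v\<bar> \<le> B * \<sigma>"
    proof (cases "a \<bullet> dual I i = 0")
      case True
      then show ?thesis using B \<sigma>0 by (simp add: v_def)
    next
      case False
      \<comment> \<open>Optimality: every \<open>a\<close> that sees the step \<open>v\<close> has a
        slab whose nominal width is at least that of \<open>i\<close>.\<close>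
      then have "k a \<le> k i" using I a by (auto simp: optimal_def)
      then have "(2 ^ k a :: real) \<le> 2 ^ k i" by (intro power_increasing) auto
      then have "2 ^ k a * \<bar>a \<bullet> dual I i\<bar> \<le> 2 ^ k i * B"
        using dual_B(1)[OF a] by (intro mult_mono) auto
      then have "2 ^ k a * \<bar>a \<bullet> dual I i\<bar> / (2 * \<bar>y\<bar>) \<le> 2 ^ k i * B / (2 * \<bar>y\<bar>)"
        by (intro divide_right_mono) auto
      then show ?thesis by (simp add: v_def \<sigma> abs_mult mult.commute)
    qed
    moreover have "2 ^ k a * \<bar>a \<bullet> e\<bar> \<le> Q * B * \<sigma>"
    proof -
      have "2 ^ k a * \<bar>a \<bullet> e\<bar> \<le> (Q * real m) * (1 / (2 * real M))"
        using k[OF a] inner_A_le[OF a e] Q by (intro mult_mono) auto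
      also have "\<dots> \<le> Q * B * \<sigma>"
      proof -
        have "1 \<le> (2 ^ k i :: real)" by simp
        then have "1 / (2 * \<bar>y\<bar>) \<le> \<sigma>" unfolding \<sigma> by (intro divide_right_mono) auto
        moreover have "1 / (2 * (B * real M / (2 * real m))) \<le> 1 / (2 * \<bar>y\<bar>)"
          using yB y0 B M m by (intro divide_left_mono) auto
        ultimately have "1 / (2 * (B * real M / (2 * real m))) \<le> \<sigma>" by linarith
        then have "real m / real M \<le> B * \<sigma>" using B M m by (simp add: field_simps)
        then have "Q * (real m / real M) \<le> Q * (B * \<sigma>)" using Q by (intro mult_left_mono) auto
        moreover have "(Q * real m) * (1 / (2 * real M)) \<le> Q * (real m / real M)"
        proof -
          define X where "X = Q * (real m / real M)"
          have "0 \<le> X" using Q by (simp add: X_def)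
          moreover have "(Q * real m) * (1 / (2 * real M)) = X / 2" by (simp add: X_def)
          ultimately have "(Q * real m) * (1 / (2 * real M)) \<le> X" by simp
          then show ?thesis by (simp only: X_def)
        qed
        ultimately show ?thesis by (simp add: mult.assoc)
      qed
      finally show ?thesis .
    qed
    moreover have "\<bar>2 ^ k a * (a \<bullet> pt M h)\<bar> \<le> 2 ^ k a * \<bar>a \<bullet> v\<bar> + 2 ^ k a * \<bar>a \<bullet> e\<bar>"
      unfolding pt inner_add_right distrib_left[symmetric] abs_mult
      by (simp add: mult_left_mono)
    ultimately show ?thesis by (simp add: distrib_right)
  qed
  show ?thesis
    using 1 2 unfolding \<sigma>_def y_def by blast
qed

text \<open>The second summand accounts for the frequencies above \<open>M / (2 d m)\<close>, where rounding to the grid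
  is too coarse and \<open>2 d\<close> unit steps are used instead; \<open>M = m\<^sup>5\<close> is large enough for the sum of these
  terms over all \<open>M\<^sup>d\<close> frequencies to be negligible.\<close>

lemma tile_ghat_bound:
  fixes Q :: real
  assumes Q: "1 \<le> Q"
  shows "\<exists>K\<ge>0. \<forall>m n k b I \<xi>. 1 \<le> m \<longrightarrow> 2 ^ n \<le> Q * real m \<longrightarrow> (\<forall>a\<in>A. k a \<le> n) \<longrightarrow> optimal k I \<longrightarrow>
    \<xi> \<in> freq_box (m ^ 5) \<longrightarrow>
    norm (ghat (m ^ 5) (\<lambda>z. tile k b (pt (m ^ 5) z)) \<xi>) \<le>
      K * (real (m ^ 5) ^ CARD('n) * (\<Prod>i\<in>I. 1 / 2 ^ k i)) *
        ((\<Prod>i\<in>I. phi (dual I i \<bullet> rvec \<xi> / 2 ^ k i)) + (1 / real m) ^ (6 * CARD('n)))"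
proof -
  let ?d = "CARD('n)"
  obtain B where B: "1 \<le> B" "\<And>I i a. I \<in> bases \<Longrightarrow> i \<in> I \<Longrightarrow> a \<in> A \<Longrightarrow> \<bar>a \<bullet> dual I i\<bar> \<le> B"
    "\<And>I i j. I \<in> bases \<Longrightarrow> i \<in> I \<Longrightarrow> \<bar>dual I i $ j\<bar> \<le> B"
    using dual_bounds by blast
  define S where "S = B + Q * B"
  have "1 * 1 \<le> Q * B" using B(1) Q by (intro mult_mono) auto
  then have S: "1 \<le> S" "Q \<le> S" "0 \<le> S" using B(1) Q mult_left_mono[OF B(1), of Q] unfolding S_def by linarith+
  obtain K where K: "0 \<le> K" and K': "\<forall>I\<in>bases. \<forall>k b M ps \<xi>. 1 \<le> M \<longrightarrow> length ps \<le> 2 * CARD('n) \<longrightarrow>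
    (\<forall>p\<in>set ps. 0 \<le> snd p \<and> snd p \<le> S \<and> (\<forall>a\<in>A. \<bar>2 ^ k a * (a \<bullet> pt M (fst p))\<bar> \<le> snd p)) \<longrightarrow>
    (\<forall>i\<in>I. 2 ^ k i \<le> Q * real M) \<longrightarrow>
    (\<Prod>p\<leftarrow>ps. norm (zchar M (zdot \<xi> (fst p)) - 1)) * norm (ghat M (\<lambda>z. tile k b (pt M z)) \<xi>) \<le>
      K * (real M ^ CARD('n) * (\<Prod>i\<in>I. 1 / 2 ^ k i)) * prod_list (map snd ps)"
    using tile_ghat_steps[OF S(3) Q] by blast
  define K0 where "K0 = K * (S\<^sup>2 * 2) ^ ?d + K * (2 * ?d * Q) ^ (2 * ?d)"
  show ?thesis
  proof (intro exI[of _ K0] conjI allI impI)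
    show "0 \<le> K0" using K Q by (simp add: K0_def)
    fix m n k b I and \<xi> :: "int ^ 'n"
    assume m: "1 \<le> m" and n: "2 ^ n \<le> Q * real m" and kn: "\<forall>a\<in>A. k a \<le> n" and opt: "optimal k I"
      and \<xi>: "\<xi> \<in> freq_box (m ^ 5)"
    define M where "M = m ^ 5"
    have M: "1 \<le> M" "m \<le> M" using m by (simp_all add: M_def self_le_power)
    have I: "I \<in> bases" using opt by (simp add: optimal_def)
    note I' = basesD[OF I]
    have k: "2 ^ k a \<le> Q * real m" if "a \<in> A" for a
    proof -
      have "(2 ^ k a :: real) \<le> 2 ^ n" using kn that by (intro power_increasing) auto
      then show ?thesis using n by linarith
    qed
    have kM: "\<forall>i\<in>I. 2 ^ k i \<le> Q * real M"
    proof
      fix i assume "i \<in> I"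
      then have "2 ^ k i \<le> Q * real m" using k I' by auto
      also have "\<dots> \<le> Q * real M" using M Q by (intro mult_left_mono) auto
      finally show "2 ^ k i \<le> Q * real M" .
    qed
    define V where "V = real M ^ CARD('n) * (\<Prod>i\<in>I. 1 / 2 ^ k i)"
    let ?G = "norm (ghat M (\<lambda>z. tile k b (pt M z)) \<xi>)"
    define \<eta> where "\<eta> i = dual I i \<bullet> rvec \<xi> / 2 ^ k i" for i
    have V: "0 \<le> V" unfolding V_def by (intro mult_nonneg_nonneg prod_nonneg) auto
    have phi0: "0 \<le> (\<Prod>i\<in>I. phi (\<eta> i))" by (intro prod_nonneg ballI less_imp_le phi_pos)
    have "?G \<le> K0 * V * ((\<Prod>i\<in>I. phi (\<eta> i)) + (1 / real m) ^ (6 * ?d))"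
    proof (cases "\<forall>j. \<bar>real_of_int (\<xi> $ j)\<bar> \<le> real M / (2 * real ?d * real m)")
      case True
      \<comment> \<open>Differences are taken only in directions where the frequency is large for
        the tile; in the others \<open>phi (\<eta> i)\<close> is at least 1/2 and nothing has to be
        gained.\<close>
      define J where "J = {i\<in>I. 1 / 2 < \<bar>\<eta> i\<bar>}"
      have J: "finite J" "J \<subseteq> I" using I' by (auto simp: J_def)
      let ?\<sigma> = "\<lambda>i. S * (1 / (2 * \<bar>\<eta> i\<bar>))"
      have "\<exists>h. 1 \<le> norm (zchar M (zdot \<xi> h) - 1) \<and> (\<forall>a\<in>A. \<bar>2 ^ k a * (a \<bullet> pt M h)\<bar> \<le> ?\<sigma> i)" if i: "i \<in> J" for i
      proof -
        have iI: "i \<in> I" "1 / 2 < \<bar>\<eta> i\<bar>" using i by (auto simp: J_def)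
        show ?thesis unfolding S_def \<eta>_def
          by (rule low_frequency_step[OF opt iI(1) m Q B(1) B(2)[OF I iI(1)] B(3)[OF I iI(1)] k M(1) True[rule_format] iI(2)[unfolded \<eta>_def]])
      qed
      then have "\<exists>h. \<forall>i\<in>J. 1 \<le> norm (zchar M (zdot \<xi> (h i)) - 1) \<and> (\<forall>a\<in>A. \<bar>2 ^ k a * (a \<bullet> pt M (h i))\<bar> \<le> ?\<sigma> i)"
        by (intro bchoice) blast
      then obtain h where h: "\<And>i. i \<in> J \<Longrightarrow> 1 \<le> norm (zchar M (zdot \<xi> (h i)) - 1)"
        "\<And>i a. i \<in> J \<Longrightarrow> a \<in> A \<Longrightarrow> \<bar>2 ^ k a * (a \<bullet> pt M (h i))\<bar> \<le> ?\<sigma> i" by blast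
      obtain xs where xs: "set xs = J" "distinct xs" using finite_distinct_list[OF J(1)] by blast
      \<comment> \<open>Each direction occurs twice, so that the squared step size matches the decay
        of \<open>phi\<close>.\<close>
      define ps where "ps = map (\<lambda>i. (h i, ?\<sigma> i)) (xs @ xs)"
      have "length xs = card J" using xs distinct_card by metis
      also have "\<dots> \<le> ?d" using card_mono[OF I'(2) J(2)] card_basis[OF I] by simp
      finally have len: "length xs \<le> ?d" .
      have \<sigma>S: "0 \<le> ?\<sigma> i" "?\<sigma> i \<le> S" if "i \<in> J" for i
      proof -
        have "1 < 2 * \<bar>\<eta> i\<bar>" using that by (simp add: J_def)
        then have "1 / (2 * \<bar>\<eta> i\<bar>) \<le> 1" by (subst divide_le_eq_1_pos) linarith+
        then have "?\<sigma> i \<le> S * 1" using S by (intro mult_left_mono) auto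
        then show "?\<sigma> i \<le> S" by simp
        show "0 \<le> ?\<sigma> i" using S by (intro mult_nonneg_nonneg divide_nonneg_nonneg) auto
      qed
      have ps: "\<forall>p\<in>set ps. 0 \<le> snd p \<and> snd p \<le> S \<and> (\<forall>a\<in>A. \<bar>2 ^ k a * (a \<bullet> pt M (fst p))\<bar> \<le> snd p)"
      proof
        fix p assume "p \<in> set ps"
        then obtain i where "i \<in> J" "p = (h i, ?\<sigma> i)" using xs by (auto simp: ps_def)
        then show "0 \<le> snd p \<and> snd p \<le> S \<and> (\<forall>a\<in>A. \<bar>2 ^ k a * (a \<bullet> pt M (fst p))\<bar> \<le> snd p)"
          using \<sigma>S h by simp
      qed
      have one: "1 \<le> (\<Prod>p\<leftarrow>ps. norm (zchar M (zdot \<xi> (fst p)) - 1))"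
      proof -
        have "1 \<le> (\<Prod>i\<leftarrow>ys. norm (zchar M (zdot \<xi> (h i)) - 1))" if "set ys \<subseteq> J" for ys
          using that
        proof (induction ys)
          case (Cons y ys)
          then show ?case using mult_mono[of 1 _ 1] h(1)[of y] by force
        qed simp
        from this[of "xs @ xs"] show ?thesis using xs by (simp add: ps_def comp_def)
      qed
      have "?G \<le> (\<Prod>p\<leftarrow>ps. norm (zchar M (zdot \<xi> (fst p)) - 1)) * ?G"
        using mult_right_mono[OF one, of ?G] by simp
      also have "\<dots> \<le> K * V * prod_list (map snd ps)"
        by (rule K'[rule_format, OF I M(1), of _ k, folded V_def]) (use len ps kM in \<open>auto simp: ps_def\<close>)
      also have "prod_list (map snd ps) = (\<Prod>i\<in>J. (?\<sigma> i)\<^sup>2)"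
      proof -
        have "prod_list (map snd ps) = (\<Prod>i\<in>J. ?\<sigma> i) * (\<Prod>i\<in>J. ?\<sigma> i)"
          using prod.distinct_set_conv_list[OF xs(2), of ?\<sigma>] xs(1) by (simp add: ps_def comp_def)
        then show ?thesis by (simp only: prod.distrib power2_eq_square)
      qed
      also have "\<dots> \<le> (S\<^sup>2 * 2) ^ ?d * (\<Prod>i\<in>I. phi (\<eta> i))"
      proof -
        have "(\<Prod>i\<in>J. (?\<sigma> i)\<^sup>2) = (\<Prod>i\<in>I. if i \<in> J then (?\<sigma> i)\<^sup>2 else 1)"
          using J I' by (simp add: prod.If_cases Int_absorb1)
        also have "\<dots> \<le> (\<Prod>i\<in>I. S\<^sup>2 * 2 * phi (\<eta> i))"
        proof (intro prod_mono conjI)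
          fix i assume i: "i \<in> I"
          have S2: "1 \<le> S\<^sup>2" using S by simp
          have pos: "0 < 1 + (\<eta> i)\<^sup>2" by (auto intro: add_pos_nonneg)
          show "(if i \<in> J then (?\<sigma> i)\<^sup>2 else 1) \<le> S\<^sup>2 * 2 * phi (\<eta> i)"
          proof (cases "i \<in> J")
            case True
            then have "1 / 2 < \<bar>\<eta> i\<bar>" by (simp add: J_def)
            then have "(1 / 2)\<^sup>2 \<le> \<bar>\<eta> i\<bar>\<^sup>2" by (intro power_mono) auto
            then have q: "1 / 4 \<le> (\<eta> i)\<^sup>2" by (simp add: power2_eq_square)
            have "(1 / (2 * \<bar>\<eta> i\<bar>))\<^sup>2 = 1 / (4 * (\<eta> i)\<^sup>2)" by (simp add: power_divide power_mult_distrib)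
            also have "\<dots> \<le> 2 * phi (\<eta> i)"
            proof -
              have "1 / (4 * (\<eta> i)\<^sup>2) \<le> 2 / (1 + (\<eta> i)\<^sup>2)"
                using q pos by (subst frac_le_eq) (auto intro!: divide_nonpos_pos mult_pos_pos)
              then show ?thesis by (simp add: phi_def)
            qed
            finally have "S\<^sup>2 * (1 / (2 * \<bar>\<eta> i\<bar>))\<^sup>2 \<le> S\<^sup>2 * (2 * phi (\<eta> i))"
              by (rule mult_left_mono) simp
            then show ?thesis using True by (simp only: power_mult_distrib if_True mult.assoc)
          next
            case False
            then have "\<bar>\<eta> i\<bar> \<le> 1" using i by (simp add: J_def)
            then have "(\<eta> i)\<^sup>2 \<le> 1" by (simp only: abs_square_le_1)
            then have "1 \<le> 2 * phi (\<eta> i)" using pos by (simp add: phi_def del: power_divide)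
            then have "1 * 1 \<le> S\<^sup>2 * (2 * phi (\<eta> i))" using S2 by (intro mult_mono) auto
            then show ?thesis using False by simp
          qed
          show "0 \<le> (if i \<in> J then (?\<sigma> i)\<^sup>2 else 1)" by simp
        qed
        also have "\<dots> = (S\<^sup>2 * 2) ^ ?d * (\<Prod>i\<in>I. phi (\<eta> i))"
          using card_basis[OF I] by (simp add: prod.distrib)
        finally show ?thesis .
      qed
      finally have "?G \<le> K * V * ((S\<^sup>2 * 2) ^ ?d * (\<Prod>i\<in>I. phi (\<eta> i)))"
        using K V by (simp add: mult_left_mono)
      also have "\<dots> = (K * (S\<^sup>2 * 2) ^ ?d) * V * (\<Prod>i\<in>I. phi (\<eta> i))" by (simp only: mult_ac)
      also have "\<dots> \<le> K0 * V * ((\<Prod>i\<in>I. phi (\<eta> i)) + (1 / real m) ^ (6 * ?d))"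
        using K V phi0 Q unfolding K0_def
        by (intro mult_mono mult_right_mono mult_nonneg_nonneg add_nonneg_nonneg) auto
      finally show ?thesis .
    next
      case False
      then obtain j where j: "real M / (2 * real ?d * real m) < \<bar>real_of_int (\<xi> $ j)\<bar>"
        unfolding not_all not_le by blast
      define h :: "int ^ 'n" where "h = axis j 1"
      define ps where "ps = replicate (2 * ?d) (h, Q * real m / real M)"
      have pth: "pt M h = (1 / real M) *\<^sub>R axis j 1"
        by (simp add: pt_def h_def int_vec_to_real_def axis_def vec_eq_iff)
      have "\<bar>2 ^ k a * (a \<bullet> pt M h)\<bar> \<le> Q * real m / real M" if a: "a \<in> A" for a
      proof -
        have "\<bar>a $ j\<bar> \<le> 1" using entry_A[OF a, of j] by (rule order_trans) simp
        then have "2 ^ k a * \<bar>a $ j\<bar> \<le> (Q * real m) * 1" using k[OF a] Q by (intro mult_mono) auto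
        then have "2 ^ k a * \<bar>a $ j\<bar> / real M \<le> Q * real m / real M" by (intro divide_right_mono) auto
        then show ?thesis by (simp add: pth inner_axis abs_mult)
      qed
      moreover have "Q * real m / real M \<le> S"
      proof -
        have "Q * real m / real M \<le> Q" using M Q by (simp add: field_simps)
        then show ?thesis using S by linarith
      qed
      ultimately have ps: "\<forall>p\<in>set ps. 0 \<le> snd p \<and> snd p \<le> S \<and> (\<forall>a\<in>A. \<bar>2 ^ k a * (a \<bullet> pt M (fst p))\<bar> \<le> snd p)"
        using Q by (auto simp: ps_def)
      have "zdot \<xi> h = \<xi> $ j" by (simp add: zdot_def h_def axis_def if_distrib cong: if_cong)
      then have z: "zchar M (zdot \<xi> h) = cis (2 * pi * (real_of_int (\<xi> $ j) / real M))"
        by (simp add: zchar_def)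
      have "\<bar>real_of_int (\<xi> $ j) / real M\<bar> \<le> 1 / 2"
        using freq_box_bound[OF \<xi>, of j] M by (simp add: M_def[symmetric] abs_divide field_simps)
      then have "\<bar>real_of_int (\<xi> $ j) / real M\<bar> \<le> norm (zchar M (zdot \<xi> h) - 1)"
        unfolding z by (rule norm_cis_minus_one_lower)
      moreover have "1 / (2 * real ?d * real m) \<le> \<bar>real_of_int (\<xi> $ j) / real M\<bar>"
        using j M by (simp add: abs_divide field_simps)
      ultimately have low: "1 / (2 * real ?d * real m) \<le> norm (zchar M (zdot \<xi> h) - 1)" by linarith
      have "(1 / (2 * real ?d * real m)) ^ (2 * ?d) * ?G \<le> (\<Prod>p\<leftarrow>ps. norm (zchar M (zdot \<xi> (fst p)) - 1)) * ?G"
        using low by (intro mult_right_mono) (auto simp: ps_def prod_list_replicate intro!: power_mono)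
      also have "\<dots> \<le> K * V * prod_list (map snd ps)"
        by (rule K'[rule_format, OF I M(1), of _ k, folded V_def]) (use ps kM in \<open>auto simp: ps_def\<close>)
      also have "\<dots> = K * V * (Q * real m / real M) ^ (2 * ?d)"
        by (simp add: ps_def prod_list_replicate)
      finally have "(1 / (2 * real ?d * real m)) ^ (2 * ?d) * ?G \<le> K * V * (Q * real m / real M) ^ (2 * ?d)" .
      then have "?G \<le> K * V * ((Q * real m / real M) * (2 * real ?d * real m)) ^ (2 * ?d)"
        using m by (simp add: power_mult_distrib power_divide field_simps)
      \<comment> \<open>m^2 / M = m^(-3), and the power 2 d turns this into the m^(-6 d) of the
        second summand.\<close>
      also have "(Q * real m / real M) * (2 * real ?d * real m) = (2 * ?d * Q) * (1 / real m) ^ 3"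
        using m by (simp add: M_def power_divide field_simps eval_nat_numeral)
      also have "K * V * ((2 * ?d * Q) * (1 / real m) ^ 3) ^ (2 * ?d) =
          (K * (2 * ?d * Q) ^ (2 * ?d)) * V * (1 / real m) ^ (6 * ?d)"
        unfolding power_mult_distrib[of "2 * ?d * Q"] power_mult[symmetric] by (simp add: mult_ac)
      also have "\<dots> \<le> K0 * V * ((\<Prod>i\<in>I. phi (\<eta> i)) + (1 / real m) ^ (6 * ?d))"
        using K V phi0 Q unfolding K0_def
        by (intro mult_mono mult_right_mono mult_nonneg_nonneg add_nonneg_nonneg) auto
      finally show ?thesis .
    qed
    then show "norm (ghat (m ^ 5) (\<lambda>z. tile k b (pt (m ^ 5) z)) \<xi>) \<le>
      K0 * (real (m ^ 5) ^ CARD('n) * (\<Prod>i\<in>I. 1 / 2 ^ k i)) *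
        ((\<Prod>i\<in>I. phi (dual I i \<bullet> rvec \<xi> / 2 ^ k i)) + (1 / real m) ^ (6 * CARD('n)))"
      by (simp only: M_def \<eta>_def V_def)
  qed
qed

end

section \<open>Averaging over generators\<close>


definition gen_box :: "nat \<Rightarrow> (int ^ 'n) set" where
  "gen_box m = {g. \<forall>j. g $ j \<in> {1..int m - 1}}"

lemma finite_gen_box: "finite (gen_box m)"
  unfolding gen_box_def by (rule finite_sum_vec_box) auto

lemma card_gen_box: "card (gen_box m :: (int ^ 'n) set) = (m - 1) ^ CARD('n)"
proof -
  have "nat (int m - 1) = m - 1" by simp
  then show ?thesis unfolding gen_box_def by (subst finite_sum_vec_box) auto
qed

text \<open>The other coordinates of a solution determine g_i modulo the prime \<open>m\<close>.
  Overwriting g_i by a free value t therefore maps the pairs (g, t) injectively into the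
  box.\<close>

lemma card_annihilated:
  fixes \<xi> :: "int ^ 'n"
  assumes m: "prime m" and i: "\<not> int m dvd \<xi> $ i"
  shows "card {g \<in> gen_box m. int m dvd zdot \<xi> g} * (m - 1) \<le> (m - 1) ^ CARD('n)"
proof -
  let ?Z = "{g \<in> gen_box m. int m dvd zdot \<xi> g}"
  let ?u = "\<lambda>(g :: int ^ 'n, t). \<chi> j. if j = i then t else g $ j"
  have "inj_on ?u (?Z \<times> {1..int m - 1})"
  proof (rule inj_onI, clarify)
    fix g g' :: "int ^ 'n" and t t'
    assume g: "g \<in> gen_box m" "int m dvd zdot \<xi> g" and g': "g' \<in> gen_box m" "int m dvd zdot \<xi> g'"
      and eq: "(\<chi> j. if j = i then t else g $ j) = (\<chi> j. if j = i then t' else g' $ j)"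
    have e: "(if j = i then t else g $ j) = (if j = i then t' else g' $ j)" for j
      using arg_cong[OF eq, of "\<lambda>v. v $ j"] by simp
    have t: "t = t'" using e[of i] by simp
    have off: "g $ j = g' $ j" if "j \<noteq> i" for j using e[of j] that by simp
    have "zdot \<xi> g - zdot \<xi> g' = (\<Sum>j\<in>UNIV. \<xi> $ j * (g $ j - g' $ j))"
      by (simp add: zdot_def right_diff_distrib sum_subtractf)
    also have "\<dots> = (\<Sum>j\<in>{i}. \<xi> $ j * (g $ j - g' $ j))"
      by (rule sum.mono_neutral_right) (auto simp: off)
    finally have "zdot \<xi> g - zdot \<xi> g' = \<xi> $ i * (g $ i - g' $ i)" by simp
    then have "int m dvd \<xi> $ i * (g $ i - g' $ i)" using g g' dvd_diff by metis
    then have "int m dvd g $ i - g' $ i" using m i by (auto simp: prime_dvd_mult_iff)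
    moreover have "\<bar>g $ i - g' $ i\<bar> < int m"
    proof -
      have "1 \<le> g $ i" "g $ i \<le> int m - 1" "1 \<le> g' $ i" "g' $ i \<le> int m - 1"
        using g g' by (auto simp: gen_box_def)
      then show ?thesis by linarith
    qed
    ultimately have "g $ i = g' $ i" using zdvd_imp_le[of "int m" "\<bar>g $ i - g' $ i\<bar>"] by force
    then show "g = g' \<and> t = t'" using off t by (auto simp: vec_eq_iff) metis
  qed
  moreover have "?u ` (?Z \<times> {1..int m - 1}) \<subseteq> gen_box m"
    by (auto simp: gen_box_def)
  ultimately have "card (?Z \<times> {1..int m - 1}) \<le> card (gen_box m :: (int ^ 'n) set)"
    using finite_gen_box by (rule card_inj_on_le)
  moreover have "nat (int m - 1) = m - 1" by simp
  ultimately show ?thesis by (simp add: card_cartesian_product card_gen_box)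
qed

text \<open>If every \<open>g\<close> exceeded the bound, so would the sum over all of them;
  exchanging the sums contradicts this. Multiples of \<open>m\<close> are annihilated by all
  \<open>g\<close> and enter with full weight.\<close>

lemma good_generator_exists:
  fixes w :: "int ^ 'n \<Rightarrow> real"
  assumes m: "prime m" and X: "finite X" and w: "\<And>\<xi>. 0 \<le> w \<xi>"
  shows "\<exists>g\<in>gen_box m. (\<Sum>\<xi> | \<xi> \<in> X \<and> int m dvd zdot \<xi> g. w \<xi>) \<le>
    (\<Sum>\<xi>\<in>X. w \<xi>) / (m - 1) + (\<Sum>\<xi> | \<xi> \<in> X \<and> (\<forall>i. int m dvd \<xi> $ i). w \<xi>)"
proof (rule ccontr)
  let ?G = "gen_box m :: (int ^ 'n) set"
  let ?N = "real (m - 1)"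
  let ?A = "{\<xi> \<in> X. \<forall>i. int m dvd \<xi> $ i}"
  define R where "R = (\<Sum>\<xi>\<in>X. w \<xi>) / (m - 1) + (\<Sum>\<xi>\<in>?A. w \<xi>)"
  assume "\<not> ?thesis"
  then have lt: "R < (\<Sum>\<xi> | \<xi> \<in> X \<and> int m dvd zdot \<xi> g. w \<xi>)" if "g \<in> ?G" for g
    using that by (auto simp: R_def not_le)
  have N: "0 < ?N" using prime_gt_1_nat[OF m] by simp
  have cardG: "real (card ?G) = ?N ^ CARD('n)" by (simp add: card_gen_box)
  then have ne: "?G \<noteq> {}" using N by (metis card.empty of_nat_0 power_eq_0_iff less_irrefl)
  have "real (card ?G) * R = (\<Sum>g\<in>?G. R)" by simp
  also have "\<dots> < (\<Sum>g\<in>?G. \<Sum>\<xi> | \<xi> \<in> X \<and> int m dvd zdot \<xi> g. w \<xi>)"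
    using lt finite_gen_box ne by (intro sum_strict_mono) auto
  also have "\<dots> = (\<Sum>g\<in>?G. \<Sum>\<xi>\<in>X. if int m dvd zdot \<xi> g then w \<xi> else 0)"
    using X by (simp add: sum.inter_filter)
  also have "\<dots> = (\<Sum>\<xi>\<in>X. \<Sum>g\<in>?G. if int m dvd zdot \<xi> g then w \<xi> else 0)"
    by (rule sum.swap)
  also have "\<dots> = (\<Sum>\<xi>\<in>X. w \<xi> * card {g\<in>?G. int m dvd zdot \<xi> g})"
    by (simp add: sum.inter_filter[symmetric] finite_gen_box mult.commute)
  also have "\<dots> \<le> (\<Sum>\<xi>\<in>X. w \<xi> * (?N ^ CARD('n) / ?N) + (if \<xi> \<in> ?A then w \<xi> else 0) * ?N ^ CARD('n))"
  proof (intro sum_mono)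
    fix \<xi> assume \<xi>: "\<xi> \<in> X"
    show "w \<xi> * card {g\<in>?G. int m dvd zdot \<xi> g} \<le> w \<xi> * (?N ^ CARD('n) / ?N) + (if \<xi> \<in> ?A then w \<xi> else 0) * ?N ^ CARD('n)"
    proof (cases "\<xi> \<in> ?A")
      case True
      have "card {g\<in>?G. int m dvd zdot \<xi> g} \<le> card ?G" by (intro card_mono finite_gen_box) auto
      then have "real (card {g\<in>?G. int m dvd zdot \<xi> g}) \<le> ?N ^ CARD('n)" using cardG by simp
      then have "w \<xi> * card {g\<in>?G. int m dvd zdot \<xi> g} \<le> w \<xi> * ?N ^ CARD('n)"
        using w by (intro mult_left_mono) auto
      moreover have "0 \<le> w \<xi> * (?N ^ CARD('n) / ?N)" using w by simp
      ultimately show ?thesis using True by simp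
    next
      case False
      then obtain i where "\<not> int m dvd \<xi> $ i" using \<xi> by auto
      from card_annihilated[OF m this]
      have "real (card {g\<in>?G. int m dvd zdot \<xi> g} * (m - 1)) \<le> real ((m - 1) ^ CARD('n))" by (simp only: of_nat_le_iff)
      then have "real (card {g\<in>?G. int m dvd zdot \<xi> g}) \<le> ?N ^ CARD('n) / ?N"
        using N by (simp add: pos_le_divide_eq)
      then have "w \<xi> * card {g\<in>?G. int m dvd zdot \<xi> g} \<le> w \<xi> * (?N ^ CARD('n) / ?N)"
        using w by (rule mult_left_mono)
      then show ?thesis by (simp only: if_not_P[OF False] mult_zero_left add_0_right)
    qed
  qed
  also have "\<dots> = (\<Sum>\<xi>\<in>X. w \<xi>) * (?N ^ CARD('n) / ?N) + (\<Sum>\<xi>\<in>?A. w \<xi>) * ?N ^ CARD('n)"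
    unfolding sum.distrib sum_distrib_right[symmetric] using X by (simp add: sum.inter_filter)
  also have "\<dots> = real (card ?G) * R"
    unfolding cardG R_def by (simp add: algebra_simps)
  finally show False by simp
qed

lemma ghat_sum:
  assumes "finite T" "\<And>k. k \<in> T \<Longrightarrow> finite {z. f k z \<noteq> 0}"
  shows "ghat M (\<lambda>z. \<Sum>k\<in>T. f k z) \<xi> = (\<Sum>k\<in>T. ghat M (f k) \<xi>)"
proof -
  let ?A = "\<Union>k\<in>T. {z. f k z \<noteq> 0}"
  have fin: "finite ?A" using assms by auto
  have "ghat M (\<lambda>z. \<Sum>k\<in>T. f k z) \<xi> = (\<Sum>z\<in>?A. of_real (\<Sum>k\<in>T. f k z) * zchar M (- zdot \<xi> z))"
    by (rule ghat_superset[OF fin]) (auto dest: sum.not_neutral_contains_not_neutral)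
  also have "\<dots> = (\<Sum>k\<in>T. \<Sum>z\<in>?A. of_real (f k z) * zchar M (- zdot \<xi> z))"
    by (simp add: sum_distrib_right) (rule sum.swap)
  also have "\<dots> = (\<Sum>k\<in>T. ghat M (f k) \<xi>)"
    by (intro sum.cong refl ghat_superset[symmetric] fin) auto
  finally show ?thesis .
qed

section \<open>Smoothed indicators and the weight that dominates their coefficients\<close>

context step_frame begin

text \<open>Equal to 1 at depth at least 2^-n below every facet and to 0 at depth at most 2^-(n + 1)
  below some facet; the exponent \<open>Suc n\<close> is the upper end of the telescoping sum of
  \<open>psi\<close>.\<close>

definition smooth_ind :: "nat \<Rightarrow> (real ^ 'n \<Rightarrow> real) \<Rightarrow> real ^ 'n \<Rightarrow> real" where
  "smooth_ind n b x = (\<Prod>a\<in>A. th (2 ^ Suc n * (b a - a \<bullet> x)))"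

text \<open>Makes the lower end \<open>th (b a - a \<bullet> x)\<close> of the telescoping sum
  vanish on the polyhedron, so the dyadic exponents may start at 0.\<close>

definition admissible :: "(real ^ 'n \<Rightarrow> real) \<Rightarrow> bool" where
  "admissible b \<longleftrightarrow> (\<forall>x. (\<forall>a\<in>A. a \<bullet> x \<le> b a) \<longrightarrow> (\<forall>a\<in>A. b a - a \<bullet> x \<le> 1))"

lemma smooth_ind_eq_0: "a \<in> A \<Longrightarrow> b a < a \<bullet> x \<Longrightarrow> smooth_ind n b x = 0"
proof -
  assume a: "a \<in> A" "b a < a \<bullet> x"
  then have "2 ^ Suc n * (b a - a \<bullet> x) \<le> 0" by (intro mult_nonneg_nonpos) auto
  then have "th (2 ^ Suc n * (b a - a \<bullet> x)) = 0" by (intro th_0) linarith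
  then show ?thesis using a finite_A by (auto simp: smooth_ind_def)
qed

text \<open>Expanding the product over \<open>A\<close> of the telescoping sums yields one tile per
  exponent vector. Outside the polyhedron a factor vanishes on either side.\<close>

lemma smooth_ind_eq_sum_tiles:
  assumes b: "admissible b"
  shows "smooth_ind n b x = (\<Sum>k\<in>A \<rightarrow>\<^sub>E {0..n}. tile k b x)"
proof -
  have tel: "(\<Sum>j\<in>{0..n}. psi (2 ^ j * t)) = th (2 ^ Suc n * t) - th t" for t n
    by (induction n) (auto simp: psi_def mult.assoc)
  have "(\<Sum>k\<in>A \<rightarrow>\<^sub>E {0..n}. tile k b x) = (\<Prod>a\<in>A. \<Sum>j\<in>{0..n}. psi (2 ^ j * (b a - a \<bullet> x)))"
    unfolding tile_def by (subst prod_sum_PiE) (auto simp: finite_A)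
  also have "\<dots> = (\<Prod>a\<in>A. th (2 ^ Suc n * (b a - a \<bullet> x)) - th (b a - a \<bullet> x))"
    by (simp only: tel)
  finally have eq: "(\<Sum>k\<in>A \<rightarrow>\<^sub>E {0..n}. tile k b x) = \<dots>" .
  show ?thesis
  proof (cases "\<forall>a\<in>A. a \<bullet> x \<le> b a")
    case True
    then have "th (b a - a \<bullet> x) = 0" if "a \<in> A" for a
      using b that by (intro th_0) (auto simp: admissible_def)
    then show ?thesis unfolding eq smooth_ind_def by simp
  next
    case False
    then obtain a where a: "a \<in> A" "b a < a \<bullet> x" by (auto simp: not_le)
    then have "2 ^ Suc n * (b a - a \<bullet> x) \<le> 0" by (intro mult_nonneg_nonpos) auto
    then have "th (2 ^ Suc n * (b a - a \<bullet> x)) - th (b a - a \<bullet> x) = 0"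
      using th_0[of "2 ^ Suc n * (b a - a \<bullet> x)"] th_0[of "b a - a \<bullet> x"] a by linarith
    then have "(\<Prod>a\<in>A. th (2 ^ Suc n * (b a - a \<bullet> x)) - th (b a - a \<bullet> x)) = 0"
      using a finite_A by (auto simp: prod_zero_iff)
    then show ?thesis unfolding eq using smooth_ind_eq_0[of a b x n] a by simp
  qed
qed

lemma finite_grid_slabs:
  assumes "1 \<le> M"
  shows "finite {z. \<forall>a\<in>A. l a \<le> a \<bullet> pt M z \<and> a \<bullet> pt M z \<le> u a}"
proof (rule finite_subset)
  have "span (id ` A) = UNIV" using span_A by simp
  then show "finite {z. \<forall>a\<in>A. \<lfloor>id a \<bullet> rvec z\<rfloor> \<in> {\<lfloor>M * l a\<rfloor>..\<lfloor>M * u a\<rfloor>}}"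
    by (intro finite_floor_in finite_A) auto
  show "{z. \<forall>a\<in>A. l a \<le> a \<bullet> pt M z \<and> a \<bullet> pt M z \<le> u a} \<subseteq>
    {z. \<forall>a\<in>A. \<lfloor>id a \<bullet> rvec z\<rfloor> \<in> {\<lfloor>M * l a\<rfloor>..\<lfloor>M * u a\<rfloor>}}"
  proof (clarsimp, intro conjI floor_mono)
    fix z a assume *: "\<forall>a\<in>A. l a \<le> a \<bullet> pt M z \<and> a \<bullet> pt M z \<le> u a" "a \<in> A"
    have "a \<bullet> rvec z = M * (a \<bullet> pt M z)" using assms by (simp add: pt_def)
    then show "M * l a \<le> a \<bullet> rvec z" "a \<bullet> rvec z \<le> M * u a"
      using * by (auto intro: mult_left_mono)
  qed
qed

lemma finite_smooth_ind_support:
  assumes "admissible b" "1 \<le> M"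
  shows "finite {z. smooth_ind n b (pt M z) \<noteq> 0}"
proof (rule finite_subset[OF _ finite_grid_slabs[OF assms(2), of "\<lambda>a. b a - 1" b]], clarify)
  fix z a assume z: "smooth_ind n b (pt M z) \<noteq> 0" and a: "a \<in> A"
  have "\<forall>a\<in>A. a \<bullet> pt M z \<le> b a" using z smooth_ind_eq_0 by (metis not_le)
  then show "b a - 1 \<le> a \<bullet> pt M z \<and> a \<bullet> pt M z \<le> b a"
    using assms(1) a unfolding admissible_def by fastforce
qed

lemma finite_tile_support:
  assumes "1 \<le> M"
  shows "finite {z. tile k b (pt M z) \<noteq> 0}"
proof (rule finite_subset[OF _ finite_grid_slabs[OF assms, of "\<lambda>a. b a - 2" b]], clarify)
  fix z a assume z: "tile k b (pt M z) \<noteq> 0" and a: "a \<in> A"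
  have "2 / 2 ^ k a \<le> (2 :: real)" by (simp add: field_simps)
  moreover have "0 < 1 / (2 * 2 ^ k a :: real)" by simp
  ultimately show "b a - 2 \<le> a \<bullet> pt M z \<and> a \<bullet> pt M z \<le> b a"
    using tile_support[OF z a] by linarith
qed

text \<open>The bound of \<open>tile_ghat_bound\<close> without its constant and M^d; it sees the
  tile only through a basis and the exponents on it.\<close>

definition weight_term :: "nat \<Rightarrow> int ^ 'n \<Rightarrow> (real ^ 'n) set \<Rightarrow> (real ^ 'n \<Rightarrow> nat) \<Rightarrow> real" where
  "weight_term m \<xi> I \<kappa> = (\<Prod>i\<in>I. 1 / 2 ^ \<kappa> i) *
    ((\<Prod>i\<in>I. phi (dual I i \<bullet> rvec \<xi> / 2 ^ \<kappa> i)) + (1 / real m) ^ (6 * CARD('n)))"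

text \<open>The common majorant: \<open>b\<close> does not occur in it.\<close>

definition weight :: "nat \<Rightarrow> nat \<Rightarrow> int ^ 'n \<Rightarrow> real" where
  "weight m n \<xi> = (\<Sum>I\<in>bases. \<Sum>\<kappa>\<in>I \<rightarrow>\<^sub>E {0..n}. weight_term m \<xi> I \<kappa>)"

lemma weight_term_nonneg: "0 \<le> weight_term m \<xi> I \<kappa>"
  unfolding weight_term_def
  by (intro mult_nonneg_nonneg add_nonneg_nonneg prod_nonneg ballI) (auto intro: less_imp_le phi_pos)

lemma weight_nonneg: "0 \<le> weight m n \<xi>"
  unfolding weight_def by (intro sum_nonneg weight_term_nonneg)

lemma smooth_ind_ghat_bound:
  fixes Q :: real
  assumes Q: "1 \<le> Q"
  shows "\<exists>K\<ge>0. \<forall>m n b \<xi>. 1 \<le> m \<longrightarrow> 2 ^ n \<le> Q * real m \<longrightarrow> admissible b \<longrightarrow> \<xi> \<in> freq_box (m ^ 5) \<longrightarrow>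
    norm (ghat (m ^ 5) (\<lambda>z. smooth_ind n b (pt (m ^ 5) z)) \<xi>) \<le> K * real (m ^ 5) ^ CARD('n) * weight m n \<xi>"
proof -
  from tile_ghat_bound[OF Q] obtain K where K: "0 \<le> K" and
    K': "\<forall>m n k b I \<xi>. 1 \<le> m \<longrightarrow> 2 ^ n \<le> Q * real m \<longrightarrow> (\<forall>a\<in>A. k a \<le> n) \<longrightarrow> optimal k I \<longrightarrow>
    \<xi> \<in> freq_box (m ^ 5) \<longrightarrow>
    norm (ghat (m ^ 5) (\<lambda>z. tile k b (pt (m ^ 5) z)) \<xi>) \<le>
      K * (real (m ^ 5) ^ CARD('n) * (\<Prod>i\<in>I. 1 / 2 ^ k i)) *
        ((\<Prod>i\<in>I. phi (dual I i \<bullet> rvec \<xi> / 2 ^ k i)) + (1 / real m) ^ (6 * CARD('n)))" by blast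
  from sum_over_tiles_le obtain C where C: "0 \<le> C" and
    C': "\<forall>b n G. (\<forall>I\<in>bases. \<forall>\<kappa>. 0 \<le> G I \<kappa>) \<longrightarrow>
    (\<Sum>k | k \<in> A \<rightarrow>\<^sub>E {0..n} \<and> (\<exists>x. tile k b x \<noteq> 0). G (opt_basis k) (restrict k (opt_basis k))) \<le>
      C * (\<Sum>I\<in>bases. \<Sum>\<kappa>\<in>I \<rightarrow>\<^sub>E {0..n}. G I \<kappa> :: real)" by blast
  show ?thesis
  proof (intro exI[of _ "K * C"] conjI allI impI)
    show "0 \<le> K * C" using K C by simp
    fix m n b and \<xi> :: "int ^ 'n"
    assume m: "1 \<le> m" and n: "2 ^ n \<le> Q * real m" and b: "admissible b" and \<xi>: "\<xi> \<in> freq_box (m ^ 5)"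
    define M where "M = m ^ 5"
    have M: "1 \<le> M" using m by (simp add: M_def)
    define T where "T = {k. k \<in> A \<rightarrow>\<^sub>E {0..n} \<and> (\<exists>x. tile k b x \<noteq> 0)}"
    have finP: "finite (A \<rightarrow>\<^sub>E {0..n})" by (intro finite_PiE finite_A) auto
    then have finT: "finite T" by (rule rev_finite_subset) (auto simp: T_def)
    have "smooth_ind n b x = (\<Sum>k\<in>T. tile k b x)" for x
      unfolding smooth_ind_eq_sum_tiles[OF b]
      by (rule sum.mono_neutral_right[OF finP]) (auto simp: T_def)
    then have "ghat M (\<lambda>z. smooth_ind n b (pt M z)) \<xi> = (\<Sum>k\<in>T. ghat M (\<lambda>z. tile k b (pt M z)) \<xi>)"
      by (simp add: ghat_sum[OF finT finite_tile_support[OF M]])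
    also have "norm \<dots> \<le> (\<Sum>k\<in>T. norm (ghat M (\<lambda>z. tile k b (pt M z)) \<xi>))" by (rule norm_sum)
    also have "\<dots> \<le> (\<Sum>k\<in>T. K * real M ^ CARD('n) * weight_term m \<xi> (opt_basis k) (restrict k (opt_basis k)))"
    proof (intro sum_mono)
      fix k assume "k \<in> T"
      then have kn: "\<forall>a\<in>A. k a \<le> n" by (auto simp: T_def PiE_iff)
      show "norm (ghat M (\<lambda>z. tile k b (pt M z)) \<xi>) \<le>
        K * real M ^ CARD('n) * weight_term m \<xi> (opt_basis k) (restrict k (opt_basis k))"
        using K'[rule_format, OF m n _ optimal_opt_basis \<xi>, of k b] kn
        by (simp add: weight_term_def M_def mult.assoc)
    qed
    also have "\<dots> = K * real M ^ CARD('n) * (\<Sum>k\<in>T. weight_term m \<xi> (opt_basis k) (restrict k (opt_basis k)))"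
      by (simp only: sum_distrib_left)
    also have "\<dots> \<le> K * real M ^ CARD('n) * (C * weight m n \<xi>)"
      unfolding T_def weight_def
      by (intro mult_left_mono C'[rule_format] weight_term_nonneg) (use K in auto)
    finally show "norm (ghat (m ^ 5) (\<lambda>z. smooth_ind n b (pt (m ^ 5) z)) \<xi>) \<le>
        K * C * real (m ^ 5) ^ CARD('n) * weight m n \<xi>"
      by (simp only: M_def mult_ac)
  qed
qed

end


section \<open>Total mass of the weight, over all frequencies and over multiples of m\<close>

context step_frame begin

lemma sum_bases_phi_le:
  "\<exists>C\<ge>0. \<forall>I\<in>bases. \<forall>Z \<kappa>. finite Z \<longrightarrow>
    (\<Sum>z\<in>Z. \<Prod>i\<in>I. phi (dual I i \<bullet> rvec z / 2 ^ \<kappa> i)) \<le> C * (\<Prod>i\<in>I. 2 ^ \<kappa> i)"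
  (is "\<exists>C\<ge>0. \<forall>I\<in>bases. ?P I C")
proof (rule bases_uniform)
  fix I assume "I \<in> bases"
  then show "\<exists>C\<ge>0. ?P I C" using sum_prod_phi_le[of I "dual I"] basesD(2) span_dual by blast
next
  fix I and C D :: real assume *: "I \<in> bases" "?P I C" "C \<le> D"
  show "?P I D"
  proof (intro allI impI)
    fix Z :: "(int ^ 'n) set" and \<kappa> :: "real ^ 'n \<Rightarrow> nat"
    assume "finite Z"
    with *(2) have "(\<Sum>z\<in>Z. \<Prod>i\<in>I. phi (dual I i \<bullet> rvec z / 2 ^ \<kappa> i)) \<le> C * (\<Prod>i\<in>I. 2 ^ \<kappa> i)" by blast
    also have "\<dots> \<le> D * (\<Prod>i\<in>I. 2 ^ \<kappa> i)" using *(3) by (intro mult_right_mono prod_nonneg) auto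
    finally show "(\<Sum>z\<in>Z. \<Prod>i\<in>I. phi (dual I i \<bullet> rvec z / 2 ^ \<kappa> i)) \<le> D * (\<Prod>i\<in>I. 2 ^ \<kappa> i)" .
  qed
qed

text \<open>There are at most M^d = m^(5 d) frequencies, each with a term m^(-6 d), which leaves
  m^(-d) \<le> 1/m. The exponent 5 of the grid comes from this balance.\<close>

lemma sum_high_part_le:
  fixes X :: "(int ^ 'n) set" and \<kappa> :: "real ^ 'n \<Rightarrow> nat"
  assumes m: "1 \<le> m" and X: "X \<subseteq> freq_box (m ^ 5)" and I: "I \<in> bases"
  shows "(\<Sum>\<xi>\<in>X. (\<Prod>i\<in>I. 1 / 2 ^ \<kappa> i) * (1 / real m) ^ (6 * CARD('n))) \<le> 1 / real m"
proof -
  let ?d = "CARD('n)"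
  have "(\<Prod>i\<in>I. 1 / 2 ^ \<kappa> i) \<le> (1 :: real)" by (intro prod_le_1) auto
  moreover have "0 \<le> (\<Prod>i\<in>I. 1 / 2 ^ \<kappa> i :: real)" by (intro prod_nonneg) auto
  moreover have "card X \<le> card (freq_box (m ^ 5) :: (int ^ 'n) set)" using X finite_freq_box by (rule card_mono[rotated])
  then have "real (card X) \<le> real m ^ (5 * ?d)" by (simp add: card_freq_box power_mult flip: of_nat_power)
  ultimately have "real (card X) * ((\<Prod>i\<in>I. 1 / 2 ^ \<kappa> i) * (1 / real m) ^ (6 * ?d)) \<le>
      real m ^ (5 * ?d) * (1 * (1 / real m) ^ (6 * ?d))"
    by (intro mult_mono) auto
  also have "\<dots> = (1 / real m) ^ ?d"
  proof -
    have "6 * ?d = 5 * ?d + ?d" by simp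
    then show ?thesis using m by (simp only: power_add) (simp add: power_divide)
  qed
  also have "\<dots> \<le> (1 / real m) ^ 1"
    using m by (intro power_decreasing) auto
  finally show ?thesis by simp
qed

text \<open>The source of the power of the logarithm: each basis carries (n + 1)^d exponent
  vectors.\<close>

lemma sum_weight_le_of_terms:
  assumes "finite X" and "\<And>I \<kappa>. I \<in> bases \<Longrightarrow> \<kappa> \<in> I \<rightarrow>\<^sub>E {0..n} \<Longrightarrow> (\<Sum>\<xi>\<in>X. weight_term m \<xi> I \<kappa>) \<le> R"
  shows "(\<Sum>\<xi>\<in>X. weight m n \<xi>) \<le> card bases * real (n + 1) ^ CARD('n) * R"
proof -
  have "(\<Sum>\<xi>\<in>X. weight m n \<xi>) = (\<Sum>I\<in>bases. \<Sum>\<kappa>\<in>I \<rightarrow>\<^sub>E {0..n}. \<Sum>\<xi>\<in>X. weight_term m \<xi> I \<kappa>)"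
    unfolding weight_def by (subst sum.swap) (intro sum.cong refl sum.swap)
  also have "\<dots> \<le> (\<Sum>I\<in>bases. \<Sum>\<kappa>\<in>I \<rightarrow>\<^sub>E {0..n}. R)" by (intro sum_mono assms)
  also have "\<dots> = (\<Sum>I\<in>bases. real (n + 1) ^ CARD('n) * R)"
  proof (intro sum.cong refl)
    fix I assume I: "I \<in> bases"
    have "card (I \<rightarrow>\<^sub>E {0..n}) = (n + 1) ^ CARD('n)"
      using basesD(2)[OF I] card_basis[OF I] by (simp add: card_PiE)
    then show "(\<Sum>\<kappa>\<in>I \<rightarrow>\<^sub>E {0..n}. R) = real (n + 1) ^ CARD('n) * R" by simp
  qed
  also have "\<dots> = card bases * real (n + 1) ^ CARD('n) * R" by simp
  finally show ?thesis .
qed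

text \<open>The volume factor of a tile cancels the size of the dual box where its coefficients are
  large, so each pair of basis and exponents has bounded mass.\<close>

lemma sum_weight_le:
  "\<exists>K\<ge>0. \<forall>m n X. 1 \<le> m \<longrightarrow> X \<subseteq> freq_box (m ^ 5) \<longrightarrow> (\<Sum>\<xi>\<in>X. weight m n \<xi>) \<le> K * real (n + 1) ^ CARD('n)"
proof -
  from sum_bases_phi_le obtain C where C: "0 \<le> C" and C': "\<forall>I\<in>bases. \<forall>Z \<kappa>. finite Z \<longrightarrow>
    (\<Sum>z\<in>Z. \<Prod>i\<in>I. phi (dual I i \<bullet> rvec z / 2 ^ \<kappa> i)) \<le> C * (\<Prod>i\<in>I. 2 ^ \<kappa> i)" by blast
  have "(\<Sum>\<xi>\<in>X. weight m n \<xi>) \<le> card bases * (C + 1) * real (n + 1) ^ CARD('n)"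
    if m: "1 \<le> m" and X: "X \<subseteq> freq_box (m ^ 5)" for m n X
  proof -
    have fin: "finite X" using X finite_freq_box by (rule finite_subset)
    have "(\<Sum>\<xi>\<in>X. weight_term m \<xi> I \<kappa>) \<le> C + 1" if I: "I \<in> bases" for I \<kappa>
    proof -
      let ?V = "\<Prod>i\<in>I. 1 / 2 ^ \<kappa> i :: real"
      have V: "0 \<le> ?V" by (intro prod_nonneg) auto
      have "(\<Sum>\<xi>\<in>X. weight_term m \<xi> I \<kappa>) = ?V * (\<Sum>\<xi>\<in>X. \<Prod>i\<in>I. phi (dual I i \<bullet> rvec \<xi> / 2 ^ \<kappa> i)) +
          (\<Sum>\<xi>\<in>X. ?V * (1 / real m) ^ (6 * CARD('n)))"
        unfolding weight_term_def distrib_left sum.distrib sum_distrib_left ..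
      also have "\<dots> \<le> ?V * (C * (\<Prod>i\<in>I. 2 ^ \<kappa> i)) + 1 / real m"
        by (intro add_mono mult_left_mono C'[rule_format] sum_high_part_le m X I fin V)
      also have "?V * (C * (\<Prod>i\<in>I. 2 ^ \<kappa> i)) = C"
        using basesD(2)[OF I] by (simp add: prod_dividef)
      also have "1 / real m \<le> 1" using m by simp
      finally show ?thesis by simp
    qed
    then show ?thesis using sum_weight_le_of_terms[OF fin, of n m "C + 1"] by (simp add: mult_ac)
  qed
  then show ?thesis using C by (intro exI[of _ "card bases * (C + 1)"]) auto
qed

text \<open>The normalisation |a_j| \<le> 1/d enters: if all dual coordinates were below 1 in
  absolute value, then so would be every integer coordinate of \<open>z\<close>.\<close>

lemma dual_coordinate_ge_1:
  assumes I: "I \<in> bases" and z: "z \<noteq> 0"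
  shows "\<exists>i\<in>I. 1 \<le> \<bar>dual I i \<bullet> rvec z\<bar>"
proof (rule ccontr)
  assume "\<not> ?thesis"
  then have lt: "\<bar>dual I i \<bullet> rvec z\<bar> < 1" if "i \<in> I" for i using that by (auto simp: not_le)
  obtain j where "z $ j \<noteq> 0" using z by (auto simp: vec_eq_iff)
  then have "1 \<le> \<bar>z $ j\<bar>" by linarith
  then have "1 \<le> \<bar>real_of_int (z $ j)\<bar>" by (metis of_int_1_le_iff of_int_abs)
  also have "real_of_int (z $ j) = (\<Sum>i\<in>I. (rvec z \<bullet> dual I i) *\<^sub>R i) $ j"
    unfolding dual_expand[OF I] by simp
  also have "\<bar>\<dots>\<bar> \<le> (\<Sum>i\<in>I. \<bar>dual I i \<bullet> rvec z\<bar> * \<bar>i $ j\<bar>)"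
    by (simp add: abs_mult inner_commute sum_abs[THEN order_trans])
  also have "\<dots> \<le> (\<Sum>i\<in>I. \<bar>dual I i \<bullet> rvec z\<bar> * (1 / real CARD('n)))"
    using entry_A basesD(1)[OF I] by (intro sum_mono mult_left_mono) auto
  also have "\<dots> < (\<Sum>i\<in>I. 1 * (1 / real CARD('n)))"
  proof (rule sum_strict_mono)
    show "I \<noteq> {}" using card_basis[OF I] by auto
  qed (use basesD(2)[OF I] lt in \<open>auto intro: divide_strict_right_mono\<close>)
  also have "\<dots> = 1" using card_basis[OF I] by simp
  finally show False by simp
qed

text \<open>On nonzero multiples of \<open>m\<close> the direction in which the frequency is large gains two powers of
  \<open>m\<close>, and loses at most one through \<open>2 ^ \<kappa> i \<le> Q m\<close>.\<close>

lemma weight_term_multiple: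
  fixes Q :: real
  assumes I: "I \<in> bases" and Q: "1 \<le> Q" and m: "1 \<le> m" and \<kappa>: "\<And>i. i \<in> I \<Longrightarrow> 2 ^ \<kappa> i \<le> Q * real m"
    and z: "z \<noteq> 0"
  shows "(\<Prod>i\<in>I. 1 / 2 ^ \<kappa> i) * (\<Prod>i\<in>I. phi (real m * (dual I i \<bullet> rvec z) / 2 ^ \<kappa> i)) \<le>
    2 * Q * (Q\<^sup>2) ^ CARD('n) / real m * (\<Prod>i\<in>I. phi (dual I i \<bullet> rvec z))"
proof -
  define y where "y i = dual I i \<bullet> rvec z" for i
  obtain j where j: "j \<in> I" "1 \<le> \<bar>y j\<bar>" using dual_coordinate_ge_1[OF I z] by (auto simp: y_def)
  let ?f = "\<lambda>i. (1 / 2 ^ \<kappa> i) * phi (real m * y i / 2 ^ \<kappa> i)"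
  have f0: "0 \<le> ?f i" for i by (intro mult_nonneg_nonneg less_imp_le phi_pos) auto
  \<comment> \<open>Any direction: 2^\<kappa> \<le> Q m makes the argument at least |y| / Q in
    absolute value, and the factor 1 / 2^\<kappa> is bounded by 1.\<close>
  have gen: "?f i \<le> Q\<^sup>2 * phi (y i)" if i: "i \<in> I" for i
  proof -
    have "(1 / Q) * \<bar>y i\<bar> \<le> \<bar>real m * y i / 2 ^ \<kappa> i\<bar>"
    proof -
      have "1 / Q \<le> real m / 2 ^ \<kappa> i" using \<kappa>[OF i] Q by (simp add: field_simps)
      then have "(1 / Q) * \<bar>y i\<bar> \<le> (real m / 2 ^ \<kappa> i) * \<bar>y i\<bar>" by (rule mult_right_mono) simp
      then show ?thesis by (simp add: abs_mult)
    qed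
    then have "phi (real m * y i / 2 ^ \<kappa> i) \<le> phi (y i) / (1 / Q)\<^sup>2"
      using Q by (intro phi_scale) auto
    also have "\<dots> = Q\<^sup>2 * phi (y i)" by (simp add: power_divide)
    finally have "(1 / 2 ^ \<kappa> i) * phi (real m * y i / 2 ^ \<kappa> i) \<le> 1 * (Q\<^sup>2 * phi (y i))"
      by (intro mult_mono less_imp_le[OF phi_pos]) auto
    then show ?thesis by simp
  qed
  \<comment> \<open>The direction with |y j| \<ge> 1: phi t \<le> 1 / t^2 gives K^2 / m^2, and the
    factor 1 / K leaves K / m^2 \<le> Q / m.\<close>
  have spec: "?f j \<le> 2 * Q / real m * phi (y j)"
  proof -
    have y2: "1 \<le> (y j)\<^sup>2" using j(2) by (metis one_le_power power2_abs)
    define K where "K = (2 ^ \<kappa> j :: real)"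
    have K: "0 < K" "K \<le> Q * real m" using \<kappa>[OF j(1)] by (auto simp: K_def)
    have "phi (real m * y j / K) \<le> 1 / (real m * y j / K)\<^sup>2"
    proof -
      have "0 < (real m * y j / K)\<^sup>2" using m K y2 by (auto simp: zero_less_power2)
      moreover have "1 / (1 + X) \<le> 1 / X" if "0 < X" for X :: real
        using that by (intro divide_left_mono mult_pos_pos) auto
      ultimately show ?thesis unfolding phi_def by blast
    qed
    also have "\<dots> = K\<^sup>2 / (real m)\<^sup>2 * (1 / (y j)\<^sup>2)" by (simp add: power_divide power_mult_distrib)
    also have "\<dots> \<le> K\<^sup>2 / (real m)\<^sup>2 * (2 * phi (y j))"
    proof (rule mult_left_mono)
      have "1 / Y \<le> 2 * (1 / (1 + Y))" if "1 \<le> Y" for Y :: real using that by (simp add: divide_simps)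
      then show "1 / (y j)\<^sup>2 \<le> 2 * phi (y j)" unfolding phi_def using y2 by blast
    qed simp
    finally have "phi (real m * y j / K) \<le> K\<^sup>2 / (real m)\<^sup>2 * (2 * phi (y j))" .
    then have "(1 / K) * phi (real m * y j / K) \<le> (1 / K) * (K\<^sup>2 / (real m)\<^sup>2 * (2 * phi (y j)))"
      using K by (intro mult_left_mono) auto
    also have "\<dots> = K / (real m)\<^sup>2 * (2 * phi (y j))" using K by (simp add: power2_eq_square)
    also have "\<dots> \<le> (Q * real m) / (real m)\<^sup>2 * (2 * phi (y j))"
      using K phi_pos[of "y j"] by (intro mult_right_mono divide_right_mono) auto
    also have "\<dots> = 2 * Q / real m * phi (y j)" using m by (simp add: power2_eq_square)
    finally show ?thesis by (simp add: K_def)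
  qed
  have "(\<Prod>i\<in>I. 1 / 2 ^ \<kappa> i) * (\<Prod>i\<in>I. phi (real m * y i / 2 ^ \<kappa> i)) = (\<Prod>i\<in>I. ?f i)"
    by (simp only: prod.distrib)
  also have "\<dots> = ?f j * (\<Prod>i\<in>I - {j}. ?f i)" by (rule prod.remove[OF basesD(2)[OF I] j(1)])
  also have "\<dots> \<le> (2 * Q / real m * phi (y j)) * (\<Prod>i\<in>I - {j}. Q\<^sup>2 * phi (y i))"
  proof (rule mult_mono[OF spec])
    show "(\<Prod>i\<in>I - {j}. ?f i) \<le> (\<Prod>i\<in>I - {j}. Q\<^sup>2 * phi (y i))"
      using f0 gen by (intro prod_mono) blast
    show "0 \<le> 2 * Q / real m * phi (y j)" using Q less_imp_le[OF phi_pos] by simp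
    show "0 \<le> (\<Prod>i\<in>I - {j}. ?f i)" using f0 by (intro prod_nonneg) blast
  qed
  also have "\<dots> = (2 * Q / real m * (Q\<^sup>2) ^ (card I - 1)) * (phi (y j) * (\<Prod>i\<in>I - {j}. phi (y i)))"
    using j(1) by (simp add: prod.distrib mult_ac)
  also have "phi (y j) * (\<Prod>i\<in>I - {j}. phi (y i)) = (\<Prod>i\<in>I. phi (y i))"
    by (rule prod.remove[OF basesD(2)[OF I] j(1), symmetric])
  also have "(2 * Q / real m * (Q\<^sup>2) ^ (card I - 1)) * (\<Prod>i\<in>I. phi (y i)) \<le>
      (2 * Q / real m * (Q\<^sup>2) ^ CARD('n)) * (\<Prod>i\<in>I. phi (y i))"
    using Q card_basis[OF I]
    by (intro mult_right_mono mult_left_mono power_increasing prod_nonneg) (auto intro: less_imp_le phi_pos)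
  finally show ?thesis by (simp add: y_def)
qed

text \<open>Division by \<open>m\<close> maps these frequencies injectively to nonzero integer
  vectors. The factor 1/m comes from \<open>weight_term_multiple\<close>, and the remaining sum is
  taken at scale 1, with all exponents 0.\<close>

lemma sum_weight_multiples_le:
  fixes Q :: real
  assumes Q: "1 \<le> Q"
  shows "\<exists>K\<ge>0. \<forall>m n. 1 \<le> m \<longrightarrow> 2 ^ n \<le> Q * real m \<longrightarrow>
    (\<Sum>\<xi> | \<xi> \<in> freq_box (m ^ 5) - {0} \<and> (\<forall>i. int m dvd \<xi> $ i). weight m n \<xi>) \<le> K * real (n + 1) ^ CARD('n) / real m"
proof -
  from sum_bases_phi_le obtain C where C: "0 \<le> C" and C': "\<forall>I\<in>bases. \<forall>Z \<kappa>. finite Z \<longrightarrow>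
    (\<Sum>z\<in>Z. \<Prod>i\<in>I. phi (dual I i \<bullet> rvec z / 2 ^ \<kappa> i)) \<le> C * (\<Prod>i\<in>I. 2 ^ \<kappa> i)" by blast
  define D where "D = 2 * Q * (Q\<^sup>2) ^ CARD('n)"
  have D: "0 \<le> D" using Q by (simp add: D_def)
  have "(\<Sum>\<xi>\<in>X. weight m n \<xi>) \<le> (card bases * (D * C + 1)) * real (n + 1) ^ CARD('n) / real m"
    if m: "1 \<le> m" and n: "2 ^ n \<le> Q * real m" and X: "X = {\<xi>. \<xi> \<in> freq_box (m ^ 5) - {0} \<and> (\<forall>i. int m dvd \<xi> $ i)}" for m n X
  proof -
    have sub: "X \<subseteq> freq_box (m ^ 5)" by (auto simp: X)
    have fin: "finite X" using sub finite_freq_box by (rule finite_subset)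
    have "(\<Sum>\<xi>\<in>X. weight_term m \<xi> I \<kappa>) \<le> (D * C + 1) / real m" if I: "I \<in> bases" and \<kappa>: "\<kappa> \<in> I \<rightarrow>\<^sub>E {0..n}" for I \<kappa>
    proof -
      let ?V = "\<Prod>i\<in>I. 1 / 2 ^ \<kappa> i :: real"
      have \<kappa>m: "2 ^ \<kappa> i \<le> Q * real m" if "i \<in> I" for i
      proof -
        have "\<kappa> i \<le> n" using \<kappa> that by (auto simp: PiE_iff)
        then have "(2 ^ \<kappa> i :: real) \<le> 2 ^ n" by (intro power_increasing) auto
        then show ?thesis using n by linarith
      qed
      define h :: "int ^ 'n \<Rightarrow> int ^ 'n" where "h \<xi> = (\<chi> i. \<xi> $ i div int m)" for \<xi>
      have mh: "\<xi> $ i = int m * h \<xi> $ i" if "\<xi> \<in> X" for \<xi> i using that by (auto simp: X h_def)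
      have inj: "inj_on h X" by (rule inj_onI) (simp add: vec_eq_iff mh)
      have hne: "h \<xi> \<noteq> 0" if "\<xi> \<in> X" for \<xi> using that mh[OF that] by (auto simp: X vec_eq_iff)
      have rv: "rvec \<xi> = real m *\<^sub>R rvec (h \<xi>)" if "\<xi> \<in> X" for \<xi>
        using mh[OF that] by (simp add: vec_eq_iff)
      have "(\<Sum>\<xi>\<in>X. weight_term m \<xi> I \<kappa>) = (\<Sum>\<xi>\<in>X. ?V * (\<Prod>i\<in>I. phi (dual I i \<bullet> rvec \<xi> / 2 ^ \<kappa> i))) +
          (\<Sum>\<xi>\<in>X. ?V * (1 / real m) ^ (6 * CARD('n)))"
        unfolding weight_term_def distrib_left sum.distrib ..
      also have "(\<Sum>\<xi>\<in>X. ?V * (1 / real m) ^ (6 * CARD('n))) \<le> 1 / real m"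
        by (intro sum_high_part_le m sub I)
      also have "(\<Sum>\<xi>\<in>X. ?V * (\<Prod>i\<in>I. phi (dual I i \<bullet> rvec \<xi> / 2 ^ \<kappa> i))) \<le>
        (\<Sum>\<xi>\<in>X. D / real m * (\<Prod>i\<in>I. phi (dual I i \<bullet> rvec (h \<xi>))))"
      proof (intro sum_mono)
        fix \<xi> assume \<xi>: "\<xi> \<in> X"
        show "?V * (\<Prod>i\<in>I. phi (dual I i \<bullet> rvec \<xi> / 2 ^ \<kappa> i)) \<le>
          D / real m * (\<Prod>i\<in>I. phi (dual I i \<bullet> rvec (h \<xi>)))"
          using weight_term_multiple[OF I Q m \<kappa>m hne[OF \<xi>]] by (simp add: rv[OF \<xi>] D_def)
      qed
      also have "\<dots> = D / real m * (\<Sum>z\<in>h ` X. \<Prod>i\<in>I. phi (dual I i \<bullet> rvec z))"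
        by (simp add: sum.reindex[OF inj] sum_distrib_left)
      also have "(\<Sum>z\<in>h ` X. \<Prod>i\<in>I. phi (dual I i \<bullet> rvec z)) \<le> C"
        using C'[rule_format, OF I, of "h ` X" "\<lambda>_. 0"] fin by simp
      finally show ?thesis using D by (simp add: mult_left_mono divide_right_mono add_divide_distrib)
    qed
    from sum_weight_le_of_terms[OF fin this] show ?thesis by (simp add: mult_ac)
  qed
  then show ?thesis using C D by (intro exI[of _ "card bases * (D * C + 1)"]) auto
qed

text \<open>\<open>g\<close> is selected from \<open>weight\<close> alone, before any
  \<open>b\<close> is given; the majorant exists to allow this order of quantifiers.\<close>

lemma lattice_rule_error:
  fixes Q :: real
  assumes Q: "1 \<le> Q"
  shows "\<exists>K\<ge>0. \<forall>m n. prime m \<longrightarrow> 2 ^ n \<le> Q * real m \<longrightarrow>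
    (\<exists>g\<in>gen_box m. \<forall>b. admissible b \<longrightarrow>
      \<bar>(\<Sum>z | smooth_ind n b (pt (m ^ 5) z) \<noteq> 0. smooth_ind n b (pt (m ^ 5) z) * lat_count m (m ^ 4) g z) / real m -
        (\<Sum>z | smooth_ind n b (pt (m ^ 5) z) \<noteq> 0. smooth_ind n b (pt (m ^ 5) z)) / real (m ^ 5) ^ CARD('n)\<bar>
      \<le> K * real (n + 1) ^ CARD('n) / real m)"
proof -
  from smooth_ind_ghat_bound[OF Q] obtain K1 where K1: "0 \<le> K1" and K1': "\<forall>m n b \<xi>. 1 \<le> m \<longrightarrow> 2 ^ n \<le> Q * real m \<longrightarrow>
    admissible b \<longrightarrow> \<xi> \<in> freq_box (m ^ 5) \<longrightarrow>
    norm (ghat (m ^ 5) (\<lambda>z. smooth_ind n b (pt (m ^ 5) z)) \<xi>) \<le> K1 * real (m ^ 5) ^ CARD('n) * weight m n \<xi>" by blast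
  from sum_weight_le obtain K2 where K2: "0 \<le> K2" and K2': "\<forall>m n X. 1 \<le> m \<longrightarrow> X \<subseteq> freq_box (m ^ 5) \<longrightarrow>
    (\<Sum>\<xi>\<in>X. weight m n \<xi>) \<le> K2 * real (n + 1) ^ CARD('n)" by blast
  from sum_weight_multiples_le[OF Q] obtain K3 where K3: "0 \<le> K3" and K3': "\<forall>m n. 1 \<le> m \<longrightarrow> 2 ^ n \<le> Q * real m \<longrightarrow>
    (\<Sum>\<xi> | \<xi> \<in> freq_box (m ^ 5) - {0} \<and> (\<forall>i. int m dvd \<xi> $ i). weight m n \<xi>) \<le> K3 * real (n + 1) ^ CARD('n) / real m" by blast
  show ?thesis
  proof (intro exI[of _ "K1 * (2 * K2 + K3)"] conjI allI impI)
    show "0 \<le> K1 * (2 * K2 + K3)" using K1 K2 K3 by simp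
    fix m n :: nat assume m: "prime m" and n: "2 ^ n \<le> Q * real m"
    have m2: "2 \<le> m" using m by (rule prime_ge_2_nat)
    then have m1: "1 \<le> m" by simp
    let ?X = "freq_box (m ^ 5) - {0} :: (int ^ 'n) set"
    let ?N = "real (n + 1) ^ CARD('n)"
    have "finite ?X" using finite_freq_box by simp
    from good_generator_exists[OF m this, of "weight m n"] weight_nonneg obtain g where g: "g \<in> gen_box m"
      and gX: "(\<Sum>\<xi> | \<xi> \<in> ?X \<and> int m dvd zdot \<xi> g. weight m n \<xi>) \<le>
        (\<Sum>\<xi>\<in>?X. weight m n \<xi>) / (m - 1) + (\<Sum>\<xi> | \<xi> \<in> ?X \<and> (\<forall>i. int m dvd \<xi> $ i). weight m n \<xi>)" by blast
    have "(\<Sum>\<xi>\<in>?X. weight m n \<xi>) / (m - 1) \<le> (K2 * ?N) / (m - 1)"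
      by (intro divide_right_mono K2'[rule_format, OF m1]) auto
    also have "\<dots> \<le> (K2 * ?N) * (2 / m)"
    proof -
      have "1 / real (m - 1) \<le> 2 / real m" using m2 by (simp add: field_simps of_nat_diff)
      then have "(K2 * ?N) * (1 / real (m - 1)) \<le> (K2 * ?N) * (2 / real m)"
        using K2 by (intro mult_left_mono) auto
      then show ?thesis by simp
    qed
    finally have "(\<Sum>\<xi>\<in>?X. weight m n \<xi>) / (m - 1) \<le> (K2 * ?N) * (2 / m)" .
    from order_trans[OF gX add_mono[OF this K3'[rule_format, OF m1 n]]]
    have W: "(\<Sum>\<xi> | \<xi> \<in> ?X \<and> int m dvd zdot \<xi> g. weight m n \<xi>) \<le> (2 * K2 + K3) * ?N / m"
      by (simp add: add_divide_distrib distrib_right mult_ac)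
    have "\<bar>(\<Sum>z | smooth_ind n b (pt (m ^ 5) z) \<noteq> 0. smooth_ind n b (pt (m ^ 5) z) * lat_count m (m ^ 4) g z) / real m -
        (\<Sum>z | smooth_ind n b (pt (m ^ 5) z) \<noteq> 0. smooth_ind n b (pt (m ^ 5) z)) / real (m ^ 5) ^ CARD('n)\<bar>
      \<le> K1 * (2 * K2 + K3) * ?N / real m" if b: "admissible b" for b
    proof -
      define M where "M = m ^ 5"
      have M: "m * m ^ 4 = M" by (simp add: M_def eval_nat_numeral)
      have M1: "1 \<le> M" "0 < real M ^ CARD('n)" using m1 by (simp_all add: M_def)
      let ?F = "\<lambda>z. smooth_ind n b (pt M z)"
      have "\<bar>(\<Sum>z | ?F z \<noteq> 0. ?F z * lat_count m (m ^ 4) g z) / m - (\<Sum>z | ?F z \<noteq> 0. ?F z) / real M ^ CARD('n)\<bar> \<le>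
        (\<Sum>\<xi> | \<xi> \<in> freq_box M - {0} \<and> int m dvd zdot \<xi> g. norm (ghat M ?F \<xi>)) / real M ^ CARD('n)"
        using grid_poisson_bound[OF finite_smooth_ind_support[OF b M1(1), of n], of m "m ^ 4" g] m1
        by (simp add: M of_nat_power[symmetric] del: of_nat_power)
      also have "\<dots> \<le> (\<Sum>\<xi> | \<xi> \<in> ?X \<and> int m dvd zdot \<xi> g. K1 * real M ^ CARD('n) * weight m n \<xi>) / real M ^ CARD('n)"
        unfolding M_def by (intro divide_right_mono sum_mono K1'[rule_format, OF m1 n b]) auto
      also have "\<dots> = K1 * (\<Sum>\<xi> | \<xi> \<in> ?X \<and> int m dvd zdot \<xi> g. weight m n \<xi>)"
        unfolding sum_distrib_left[symmetric] using M1 by simp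
      also have "\<dots> \<le> K1 * ((2 * K2 + K3) * ?N / m)" by (intro mult_left_mono W K1)
      finally show ?thesis by (simp add: M_def)
    qed
    then show "\<exists>g\<in>gen_box m. \<forall>b. admissible b \<longrightarrow>
      \<bar>(\<Sum>z | smooth_ind n b (pt (m ^ 5) z) \<noteq> 0. smooth_ind n b (pt (m ^ 5) z) * lat_count m (m ^ 4) g z) / real m -
        (\<Sum>z | smooth_ind n b (pt (m ^ 5) z) \<noteq> 0. smooth_ind n b (pt (m ^ 5) z)) / real (m ^ 5) ^ CARD('n)\<bar>
      \<le> K1 * (2 * K2 + K3) * ?N / real m" using g by blast
  qed
qed

end

section \<open>Volumes and grid points\<close>


lemma measure_lebesgue_cube:
  fixes p :: "real ^ 'n"
  assumes "0 \<le> r"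
  shows "measure lebesgue (cbox p (p + (\<chi> i. r))) = r ^ CARD('n)"
    and "measure lebesgue (box p (p + (\<chi> i. r))) = r ^ CARD('n)"
proof -
  have "\<forall>b\<in>Basis. p \<bullet> b \<le> (p + (\<chi> i. r)) \<bullet> b"
    using assms by (auto simp: Basis_vec_def inner_axis)
  then have ne: "cbox p (p + (\<chi> i. r)) \<noteq> {}" by (auto simp: cbox_def)
  show 1: "measure lebesgue (cbox p (p + (\<chi> i. r))) = r ^ CARD('n)"
    using content_cbox_cart[OF ne] by (simp add: measure_completion)
  have "measure lborel (box p (p + (\<chi> i. r))) = measure lborel (cbox p (p + (\<chi> i. r)))"
    by (simp only: measure_lborel_box_eq measure_lborel_cbox_eq)
  then show "measure lebesgue (box p (p + (\<chi> i. r))) = r ^ CARD('n)"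
    using 1 by (simp add: measure_completion)
qed

text \<open>About 1/r translates of the piece along the normal fit into a cube of fixed size, so its
  volume is O(r). The half-open slab makes the translates disjoint.\<close>

lemma slab_measure_le:
  fixes a :: "real ^ 'n"
  assumes a: "a \<noteq> 0" and R: "0 \<le> R"
  shows "\<exists>C\<ge>0. \<forall>p \<beta> r. 0 < r \<longrightarrow> r \<le> 1 \<longrightarrow>
    measure lebesgue {x \<in> cbox p (p + (\<chi> i. R)). \<beta> < a \<bullet> x \<and> a \<bullet> x \<le> \<beta> + r} \<le> C * r"
proof -
  have aa: "0 < a \<bullet> a" using a by simp
  \<comment> \<open>Bounds the total displacement: at most 2 / r translates, each by a vector of
    length r / |a|.\<close>
  define W where "W = 2 * norm a / (a \<bullet> a)"
  have W: "0 \<le> W" using aa by (simp add: W_def)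
  have "measure lebesgue S \<le> (R + 2 * W) ^ CARD('n) * r"
    if r: "0 < r" "r \<le> 1" and S: "S = {x \<in> cbox p (p + (\<chi> i. R)). \<beta> < a \<bullet> x \<and> a \<bullet> x \<le> \<beta> + r}"
    for p \<beta> r S
  proof -
    define v where "v = (r / (a \<bullet> a)) *\<^sub>R a"
    have av: "a \<bullet> v = r" using aa by (simp add: v_def)
    define L where "L = nat \<lceil>1 / r\<rceil>"
    have L: "1 / r \<le> real L" "real L \<le> 2 / r"
    proof -
      show "1 / r \<le> real L" using r by (simp add: L_def)
      have "1 \<le> 1 / r" using r by simp
      then have "real L \<le> 1 / r + 1" using r by (simp add: L_def)
      also have "\<dots> \<le> 1 / r + 1 / r" using \<open>1 \<le> 1 / r\<close> by linarith
      also have "\<dots> = 2 / r" by simp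
      finally show "real L \<le> 2 / r" .
    qed
    let ?T = "\<lambda>l. (+) (real l *\<^sub>R v) ` S"
    let ?B = "cbox (p - (\<chi> i. W)) ((p - (\<chi> i. W)) + (\<chi> i. R + 2 * W))"
    have "S = (cbox p (p + (\<chi> i. R)) \<inter> {x. a \<bullet> x \<le> \<beta> + r}) - {x. a \<bullet> x \<le> \<beta>}"
      by (auto simp: S)
    also have "\<dots> \<in> sets borel"
      by (intro sets.Diff borel_closed closed_Int closed_cbox closed_halfspace_le)
    finally have "S \<in> sets lebesgue" by (simp add: sets_completionI_sets)
    moreover have "bounded S" by (rule bounded_subset[OF bounded_cbox]) (auto simp: S)
    ultimately have lm: "S \<in> lmeasurable" by (rule bounded_set_imp_lmeasurable[rotated])
    have T: "?T l \<in> lmeasurable" for l using lm by (rule measurable_translation)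
    have "disjoint_family_on ?T {..<L}"
    proof (unfold disjoint_family_on_def, intro ballI impI equals0I)
      fix l l' x assume ne: "l \<noteq> l'" and "x \<in> ?T l \<inter> ?T l'"
      then obtain y y' where y: "y \<in> S" "x = real l *\<^sub>R v + y" "y' \<in> S" "x = real l' *\<^sub>R v + y'" by auto
      have "a \<bullet> x = real l * r + a \<bullet> y"
        unfolding y(2) by (simp add: inner_add_right av)
      moreover have "a \<bullet> x = real l' * r + a \<bullet> y'"
        unfolding y(4) by (simp add: inner_add_right av)
      moreover have "\<beta> < a \<bullet> y" "a \<bullet> y \<le> \<beta> + r" "\<beta> < a \<bullet> y'" "a \<bullet> y' \<le> \<beta> + r" using y by (auto simp: S)
      ultimately have "real l * r < real l' * r + r" "real l' * r < real l * r + r" by linarith+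
      then have "real l * r < real (l' + 1) * r" "real l' * r < real (l + 1) * r" by (simp_all add: distrib_right)
      then have "l < l' + 1" "l' < l + 1" using r by (simp_all only: mult_less_cancel_right_pos of_nat_less_iff)
      then show False using ne by simp
    qed
    then have "measure lebesgue (\<Union>l\<in>{..<L}. ?T l) = (\<Sum>l<L. measure lebesgue (?T l))"
      by (intro measure_finite_Union) (use fmeasurableD[OF T] fmeasurableD2[OF T] in \<open>simp_all add: image_subset_iff\<close>)
    also have "\<dots> = real L * measure lebesgue S" by (simp add: measure_translation)
    finally have eq: "real L * measure lebesgue S = measure lebesgue (\<Union>l\<in>{..<L}. ?T l)" ..
    have "(\<Union>l\<in>{..<L}. ?T l) \<subseteq> ?B"
    proof
      fix x assume "x \<in> (\<Union>l\<in>{..<L}. ?T l)"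
      then obtain l y where ly: "l < L" "y \<in> S" "x = real l *\<^sub>R v + y" by auto
      have 1: "\<bar>real l * v $ i\<bar> \<le> W" for i
      proof -
        have "\<bar>real l * v $ i\<bar> = real l * (r / (a \<bullet> a) * \<bar>a $ i\<bar>)"
          using r aa by (simp add: v_def abs_mult)
        also have "\<dots> \<le> (2 / r) * (r / (a \<bullet> a) * norm a)"
          using ly(1) L(2) r aa by (intro mult_mono component_le_norm_cart) auto
        also have "\<dots> = W" using r by (simp add: W_def)
        finally show ?thesis .
      qed
      have 2: "p $ i \<le> y $ i" "y $ i \<le> p $ i + R" for i using ly(2) by (auto simp: S mem_box_cart)
      show "x \<in> ?B"
        unfolding mem_box_cart
      proof
        fix i
        have "x $ i = real l * v $ i + y $ i" by (simp add: ly(3))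
        then show "(p - (\<chi> i. W)) $ i \<le> x $ i \<and> x $ i \<le> ((p - (\<chi> i. W)) + (\<chi> i. R + 2 * W)) $ i"
          using 1[of i] 2[of i] by (simp add: abs_le_iff)
      qed
    qed
    then have "measure lebesgue (\<Union>l\<in>{..<L}. ?T l) \<le> measure lebesgue ?B"
    proof (rule measure_mono_fmeasurable)
      show "(\<Union>l\<in>{..<L}. ?T l) \<in> sets lebesgue" by (intro sets.finite_UN fmeasurableD T) simp
    qed simp
    also have "\<dots> = (R + 2 * W) ^ CARD('n)" using R W by (intro measure_lebesgue_cube) auto
    finally have le: "real L * measure lebesgue S \<le> (R + 2 * W) ^ CARD('n)" using eq by simp
    have "(1 / r) * measure lebesgue S \<le> real L * measure lebesgue S"
      using L(1) by (intro mult_right_mono) auto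
    then have "(1 / r) * measure lebesgue S \<le> (R + 2 * W) ^ CARD('n)" using le by linarith
    then show ?thesis using r by (simp add: field_simps)
  qed
  then show ?thesis using R W by (intro exI[of _ "(R + 2 * W) ^ CARD('n)"]) auto
qed

lemma pt_nth: "pt M z $ j = real_of_int (z $ j) / real M"
  by (simp add: pt_def)

lemma finite_grid_bounded:
  assumes "bounded S" "1 \<le> M"
  shows "finite {z :: int ^ 'n. pt M z \<in> S}"
proof -
  obtain B where B: "\<And>x. x \<in> S \<Longrightarrow> norm x \<le> B" using assms(1) by (auto simp: bounded_iff)
  have "{z. pt M z \<in> S} \<subseteq> {z. \<forall>j. z $ j \<in> {\<lfloor>- (M * B)\<rfloor>..\<lceil>M * B\<rceil>}}"
  proof (intro subsetI CollectI allI)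
    fix z j assume "z \<in> {z. pt M z \<in> S}"
    then have "\<bar>pt M z $ j\<bar> \<le> B" using B component_le_norm_cart order_trans by blast
    then have "\<bar>real_of_int (z $ j)\<bar> \<le> M * B" using assms(2) by (simp add: pt_nth abs_divide field_simps)
    then show "z $ j \<in> {\<lfloor>- (M * B)\<rfloor>..\<lceil>M * B\<rceil>}" by (auto simp: abs_le_iff) linarith+
  qed
  moreover have "finite {z :: int ^ 'n. \<forall>j. z $ j \<in> {\<lfloor>- (M * B)\<rfloor>..\<lceil>M * B\<rceil>}}"
    by (rule finite_sum_vec_box) auto
  ultimately show ?thesis by (rule finite_subset)
qed

section \<open>Grid counts and volumes of slab polyhedra\<close>

context frame begin

definition slab_poly :: "(real ^ 'n \<Rightarrow> real) \<Rightarrow> (real ^ 'n) set" where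
  "slab_poly b = {x. \<forall>a\<in>A. a \<bullet> x \<le> b a}"

lemma closed_slab_poly: "closed (slab_poly b)"
proof -
  have "slab_poly b = (\<Inter>a\<in>A. {x. a \<bullet> x \<le> b a})" by (auto simp: slab_poly_def)
  then show ?thesis by (auto intro: closed_halfspace_le)
qed

lemma slab_poly_mono: "(\<And>a. a \<in> A \<Longrightarrow> b a \<le> b' a) \<Longrightarrow> slab_poly b \<subseteq> slab_poly b'"
  by (force simp: slab_poly_def)

lemma slab_poly_lmeasurable: "bounded (slab_poly b) \<Longrightarrow> slab_poly b \<in> lmeasurable"
  using closed_slab_poly compact_eq_bounded_closed lmeasurable_compact by blast

lemma slab_poly_near:
  assumes "x \<in> slab_poly b" "\<And>j. \<bar>y $ j - x $ j\<bar> \<le> s"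
  shows "y \<in> slab_poly (\<lambda>a. b a + s)"
  unfolding slab_poly_def
proof (intro CollectI ballI)
  fix a assume a: "a \<in> A"
  have "\<bar>a \<bullet> (y - x)\<bar> \<le> s" using assms(2) by (intro inner_A_le[OF a]) auto
  moreover have "a \<bullet> x \<le> b a" using assms(1) a by (auto simp: slab_poly_def)
  ultimately show "a \<bullet> y \<le> b a + s" by (simp add: inner_diff_right abs_le_iff)
qed

text \<open>The open cubes of side 1/M at the grid points are disjoint and, by the entry bound on
  \<open>A\<close>, stay inside the polyhedron whose facets are moved out by 1/M.\<close>

lemma grid_count_le_volume:
  assumes M: "1 \<le> M" and bd: "bounded (slab_poly (\<lambda>a. b a + 1 / real M))"
  shows "real (card {z. pt M z \<in> slab_poly b}) / real M ^ CARD('n) \<le> measure lebesgue (slab_poly (\<lambda>a. b a + 1 / real M))"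
proof -
  let ?Z = "{z. pt M z \<in> slab_poly b}"
  let ?C = "\<lambda>z. box (pt M z) (pt M z + (\<chi> i. 1 / real M))"
  have "bounded (slab_poly b)" using bd by (rule bounded_subset) (auto intro!: slab_poly_mono)
  then have fin: "finite ?Z" using M by (rule finite_grid_bounded)
  have box_finite: "emeasure lborel (box u v) \<noteq> top" for u v :: "real ^ 'n"
    using emeasure_lborel_box_finite[of u v] by (simp add: less_top)
  have "disjoint_family_on ?C ?Z"
  proof (unfold disjoint_family_on_def, intro ballI impI equals0I)
    fix z z' :: "int ^ 'n" and x assume ne: "z \<noteq> z'" and x: "x \<in> ?C z \<inter> ?C z'"
    have "z $ j = z' $ j" for j
    proof -
      have "real_of_int (z $ j) < real M * x $ j" "real M * x $ j < real_of_int (z $ j) + 1"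
        "real_of_int (z' $ j) < real M * x $ j" "real M * x $ j < real_of_int (z' $ j) + 1"
        using x M by (auto simp: mem_box_cart pt_nth add_divide_distrib[symmetric] pos_divide_less_eq pos_less_divide_eq mult.commute)
      then show ?thesis by linarith
    qed
    then show False using ne by (simp add: vec_eq_iff)
  qed
  then have "measure lebesgue (\<Union>z\<in>?Z. ?C z) = (\<Sum>z\<in>?Z. measure lebesgue (?C z))"
    using fin by (intro measure_finite_Union) (auto simp: box_finite)
  also have "\<dots> = (\<Sum>z\<in>?Z. (1 / real M) ^ CARD('n))"
    by (intro sum.cong refl measure_lebesgue_cube) simp
  also have "\<dots> = real (card ?Z) / real M ^ CARD('n)" by (simp add: power_divide)
  finally have eq: "real (card ?Z) / real M ^ CARD('n) = measure lebesgue (\<Union>z\<in>?Z. ?C z)" ..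
  have "(\<Union>z\<in>?Z. ?C z) \<subseteq> slab_poly (\<lambda>a. b a + 1 / real M)"
  proof clarify
    fix z x assume "pt M z \<in> slab_poly b" "x \<in> ?C z"
    moreover have "\<bar>x $ j - pt M z $ j\<bar> \<le> 1 / real M" for j
    proof -
      have "pt M z $ j < x $ j" "x $ j < pt M z $ j + 1 / real M"
        using \<open>x \<in> ?C z\<close> by (simp_all add: mem_box_cart)
      then show ?thesis by (simp add: abs_le_iff)
    qed
    ultimately show "x \<in> slab_poly (\<lambda>a. b a + 1 / real M)" by (intro slab_poly_near[of "pt M z"])
  qed
  then show ?thesis unfolding eq
    by (intro measure_mono_fmeasurable slab_poly_lmeasurable bd) (auto intro!: sets.finite_UN fin)
qed

text \<open>Rounding down a point of the polyhedron to the grid moves it by at most 1/M in each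
  coordinate, so closed cubes at grid points of the enlarged polyhedron cover it.\<close>

lemma volume_le_grid_count:
  assumes M: "1 \<le> M" and bd: "bounded (slab_poly (\<lambda>a. b a + 1 / real M))"
  shows "measure lebesgue (slab_poly b) \<le> real (card {z. pt M z \<in> slab_poly (\<lambda>a. b a + 1 / real M)}) / real M ^ CARD('n)"
proof -
  let ?Z = "{z. pt M z \<in> slab_poly (\<lambda>a. b a + 1 / real M)}"
  let ?C = "\<lambda>z. cbox (pt M z) (pt M z + (\<chi> i. 1 / real M))"
  have fin: "finite ?Z" using bd M by (rule finite_grid_bounded)
  have "slab_poly b \<subseteq> (\<Union>z\<in>?Z. ?C z)"
  proof
    fix x assume x: "x \<in> slab_poly b"
    define z :: "int ^ 'n" where "z = (\<chi> j. \<lfloor>real M * x $ j\<rfloor>)"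
    have z: "pt M z $ j \<le> x $ j \<and> x $ j \<le> pt M z $ j + 1 / real M" for j
    proof -
      have "real_of_int (z $ j) \<le> real M * x $ j" "real M * x $ j \<le> real_of_int (z $ j) + 1"
        unfolding z_def by simp_all
      then show ?thesis using M by (simp add: pt_nth add_divide_distrib[symmetric] pos_divide_le_eq pos_le_divide_eq mult.commute)
    qed
    have "\<bar>pt M z $ j - x $ j\<bar> \<le> 1 / real M" for j using z[of j] by (simp add: abs_le_iff)
    from slab_poly_near[OF x this] have "z \<in> ?Z" by simp
    moreover have "x \<in> ?C z" using z by (simp add: mem_box_cart)
    ultimately show "x \<in> (\<Union>z\<in>?Z. ?C z)" by blast
  qed
  then have "measure lebesgue (slab_poly b) \<le> measure lebesgue (\<Union>z\<in>?Z. ?C z)"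
    using fin by (intro measure_mono_fmeasurable)
      (auto intro!: fmeasurable.finite_UN sets_completionI_sets borel_closed closed_slab_poly)
  also have "\<dots> \<le> (\<Sum>z\<in>?Z. measure lebesgue (?C z))"
    by (rule measure_UNION_le[OF fin]) auto
  also have "\<dots> = (\<Sum>z\<in>?Z. (1 / real M) ^ CARD('n))"
    by (intro sum.cong refl measure_lebesgue_cube) simp
  also have "\<dots> = real (card ?Z) / real M ^ CARD('n)" by (simp add: power_divide)
  finally show ?thesis .
qed

text \<open>The added shell is covered by one slab of width r per normal within a cube of side
  \<open>R\<close>, whence a constant independent of \<open>b\<close> and of the position.\<close>

lemma volume_enlarged_le:
  assumes "0 \<notin> A" "0 \<le> R"
  shows "\<exists>C\<ge>0. \<forall>b r p. 0 < r \<longrightarrow> r \<le> 1 \<longrightarrow> slab_poly (\<lambda>a. b a + r) \<subseteq> cbox p (p + (\<chi> i. R)) \<longrightarrow>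
    measure lebesgue (slab_poly (\<lambda>a. b a + r)) \<le> measure lebesgue (slab_poly b) + C * r"
proof -
  have "\<forall>a\<in>A. \<exists>C\<ge>0. \<forall>p \<beta> r. 0 < r \<longrightarrow> r \<le> 1 \<longrightarrow>
    measure lebesgue {x \<in> cbox p (p + (\<chi> i. R)). \<beta> < a \<bullet> x \<and> a \<bullet> x \<le> \<beta> + r} \<le> C * r"
  proof
    fix a assume "a \<in> A"
    then have "a \<noteq> 0" using assms(1) by auto
    from slab_measure_le[OF this assms(2)] show "\<exists>C\<ge>0. \<forall>p \<beta> r. 0 < r \<longrightarrow> r \<le> 1 \<longrightarrow>
      measure lebesgue {x \<in> cbox p (p + (\<chi> i. R)). \<beta> < a \<bullet> x \<and> a \<bullet> x \<le> \<beta> + r} \<le> C * r" .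
  qed
  then obtain C where C: "\<forall>a\<in>A. 0 \<le> C a \<and> (\<forall>p \<beta> r. 0 < r \<longrightarrow> r \<le> 1 \<longrightarrow>
    measure lebesgue {x \<in> cbox p (p + (\<chi> i. R)). \<beta> < a \<bullet> x \<and> a \<bullet> x \<le> \<beta> + r} \<le> C a * r)"
    by (rule bchoice[THEN exE])
  have "measure lebesgue (slab_poly (\<lambda>a. b a + r)) \<le> measure lebesgue (slab_poly b) + (\<Sum>a\<in>A. C a) * r"
    if r: "0 < r" "r \<le> 1" and sub: "slab_poly (\<lambda>a. b a + r) \<subseteq> cbox p (p + (\<chi> i. R))" for b r p
  proof -
    let ?S = "\<lambda>a. {x \<in> cbox p (p + (\<chi> i. R)). b a < a \<bullet> x \<and> a \<bullet> x \<le> b a + r}"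
    have meas: "?S a \<in> sets lebesgue" for a
    proof -
      have "?S a = (cbox p (p + (\<chi> i. R)) \<inter> {x. a \<bullet> x \<le> b a + r}) - {x. a \<bullet> x \<le> b a}"
        by auto
      also have "\<dots> \<in> sets borel"
        by (intro sets.Diff borel_closed closed_Int closed_cbox closed_halfspace_le)
      finally show ?thesis by (simp add: sets_completionI_sets)
    qed
    have bd': "bounded (slab_poly (\<lambda>a. b a + r))" using sub by (rule bounded_subset[OF bounded_cbox])
    have bd: "bounded (slab_poly b)" by (rule bounded_subset[OF bd']) (use r in \<open>auto intro!: slab_poly_mono\<close>)
    have lm: "slab_poly b \<in> lmeasurable" using bd by (rule slab_poly_lmeasurable)
    have lmS: "?S a \<in> lmeasurable" for a
      by (rule bounded_set_imp_lmeasurable[OF bounded_subset[OF bounded_cbox] meas]) auto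
    have lmU: "(\<Union>a\<in>A. ?S a) \<in> lmeasurable" using finite_A lmS by (intro fmeasurable.finite_UN) auto
    have "slab_poly (\<lambda>a. b a + r) \<subseteq> slab_poly b \<union> (\<Union>a\<in>A. ?S a)"
    proof
      fix x assume x: "x \<in> slab_poly (\<lambda>a. b a + r)"
      then show "x \<in> slab_poly b \<union> (\<Union>a\<in>A. ?S a)"
        using sub by (cases "x \<in> slab_poly b") (auto simp: slab_poly_def not_le)
    qed
    then have "measure lebesgue (slab_poly (\<lambda>a. b a + r)) \<le> measure lebesgue (slab_poly b \<union> (\<Union>a\<in>A. ?S a))"
      using slab_poly_lmeasurable[OF bd'] lm lmU
      by (intro measure_mono_fmeasurable fmeasurable.Un) auto
    also have "\<dots> \<le> measure lebesgue (slab_poly b) + measure lebesgue (\<Union>a\<in>A. ?S a)"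
      using lm lmU by (intro measure_Un_le) auto
    also have "measure lebesgue (\<Union>a\<in>A. ?S a) \<le> (\<Sum>a\<in>A. measure lebesgue (?S a))"
      by (rule measure_UNION_le[OF finite_A meas])
    also have "\<dots> \<le> (\<Sum>a\<in>A. C a * r)" using C r by (intro sum_mono) auto
    finally show ?thesis by (simp add: sum_distrib_right)
  qed
  moreover have "0 \<le> (\<Sum>a\<in>A. C a)" using C by (intro sum_nonneg) auto
  ultimately show ?thesis by (intro exI[of _ "\<Sum>a\<in>A. C a"]) auto
qed

end

section \<open>From smoothed to sharp indicators\<close>

context step_frame begin

lemma smooth_ind_range: "0 \<le> smooth_ind n b x \<and> smooth_ind n b x \<le> 1"
  unfolding smooth_ind_def using th_range by (auto intro!: prod_nonneg prod_le_1)

lemma smooth_ind_eq_1: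
  assumes "x \<in> slab_poly (\<lambda>a. b a - 1 / 2 ^ n)"
  shows "smooth_ind n b x = 1"
  unfolding smooth_ind_def
proof (intro prod.neutral ballI th_1)
  fix a assume "a \<in> A"
  then have "1 / 2 ^ n \<le> b a - a \<bullet> x" using assms by (auto simp: slab_poly_def)
  then have "2 ^ Suc n * (1 / 2 ^ n) \<le> 2 ^ Suc n * (b a - a \<bullet> x)" by (rule mult_left_mono) simp
  then show "2 \<le> 2 ^ Suc n * (b a - a \<bullet> x)" by simp
qed

lemma smooth_ind_support: "smooth_ind n b x \<noteq> 0 \<Longrightarrow> x \<in> slab_poly b"
  using smooth_ind_eq_0 by (force simp: slab_poly_def not_le)

lemma sum_smooth_ind_bounds:
  fixes f :: "int ^ 'n \<Rightarrow> nat"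
  assumes M: "1 \<le> M" and bd: "bounded (slab_poly b)"
  shows "(\<Sum>z | smooth_ind n b (pt M z) \<noteq> 0. smooth_ind n b (pt M z) * real (f z)) \<le> (\<Sum>z | pt M z \<in> slab_poly b. real (f z))"
    and "(\<Sum>z | pt M z \<in> slab_poly (\<lambda>a. b a - 1 / 2 ^ n). real (f z)) \<le>
      (\<Sum>z | smooth_ind n b (pt M z) \<noteq> 0. smooth_ind n b (pt M z) * real (f z))"
proof -
  have fin: "finite {z. pt M z \<in> slab_poly b}" using bd M by (rule finite_grid_bounded)
  have sub: "{z. smooth_ind n b (pt M z) \<noteq> 0} \<subseteq> {z. pt M z \<in> slab_poly b}"
    using smooth_ind_support by blast
  have "(\<Sum>z | smooth_ind n b (pt M z) \<noteq> 0. smooth_ind n b (pt M z) * real (f z)) \<le>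
      (\<Sum>z | smooth_ind n b (pt M z) \<noteq> 0. 1 * real (f z))"
    using smooth_ind_range by (intro sum_mono mult_right_mono) auto
  also have "\<dots> \<le> (\<Sum>z | pt M z \<in> slab_poly b. real (f z))"
    using sum_mono2[OF fin sub, of "\<lambda>z. real (f z)"] by simp
  finally show "(\<Sum>z | smooth_ind n b (pt M z) \<noteq> 0. smooth_ind n b (pt M z) * real (f z)) \<le> (\<Sum>z | pt M z \<in> slab_poly b. real (f z))" .
  have "(\<Sum>z | pt M z \<in> slab_poly (\<lambda>a. b a - 1 / 2 ^ n). real (f z)) =
      (\<Sum>z | pt M z \<in> slab_poly (\<lambda>a. b a - 1 / 2 ^ n). smooth_ind n b (pt M z) * real (f z))"
    by (intro sum.cong refl) (simp add: smooth_ind_eq_1)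
  also have "\<dots> \<le> (\<Sum>z | smooth_ind n b (pt M z) \<noteq> 0. smooth_ind n b (pt M z) * real (f z))"
    using finite_subset[OF sub fin] smooth_ind_range
    by (intro sum_mono2) (auto simp: smooth_ind_eq_1)
  finally show "(\<Sum>z | pt M z \<in> slab_poly (\<lambda>a. b a - 1 / 2 ^ n). real (f z)) \<le>
      (\<Sum>z | smooth_ind n b (pt M z) \<noteq> 0. smooth_ind n b (pt M z) * real (f z))" .
qed

text \<open>A sandwich: the smoothed indicator of b + 2^-n is 1 on the polyhedron of b, and that of
  b lies below the sharp one. Only these two right-hand sides enter the error hypothesis; comparing
  grid sums with volumes costs a further 1/M.\<close>

lemma volume_minus_lattice_sum_le:
  assumes "0 \<notin> A" "0 \<le> R"
  shows "\<exists>C\<ge>0. \<forall>m M n E b p. \<forall>f :: int ^ 'n \<Rightarrow> nat. 1 \<le> M \<longrightarrow> 1 / 2 ^ n + 1 / real M \<le> 1 \<longrightarrow>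
    slab_poly (\<lambda>a. b a + (1 / 2 ^ n + 1 / real M)) \<subseteq> cbox p (p + (\<chi> i. R)) \<longrightarrow>
    (\<forall>b'\<in>{b, \<lambda>a. b a + 1 / 2 ^ n}.
      \<bar>(\<Sum>z | smooth_ind n b' (pt M z) \<noteq> 0. smooth_ind n b' (pt M z) * f z) / real m -
        (\<Sum>z | smooth_ind n b' (pt M z) \<noteq> 0. smooth_ind n b' (pt M z)) / real M ^ CARD('n)\<bar> \<le> E) \<longrightarrow>
    \<bar>measure lebesgue (slab_poly b) - (\<Sum>z | pt M z \<in> slab_poly b. real (f z)) / real m\<bar> \<le>
      E + C * (1 / 2 ^ n + 1 / real M)"
proof -
  from volume_enlarged_le[OF assms] obtain C where C: "0 \<le> C" and
    C': "\<forall>b r p. 0 < r \<longrightarrow> r \<le> 1 \<longrightarrow> slab_poly (\<lambda>a. b a + r) \<subseteq> cbox p (p + (\<chi> i. R)) \<longrightarrow>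
    measure lebesgue (slab_poly (\<lambda>a. b a + r)) \<le> measure lebesgue (slab_poly b) + C * r" by blast
  show ?thesis
  proof (intro exI[of _ C] conjI allI impI C)
    fix m M n E b p and f :: "int ^ 'n \<Rightarrow> nat"
    define \<delta> where "\<delta> = (1 / 2 ^ n :: real)"
    define s where "s = \<delta> + 1 / real M"
    let ?G = "\<lambda>b. \<Sum>z | smooth_ind n b (pt M z) \<noteq> 0. smooth_ind n b (pt M z)"
    let ?H = "\<lambda>b. \<Sum>z | smooth_ind n b (pt M z) \<noteq> 0. smooth_ind n b (pt M z) * f z"
    let ?N = "\<Sum>z | pt M z \<in> slab_poly b. real (f z)"
    assume M: "1 \<le> M" and s1: "1 / 2 ^ n + 1 / real M \<le> 1"
      and sub: "slab_poly (\<lambda>a. b a + (1 / 2 ^ n + 1 / real M)) \<subseteq> cbox p (p + (\<chi> i. R))"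
      and E: "\<forall>b'\<in>{b, \<lambda>a. b a + 1 / 2 ^ n}. \<bar>?H b' / real m - ?G b' / real M ^ CARD('n)\<bar> \<le> E"
    note s1 = s1[folded \<delta>_def, folded s_def] and sub = sub[folded \<delta>_def, folded s_def]
      and E = E[folded \<delta>_def]
    have \<delta>0: "0 < \<delta>" "0 < 1 / real M" using M by (simp_all add: \<delta>_def)
    then have s0: "0 < s" unfolding s_def by (rule add_pos_pos)
    have bds: "bounded (slab_poly (\<lambda>a. b a + s))" using sub by (rule bounded_subset[OF bounded_cbox])
    have bd: "bounded (slab_poly b')" if "\<And>a. b' a \<le> b a + s" for b'
      by (rule bounded_subset[OF bds]) (use that in \<open>auto intro!: slab_poly_mono\<close>)
    have Md: "0 < real M ^ CARD('n)" using M by simp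
    have G: "?G b' \<le> real (card {z. pt M z \<in> slab_poly b'})"
      "real (card {z. pt M z \<in> slab_poly (\<lambda>a. b' a - \<delta>)}) \<le> ?G b'" if "bounded (slab_poly b')" for b'
      using sum_smooth_ind_bounds[OF M that, where n = n and f = "\<lambda>_. 1"] by (simp_all add: \<delta>_def)
    have "?N / m \<le> measure lebesgue (slab_poly b) + (E + C * s)"
    proof -
      let ?b = "\<lambda>a. b a + \<delta>"
      have bdb: "bounded (slab_poly ?b)" by (rule bd) (use \<delta>0 in \<open>simp add: s_def\<close>)
      have "?N \<le> ?H ?b" using sum_smooth_ind_bounds(2)[OF M bdb, where n = n and f = f] by (simp add: \<delta>_def)
      then have "?N / m \<le> ?H ?b / m" by (simp add: divide_right_mono)
      also have "\<dots> \<le> ?G ?b / real M ^ CARD('n) + E" using E by auto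
      also have "?G ?b / real M ^ CARD('n) \<le> real (card {z. pt M z \<in> slab_poly ?b}) / real M ^ CARD('n)"
        using G(1)[OF bdb] Md by (intro divide_right_mono) auto
      also have "\<dots> \<le> measure lebesgue (slab_poly (\<lambda>a. ?b a + 1 / real M))"
        by (rule grid_count_le_volume[OF M]) (use bds in \<open>simp add: s_def add.assoc\<close>)
      also have "(\<lambda>a. ?b a + 1 / real M) = (\<lambda>a. b a + s)" by (simp add: s_def add.assoc)
      also have "measure lebesgue (slab_poly (\<lambda>a. b a + s)) \<le> measure lebesgue (slab_poly b) + C * s"
        using C' s0 s1 sub by blast
      finally show ?thesis by simp
    qed
    moreover have "measure lebesgue (slab_poly b) - (E + C * s) \<le> ?N / m"
    proof -
      \<comment> \<open>The volume estimate starts from the polyhedron shrunk by s. Enlarged by 1/M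
        for the grid count, it becomes that of b - 2^-n, where the smoothed indicator of b equals
        1.\<close>
      let ?b = "\<lambda>a. b a - s"
      have e1: "(\<lambda>a. ?b a + s) = b" by simp
      have e2: "(\<lambda>a. ?b a + 1 / real M) = (\<lambda>a. b a - \<delta>)" by (simp add: s_def)
      have subb: "slab_poly b \<subseteq> cbox p (p + (\<chi> i. R))"
        using sub slab_poly_mono[of b "\<lambda>a. b a + s"] s0 by fastforce
      have bdb: "bounded (slab_poly b)" by (rule bd) (use s0 in simp)
      have "measure lebesgue (slab_poly b) \<le> measure lebesgue (slab_poly ?b) + C * s"
        using C'[rule_format, of s ?b p] s0 s1 subb unfolding e1 by blast
      also have "measure lebesgue (slab_poly ?b) \<le> real (card {z. pt M z \<in> slab_poly (\<lambda>a. b a - \<delta>)}) / real M ^ CARD('n)"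
      proof (rule volume_le_grid_count[OF M, of ?b, unfolded e2])
        have "b a - \<delta> \<le> b a + s" for a using \<delta>0 s0 by linarith
        then show "bounded (slab_poly (\<lambda>a. b a - \<delta>))" by (rule bd)
      qed
      also have "\<dots> \<le> ?G b / real M ^ CARD('n)"
        using G(2)[OF bdb] Md by (intro divide_right_mono) auto
      also have "\<dots> \<le> ?H b / m + E" using E by (auto simp: abs_le_iff)
      also have "?H b / m \<le> ?N / m"
        using sum_smooth_ind_bounds(1)[OF M bdb, where n = n and f = f] by (simp add: divide_right_mono)
      finally show ?thesis by simp
    qed
    ultimately show "\<bar>measure lebesgue (slab_poly b) - ?N / m\<bar> \<le> E + C * (1 / 2 ^ n + 1 / real M)"
      unfolding s_def[symmetric] \<delta>_def[symmetric] by (simp add: abs_le_iff)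
  qed
qed

end

section \<open>The torus\<close>


lemma to_torus_eq_iff: "to_torus x = to_torus y \<longleftrightarrow> torus_rel x y"
  by (simp add: to_torus.abs_eq torus.abs_eq_iff)

lemma torus_rel_iff: "torus_rel x y \<longleftrightarrow> (\<exists>z. x = rvec z + y)"
proof
  assume "torus_rel x y"
  then have "\<forall>i. \<exists>k::int. x $ i - y $ i = of_int k" by (auto simp: torus_rel_def Ints_def)
  then obtain k :: "'a \<Rightarrow> int" where "\<And>i. x $ i - y $ i = of_int (k i)" by metis
  then have "x = rvec (\<chi> i. k i) + y" by (simp add: vec_eq_iff algebra_simps)
  then show "\<exists>z. x = rvec z + y" by blast
qed (auto simp: torus_rel_def)

lemma int_vec_eq_0:
  assumes "norm (rvec z) < 1"
  shows "z = 0"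
proof -
  have "z $ i = 0" for i
  proof -
    have "\<bar>real_of_int (z $ i)\<bar> < 1"
      using component_le_norm_cart[of "rvec z" i] assms by simp
    then show ?thesis by linarith
  qed
  then show ?thesis by (simp add: vec_eq_iff)
qed

text \<open>A nonzero integer vector has norm at least 1, so distinct integer translates of a set of
  diameter below 1 are disjoint, and the quotient map is injective on it.\<close>

lemma int_vec_eq:
  assumes "bounded K" "diameter K < 1" "x \<in> K" "y \<in> K" "rvec z + x = rvec w + y"
  shows "z = w"
proof -
  have "rvec (z - w) = y - x"
    using assms(5) by (simp add: vec_eq_iff algebra_simps)
  moreover have "dist y x < 1" using diameter_bounded_bound[OF assms(1,4,3)] assms(2) by simp
  ultimately have "z - w = 0" by (intro int_vec_eq_0) (simp add: dist_norm)
  then show ?thesis by simp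
qed

lemma vimage_to_torus: "to_torus -` to_torus ` K = (\<Union>z. (+) (rvec z) ` K)"
proof -
  have *: "to_torus y \<in> to_torus ` K \<longleftrightarrow> (\<exists>x\<in>K. \<exists>z. y = rvec z + x)" for y
    unfolding image_iff to_torus_eq_iff torus_rel_iff ..
  show ?thesis
  proof (rule set_eqI)
    fix y
    have "y \<in> to_torus -` to_torus ` K \<longleftrightarrow> (\<exists>x\<in>K. \<exists>z. y = rvec z + x)"
      unfolding vimage_eq by (rule *)
    also have "\<dots> \<longleftrightarrow> y \<in> (\<Union>z. (+) (rvec z) ` K)" by blast
    finally show "y \<in> to_torus -` to_torus ` K \<longleftrightarrow> y \<in> (\<Union>z. (+) (rvec z) ` K)" .
  qed
qed

lemma emeasure_translation: "emeasure lebesgue ((+) a ` S) = emeasure lebesgue S" for a :: "'a::euclidean_space"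
  using emeasure_lebesgue_affine[of 1 a S] by (simp add: add.commute)

lemma sets_lebesgue_translation: "S \<in> sets lebesgue \<Longrightarrow> (+) a ` S \<in> sets lebesgue" for a :: "'a::euclidean_space"
  by (rule lebesgue_sets_translation)

lemma unit_cell_translate_unique: "\<exists>!z. rvec z + x \<in> unit_cell"
proof (rule ex1I[of _ "\<chi> i. - \<lfloor>x $ i\<rfloor>"])
  have "0 \<le> x $ i - of_int \<lfloor>x $ i\<rfloor> \<and> x $ i - of_int \<lfloor>x $ i\<rfloor> < 1" for i by linarith
  then show "rvec (\<chi> i. - \<lfloor>x $ i\<rfloor>) + x \<in> unit_cell" by (simp add: unit_cell_def)
  fix z assume "rvec z + x \<in> unit_cell"
  then have "0 \<le> of_int (z $ i) + x $ i \<and> of_int (z $ i) + x $ i < 1" for i by (simp add: unit_cell_def)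
  then have "z $ i = - \<lfloor>x $ i\<rfloor>" for i by (smt (verit, best) floor_unique of_int_minus)
  then show "z = (\<chi> i. - \<lfloor>x $ i\<rfloor>)" by (simp add: vec_eq_iff)
qed

text \<open>The integer translates of \<open>K\<close>, cut by the unit cell, are disjoint. Moved
  back they partition \<open>K\<close>, since every point has exactly one integer translate in the
  cell.\<close>

lemma measure_torus_image:
  fixes K :: "(real ^ 'n::finite) set"
  assumes K: "K \<in> sets lebesgue" and bd: "bounded K" and diam: "diameter K < 1"
  shows "measure torus_lebesgue (to_torus ` K) = measure lebesgue K"
proof -
  let ?T = "\<lambda>z. (+) (rvec z) ` K"
  let ?cell = "\<lambda>z. {x \<in> K. rvec z + x \<in> unit_cell}"
  have T: "?T z \<in> sets lebesgue" for z by (rule sets_lebesgue_translation[OF K])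
  have img: "?T z \<inter> unit_cell = (+) (rvec z) ` ?cell z" for z by auto
  have cell: "?cell z \<in> sets lebesgue" for z
  proof -
    have "?cell z = (+) (- rvec z) ` (?T z \<inter> unit_cell)"
      by (force simp: image_iff)
    also have "\<dots> \<in> sets lebesgue" by (intro sets_lebesgue_translation sets.Int T unit_cell_lebesgue)
    finally show ?thesis .
  qed
  have "(\<Union>z. ?T z) \<in> sets lebesgue" by (rule sets.countable_UN'') (auto intro: T)
  then have "emeasure torus_lebesgue (to_torus ` K) = emeasure lebesgue ((\<Union>z. ?T z) \<inter> unit_cell)"
    by (simp add: emeasure_torus_lebesgue vimage_to_torus)
  also have "(\<Union>z. ?T z) \<inter> unit_cell = (\<Union>z. ?T z \<inter> unit_cell)" by auto
  also have "emeasure lebesgue \<dots> = (\<integral>\<^sup>+z. emeasure lebesgue (?T z \<inter> unit_cell) \<partial>count_space UNIV)"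
  proof (rule emeasure_UN_countable)
    show "disjoint_family_on (\<lambda>z. ?T z \<inter> unit_cell) UNIV"
      unfolding disjoint_family_on_def using int_vec_eq[OF bd diam] by blast
  qed (use T unit_cell_lebesgue in auto)
  also have "\<dots> = (\<integral>\<^sup>+z. emeasure lebesgue (?cell z) \<partial>count_space UNIV)"
    unfolding img emeasure_translation ..
  also have "\<dots> = emeasure lebesgue (\<Union>z. ?cell z)"
  proof (rule emeasure_UN_countable[symmetric])
    show "disjoint_family_on ?cell UNIV"
      unfolding disjoint_family_on_def using unit_cell_translate_unique by blast
  qed (use cell in auto)
  also have "(\<Union>z. ?cell z) = K" using unit_cell_translate_unique by blast
  finally show ?thesis by (simp add: measure_def)
qed

text \<open>Each j g / m has at most one representative z / M in \<open>K\<close>, by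
  \<open>int_vec_eq\<close>, so counting the j and counting the z with multiplicity agree.\<close>

lemma sum_indicator_torus_image:
  fixes K :: "(real ^ 'n) set" and g :: "int ^ 'n"
  assumes bd: "bounded K" and diam: "diameter K < 1" and m: "1 \<le> m" and q: "1 \<le> q" and M: "M = m * q"
  shows "(\<Sum>j = 1..m. indicator (to_torus ` K) (to_torus ((real j * inverse (real m)) *\<^sub>R rvec g))) =
    (\<Sum>z | pt M z \<in> K. real (lat_count m q g z))"
proof -
  let ?x = "\<lambda>j. (real j * inverse (real m)) *\<^sub>R rvec g"
  let ?P = "\<lambda>j z. \<forall>i. int M dvd int j * int q * g $ i - z $ i"
  have M0: "0 < M" using m q by (simp add: M)
  have fin: "finite {z :: int ^ 'n. pt M z \<in> K}" using bd M0 by (intro finite_grid_bounded) auto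
  have P: "?P j z \<longleftrightarrow> (\<exists>w. ?x j = rvec w + pt M z)" for j and z :: "int ^ 'n"
  proof
    assume "?P j z"
    then obtain w where w: "\<And>i. int j * int q * g $ i - z $ i = int M * w i" unfolding dvd_def by metis
    have "?x j $ i = (rvec (\<chi> i. w i) + pt M z) $ i" for i
    proof -
      have "real_of_int (int j * int q * g $ i - z $ i) = real_of_int (int M * w i)" by (simp only: w)
      then have "real j * real q * real_of_int (g $ i) = real M * real_of_int (w i) + real_of_int (z $ i)" by simp
      then have "real j * real q * real_of_int (g $ i) / real M = real_of_int (w i) + real_of_int (z $ i) / real M"
        using M0 by (simp add: field_simps)
      moreover have "real j * real q * real_of_int (g $ i) / real M = real j * inverse (real m) * real_of_int (g $ i)"
        using q by (simp add: M field_simps)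
      ultimately show ?thesis by (simp add: pt_nth)
    qed
    then show "\<exists>w. ?x j = rvec w + pt M z" unfolding vec_eq_iff by blast
  next
    assume "\<exists>w. ?x j = rvec w + pt M z"
    then obtain w where w: "?x j = rvec w + pt M z" by blast
    show "?P j z"
    proof
      fix i
      have "real j * inverse (real m) * real_of_int (g $ i) = real_of_int (w $ i) + real_of_int (z $ i) / real M"
        using arg_cong[OF w, of "\<lambda>v. v $ i"] by (simp add: pt_nth)
      then have "real j * inverse (real m) * real_of_int (g $ i) * real M = (real_of_int (w $ i) + real_of_int (z $ i) / real M) * real M"
        by simp
      then have "real j * real q * real_of_int (g $ i) = real M * real_of_int (w $ i) + real_of_int (z $ i)"
        using M0 m by (simp add: M field_simps)
      then have "real_of_int (int j * int q * g $ i - z $ i) = real_of_int (int M * w $ i)" by simp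
      then have "int j * int q * g $ i - z $ i = int M * w $ i" by (simp only: of_int_eq_iff)
      then show "int M dvd int j * int q * g $ i - z $ i" by simp
    qed
  qed
  have one: "indicator (to_torus ` K) (to_torus (?x j)) = real (card {z. pt M z \<in> K \<and> ?P j z})" for j
  proof (cases "to_torus (?x j) \<in> to_torus ` K")
    case True
    then obtain y w where y: "y \<in> K" "?x j = rvec w + y"
      by (auto simp: to_torus_eq_iff torus_rel_iff)
    define z :: "int ^ 'n" where "z = (\<chi> i. int j * int q * g $ i - int M * w $ i)"
    have "?P j z" by (simp add: z_def)
    have "pt M z = y"
    proof -
      have "pt M z $ i = ?x j $ i - real_of_int (w $ i)" for i
        using M0 q by (simp add: pt_nth z_def M field_simps)
      then show ?thesis by (simp add: y(2) vec_eq_iff)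
    qed
    have "z' = z" if K: "pt M z' \<in> K" and Pz: "?P j z'" for z' :: "int ^ 'n"
    proof -
      obtain w' where w': "?x j = rvec w' + pt M z'" using Pz unfolding P by blast
      then have "w' = w" using int_vec_eq[OF bd diam K y(1)] y(2) by metis
      then have "pt M z' = pt M z" using w' y(2) \<open>pt M z = y\<close> by simp
      then have "real_of_int (z' $ i) / real M = real_of_int (z $ i) / real M" for i by (metis pt_nth)
      then show ?thesis using M0 by (simp add: vec_eq_iff)
    qed
    then have "{z. pt M z \<in> K \<and> ?P j z} = {z}" using \<open>?P j z\<close> \<open>pt M z = y\<close> y(1) by blast
    then show ?thesis using True by simp
  next
    case False
    have "\<not> (pt M z \<in> K \<and> ?P j z)" for z
      using False unfolding P by (auto simp: image_iff to_torus_eq_iff torus_rel_iff)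
    then have "{z. pt M z \<in> K \<and> ?P j z} = {}" by blast
    then show ?thesis using False by (simp only: card.empty) simp
  qed
  have "(\<Sum>z | pt M z \<in> K. real (lat_count m q g z)) = (\<Sum>z | pt M z \<in> K. \<Sum>j = 1..m. if ?P j z then 1 else 0)"
    unfolding lat_count_def by (intro sum.cong refl) (simp add: sum.inter_filter[symmetric] M)
  also have "\<dots> = (\<Sum>j = 1..m. \<Sum>z | pt M z \<in> K. if ?P j z then 1 else 0)" by (rule sum.swap)
  also have "\<dots> = (\<Sum>j = 1..m. real (card {z. pt M z \<in> K \<and> ?P j z}))"
    using fin by (intro sum.cong refl) (simp add: sum.inter_filter[symmetric])
  finally show ?thesis by (simp only: one)
qed

text \<open>A facet normal is orthogonal to the hyperspace parallel to the facet, hence a multiple of its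
  normal.\<close>

lemma polyhedron_separating_normal:
  fixes K :: "(real ^ 'n) set"
  assumes K: "convex_polyhedron K"
    and facets: "\<forall>F. F facet_of K \<longrightarrow> (\<exists>H\<in>X. affine_parallel H (affine hull F))"
    and u: "\<And>H. H \<in> X \<Longrightarrow> u H \<noteq> 0 \<and> H = {x. u H \<bullet> x = 0}"
    and x: "x \<notin> K"
  shows "\<exists>H\<in>X. \<exists>l \<beta>. (\<forall>y\<in>K. (l *\<^sub>R u H) \<bullet> y \<le> \<beta>) \<and> \<beta> < (l *\<^sub>R u H) \<bullet> x"
proof -
  have aff: "affine hull K = UNIV"
    using K by (intro affine_hull_nonempty_interior) (simp add: convex_polyhedron_def)
  have "polyhedron K" using K by (simp add: convex_polyhedron_def)
  \<comment> \<open>Minimality of the family of halfspaces makes each bounding hyperplane cut out a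
    facet.\<close>
  then obtain F where F: "finite F" "K = affine hull K \<inter> \<Inter>F"
    "\<forall>h\<in>F. \<exists>a b. a \<noteq> 0 \<and> h = {x. a \<bullet> x \<le> b}" "\<And>F'. F' \<subset> F \<Longrightarrow> K \<subset> affine hull K \<inter> \<Inter>F'"
    unfolding polyhedron_Int_affine_minimal by blast
  then obtain a b where ab: "\<And>h. h \<in> F \<Longrightarrow> a h \<noteq> 0 \<and> h = {x. a h \<bullet> x \<le> b h}" by metis
  obtain h where h: "h \<in> F" "x \<notin> h" using F(2) aff x by blast
  have "(K \<inter> {x. a h \<bullet> x = b h}) facet_of K"
    using facet_of_polyhedron_explicit[OF F(1,2) ab F(4)] h(1) by blast
  then obtain H where H: "H \<in> X" "affine_parallel H (affine hull (K \<inter> {x. a h \<bullet> x = b h}))"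
    and ne: "K \<inter> {x. a h \<bullet> x = b h} \<noteq> {}" using facets unfolding facet_of_def by blast
  then obtain t where t: "affine hull (K \<inter> {x. a h \<bullet> x = b h}) = (\<lambda>x. t + x) ` H"
    unfolding affine_parallel_def by blast
  have "affine hull (K \<inter> {x. a h \<bullet> x = b h}) \<subseteq> {x. a h \<bullet> x = b h}"
    by (rule hull_minimal) (auto intro: affine_hyperplane)
  then have on: "a h \<bullet> (t + v) = b h" if "v \<in> H" for v using that unfolding t by blast
  obtain N where N: "N = u H" by blast
  have N0: "N \<noteq> 0" and "H = {x. N \<bullet> x = 0}" using u[OF H(1)] unfolding N by (rule conjunct1, rule conjunct2)
  then have memH: "v \<in> H \<longleftrightarrow> N \<bullet> v = 0" for v by blast
  have "0 \<in> H" by (simp add: memH)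
  then have orth: "a h \<bullet> v = 0" if "v \<in> H" for v using on[OF that] on[of 0] by (simp add: inner_add_right)
  \<comment> \<open>Orthogonal decomposition of the facet normal along \<open>N\<close>: the
    remainder \<open>w\<close> lies in \<open>H\<close>, to which both \<open>N\<close> and
    \<open>a h\<close> are orthogonal, so w . w = 0. The sign of \<open>l\<close> stays
    open.\<close>
  define l where "l = (a h \<bullet> N) / (N \<bullet> N)"
  define w where "w = a h - l *\<^sub>R N"
  have "N \<bullet> w = 0" using N0 by (simp add: w_def l_def inner_diff_right inner_commute)
  then have "w \<in> H" by (simp add: memH)
  then have "w \<bullet> w = 0" using orth \<open>N \<bullet> w = 0\<close> by (simp add: w_def inner_diff_left)
  then have a: "a h = l *\<^sub>R N" by (simp add: w_def)
  have "a h \<bullet> y \<le> b h" if "y \<in> K" for y using that F(2) h(1) ab[OF h(1)] by blast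
  moreover have "b h < a h \<bullet> x" using h ab[OF h(1)] by fastforce
  ultimately show ?thesis using H(1) unfolding a N by blast
qed

section \<open>Discrepancy of polyhedra\<close>


context frame begin

text \<open>Moving the facet of an axis normal of length c by s moves a coordinate by s / c, which
  confines the enlarged polyhedron near \<open>K\<close>. With c = 1/(4 d) and s \<le> c the slab
  value varies by at most d * c * 2 = 1/2, leaving room for s below the admissible depth 1.\<close>

lemma enlarged_polyhedron:
  fixes c s :: real
  assumes c: "c = 1 / (4 * real CARD('n))" and norm_A: "\<And>a. a \<in> A \<Longrightarrow> norm a = c"
    and axis_A: "\<And>i. axis i c \<in> A" "\<And>i. axis i (- c) \<in> A"
    and ym: "\<And>a. ym a \<in> K" and bd: "bounded K" and diam: "diameter K < 1" and s: "0 \<le> s"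
    and x: "x \<in> slab_poly (\<lambda>a. a \<bullet> ym a + s)"
  shows "y \<in> K \<Longrightarrow> \<bar>x $ j - y $ j\<bar> \<le> 1 + s / c" and "a \<in> A \<Longrightarrow> s \<le> c \<Longrightarrow> a \<bullet> ym a + s - a \<bullet> x \<le> 1"
proof -
  have c0: "0 < c" by (simp add: c)
  have near: "\<bar>y $ j - y' $ j\<bar> \<le> 1" if "y \<in> K" "y' \<in> K" for y y' j
  proof -
    have "\<bar>(y - y') $ j\<bar> \<le> norm (y - y')" by (rule component_le_norm_cart)
    also have "\<dots> \<le> diameter K" using diameter_bounded_bound[OF bd that] by (simp add: dist_norm)
    finally show ?thesis using diam by simp
  qed
  have near_x: "\<bar>x $ j - y $ j\<bar> \<le> 1 + s / c" if y: "y \<in> K" for y j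
  proof -
    have "axis j c \<bullet> x \<le> axis j c \<bullet> ym (axis j c) + s"
      "axis j (- c) \<bullet> x \<le> axis j (- c) \<bullet> ym (axis j (- c)) + s"
      using x axis_A[of j] unfolding slab_poly_def by fastforce+
    then have "c * x $ j \<le> c * (ym (axis j c) $ j + s / c)" "c * (ym (axis j (- c)) $ j - s / c) \<le> c * x $ j"
      using c0 by (simp_all add: inner_axis' algebra_simps)
    then have "x $ j \<le> ym (axis j c) $ j + s / c" "ym (axis j (- c)) $ j - s / c \<le> x $ j"
      using c0 by (simp_all only: mult_le_cancel_left_pos)
    then show ?thesis
      using near[OF ym y, of "axis j c" j] near[OF ym y, of "axis j (- c)" j] by (simp add: abs_le_iff)
  qed
  then show "y \<in> K \<Longrightarrow> \<bar>x $ j - y $ j\<bar> \<le> 1 + s / c" .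
  show "a \<bullet> ym a + s - a \<bullet> x \<le> 1" if a: "a \<in> A" and sc: "s \<le> c"
  proof -
    have "s / c \<le> 1" using sc c0 by simp
    have "\<bar>a \<bullet> (ym a - x)\<bar> \<le> (\<Sum>j\<in>UNIV. \<bar>a $ j\<bar> * \<bar>(ym a - x) $ j\<bar>)"
      unfolding inner_vec_def by (rule order_trans[OF sum_abs]) (simp add: abs_mult)
    also have "\<dots> \<le> (\<Sum>j\<in>(UNIV :: 'n set). c * 2)"
    proof (intro sum_mono mult_mono)
      fix j
      show "\<bar>a $ j\<bar> \<le> c" using component_le_norm_cart[of a j] norm_A[OF a] by simp
      show "\<bar>(ym a - x) $ j\<bar> \<le> 2" using near_x[OF ym, of j a] \<open>s / c \<le> 1\<close> by (simp add: abs_minus_commute)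
    qed (use c0 in auto)
    also have "\<dots> = 1 / 2" by (simp add: c)
    finally have "a \<bullet> ym a - a \<bullet> x \<le> 1 / 2" unfolding inner_diff_right by linarith
    moreover have "c \<le> 1 / 2"
    proof -
      have "1 \<le> real CARD('n)" by (simp add: Suc_leI)
      then show ?thesis unfolding c by (intro divide_left_mono) linarith+
    qed
    ultimately show ?thesis using sc by linarith
  qed
qed

end

lemma dyadic_scale_exists:
  assumes "1 \<le> D"
  shows "\<exists>C\<ge>0. \<forall>m. (2::nat) \<le> m \<longrightarrow>
    (\<exists>n. real D * real m \<le> 2 ^ n \<and> 2 ^ n \<le> 2 * real D * real m \<and> real (n + 1) \<le> C * ln (real m))"
proof -
  \<comment> \<open>The 3 consists of 1 for log_2 m and 2 for the two extra units in n + 2, which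
    are at most 2 log_2 m because m \<ge> 2.\<close>
  define C where "C = (ln (real D) / ln 2 + 3) / ln 2"
  have C: "0 \<le> C" using assms by (simp add: C_def)
  have "\<exists>n. real D * real m \<le> 2 ^ n \<and> 2 ^ n \<le> 2 * real D * real m \<and> real (n + 1) \<le> C * ln (real m)"
    if m: "(2::nat) \<le> m" for m
  proof -
    have "1 \<le> D * m" using assms m by simp
    from ex_power_ivl1[OF _ this, of 2] obtain n where n: "2 ^ n \<le> D * m" "D * m < 2 ^ (n + 1)" by auto
    have n': "2 ^ n \<le> real D * m" "real D * m < 2 ^ (n + 1)"
      using n by (metis of_nat_le_iff of_nat_mult of_nat_numeral of_nat_power)
        (metis n(2) of_nat_less_iff of_nat_mult of_nat_numeral of_nat_power)
    have l2: "0 < ln (2::real)" "ln 2 \<le> ln (real m)" using m by auto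
    have "real n * ln 2 = ln (2 ^ n)" by (simp add: ln_realpow)
    also have "\<dots> \<le> ln (real D * m)" using n'(1) by (subst ln_le_cancel_iff) (auto intro: less_le_trans[OF _ n'(1)])
    also have "\<dots> = ln (real D) + ln m" using assms m by (simp add: ln_mult)
    finally have "real n \<le> (ln (real D) + ln m) / ln 2" using l2 by (simp add: pos_le_divide_eq)
    moreover have "ln (real D) \<le> ln (real D) / ln 2 * ln m"
    proof -
      have "ln (real D) * ln 2 \<le> ln (real D) * ln m" using assms l2 by (intro mult_left_mono) auto
      then show ?thesis using l2 by (simp add: field_simps)
    qed
    moreover have "2 \<le> 2 * ln m / ln 2" using l2 by (simp add: field_simps)
    ultimately have "real (n + 1 + 1) \<le> (ln (real D) / ln 2 * ln m + ln m) / ln 2 + 2 * ln m / ln 2"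
      using l2 by (smt (verit, best) divide_right_mono of_nat_1 of_nat_add)
    also have "\<dots> = C * ln m" by (simp add: C_def field_simps)
    finally show ?thesis using n' by (intro exI[of _ "n + 1"]) auto
  qed
  then show ?thesis by (intro exI[of _ C] conjI C allI impI)
qed

context step_frame begin

text \<open>A polyhedron enters through separation by normals from \<open>A\<close>: this makes
  \<open>K\<close> the slab polyhedron of its own support values, which are attained by
  compactness.\<close>

lemma polyhedra_discrepancy:
  fixes c :: real
  assumes c: "c = 1 / (4 * real CARD('n))" and norm_A: "\<And>a. a \<in> A \<Longrightarrow> norm a = c"
    and axis_A: "\<And>i. axis i c \<in> A" "\<And>i. axis i (- c) \<in> A"
  shows "\<exists>C. \<forall>m. prime m \<longrightarrow> (\<exists>g\<in>gen_box m. \<forall>K. compact K \<longrightarrow> K \<noteq> {} \<longrightarrow> diameter K < 1 \<longrightarrow>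
    (\<forall>x. x \<notin> K \<longrightarrow> (\<exists>a\<in>A. \<exists>\<beta>. (\<forall>y\<in>K. a \<bullet> y \<le> \<beta>) \<and> \<beta> < a \<bullet> x)) \<longrightarrow>
    \<bar>measure lebesgue K - (\<Sum>z | pt (m ^ 5) z \<in> K. real (lat_count m (m ^ 4) g z)) / real m\<bar> \<le>
      C * inverse (real m) * ln (real m) ^ CARD('n))"
proof -
  let ?d = "CARD('n)"
  \<comment> \<open>D = 1/c, so 2^n \<ge> D m gives 2^-n \<le> c / m: the enlargement by 2^-n stays
    in the range s \<le> c where admissibility holds.\<close>
  define D where "D = 4 * ?d"
  have D: "1 \<le> D" "real D = 4 * real ?d" by (simp_all add: D_def Suc_leI)
  have c0: "0 < c" by (simp add: c)
  have c1: "c \<le> 1 / 4" using D by (simp add: c D_def field_simps Suc_leI)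
  have zero: "0 \<notin> A" using norm_A c0 by force
  have Q: "1 \<le> 2 * real D" using D by linarith
  from dyadic_scale_exists[OF D(1)] obtain C1 where C1: "0 \<le> C1"
    and C1': "\<forall>m. (2::nat) \<le> m \<longrightarrow>
    (\<exists>n. real D * real m \<le> 2 ^ n \<and> 2 ^ n \<le> 2 * real D * real m \<and> real (n + 1) \<le> C1 * ln (real m))" by blast
  from lattice_rule_error[OF Q] obtain C2 where C2: "0 \<le> C2"
    and C2': "\<forall>m n. prime m \<longrightarrow> 2 ^ n \<le> 2 * real D * real m \<longrightarrow>
    (\<exists>g\<in>gen_box m. \<forall>b. admissible b \<longrightarrow>
      \<bar>(\<Sum>z | smooth_ind n b (pt (m ^ 5) z) \<noteq> 0. smooth_ind n b (pt (m ^ 5) z) * lat_count m (m ^ 4) g z) / real m -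
        (\<Sum>z | smooth_ind n b (pt (m ^ 5) z) \<noteq> 0. smooth_ind n b (pt (m ^ 5) z)) / real (m ^ 5) ^ CARD('n)\<bar>
      \<le> C2 * real (n + 1) ^ CARD('n) / real m)" by blast
  \<comment> \<open>Enlarging by \<delta> \<le> 1 keeps every coordinate within 1 + \<delta> / c
    \<le> 2 + D of a point of \<open>K\<close>.\<close>
  define R where "R = 2 * (2 + real D)"
  have "0 \<le> R" by (simp add: R_def)
  from volume_minus_lattice_sum_le[OF zero this] obtain C3 where C3: "0 \<le> C3"
    and C3': "\<forall>m M n E b p. \<forall>f :: int ^ 'n \<Rightarrow> nat. 1 \<le> M \<longrightarrow> 1 / 2 ^ n + 1 / real M \<le> 1 \<longrightarrow>
    slab_poly (\<lambda>a. b a + (1 / 2 ^ n + 1 / real M)) \<subseteq> cbox p (p + (\<chi> i. R)) \<longrightarrow>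
    (\<forall>b'\<in>{b, \<lambda>a. b a + 1 / 2 ^ n}.
      \<bar>(\<Sum>z | smooth_ind n b' (pt M z) \<noteq> 0. smooth_ind n b' (pt M z) * f z) / real m -
        (\<Sum>z | smooth_ind n b' (pt M z) \<noteq> 0. smooth_ind n b' (pt M z)) / real M ^ CARD('n)\<bar> \<le> E) \<longrightarrow>
    \<bar>measure lebesgue (slab_poly b) - (\<Sum>z | pt M z \<in> slab_poly b. real (f z)) / real m\<bar> \<le>
      E + C3 * (1 / 2 ^ n + 1 / real M)" by blast
  define C4 where "C4 = C2 * C1 ^ ?d + C3 * (2 / ln 2 ^ ?d)"
  show ?thesis
  proof (intro exI[of _ C4] allI impI)
    fix m :: nat assume m: "prime m"
    have m2: "2 \<le> m" using m by (rule prime_ge_2_nat)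
    obtain n where n: "real D * m \<le> 2 ^ n" "2 ^ n \<le> 2 * real D * real m" "real (n + 1) \<le> C1 * ln m"
      using C1' m2 by blast
    from C2' m n(2) obtain g where g: "g \<in> gen_box m" and err: "\<forall>b. admissible b \<longrightarrow>
      \<bar>(\<Sum>z | smooth_ind n b (pt (m ^ 5) z) \<noteq> 0. smooth_ind n b (pt (m ^ 5) z) * lat_count m (m ^ 4) g z) / real m -
        (\<Sum>z | smooth_ind n b (pt (m ^ 5) z) \<noteq> 0. smooth_ind n b (pt (m ^ 5) z)) / real (m ^ 5) ^ CARD('n)\<bar>
      \<le> C2 * real (n + 1) ^ CARD('n) / real m" by blast
    define M where "M = m ^ 5"
    define \<delta> where "\<delta> = 1 / 2 ^ n + 1 / real M"
    have M1: "1 \<le> M" using m2 by (simp add: M_def)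
    have dyad: "0 < 1 / (2 ^ n :: real)" "1 / 2 ^ n \<le> c / m"
    proof -
      have "1 / (2 ^ n) \<le> 1 / (real D * m)" using n(1) m2 D by (intro divide_left_mono) auto
      then show "1 / 2 ^ n \<le> c / m" by (simp add: c D(2))
    qed simp
    have cm: "c / m \<le> c" "c / m \<le> 1 / m" using m2 c0 c1 by (simp_all add: field_simps)
    have Mm: "1 / real M \<le> 1 / m"
    proof -
      have "m \<le> M" unfolding M_def by (rule self_le_power) (use m2 in auto)
      then show ?thesis using m2 by (intro divide_left_mono) auto
    qed
    have \<delta>: "0 < \<delta>" "\<delta> \<le> 2 / m" using dyad cm Mm M1 by (auto simp: \<delta>_def intro: add_pos_pos)
    have \<delta>1: "\<delta> \<le> 1"
    proof -
      have "2 / real m \<le> 1" using m2 by simp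
      then show ?thesis using \<delta> by linarith
    qed
    show "\<exists>g\<in>gen_box m. \<forall>K. compact K \<longrightarrow> K \<noteq> {} \<longrightarrow> diameter K < 1 \<longrightarrow>
      (\<forall>x. x \<notin> K \<longrightarrow> (\<exists>a\<in>A. \<exists>\<beta>. (\<forall>y\<in>K. a \<bullet> y \<le> \<beta>) \<and> \<beta> < a \<bullet> x)) \<longrightarrow>
      \<bar>measure lebesgue K - (\<Sum>z | pt (m ^ 5) z \<in> K. real (lat_count m (m ^ 4) g z)) / real m\<bar> \<le>
        C4 * inverse (real m) * ln (real m) ^ CARD('n)"
    proof (intro bexI[OF _ g] allI impI)
      fix K assume K: "compact K" "K \<noteq> {}" and diam: "diameter K < 1"
        and sep: "\<forall>x. x \<notin> K \<longrightarrow> (\<exists>a\<in>A. \<exists>\<beta>. (\<forall>y\<in>K. a \<bullet> y \<le> \<beta>) \<and> \<beta> < a \<bullet> x)"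
      have bd: "bounded K" using K(1) by (rule compact_imp_bounded)
      have "\<forall>a. \<exists>y\<in>K. \<forall>x\<in>K. a \<bullet> x \<le> a \<bullet> y"
      proof
        fix a :: "real ^ 'n"
        have "continuous_on K ((\<bullet>) a)" by (intro continuous_intros)
        from continuous_attains_sup[OF K this] show "\<exists>y\<in>K. \<forall>x\<in>K. a \<bullet> x \<le> a \<bullet> y" .
      qed
      then obtain ym where ym: "\<And>a. ym a \<in> K" "\<And>a x. x \<in> K \<Longrightarrow> a \<bullet> x \<le> a \<bullet> ym a" by metis
      define b where "b a = a \<bullet> ym a" for a
      have Kb: "K = slab_poly b"
      proof (intro set_eqI iffI)
        fix x assume "x \<in> slab_poly b"
        then have le: "a \<bullet> x \<le> a \<bullet> ym a" if "a \<in> A" for a using that by (simp add: slab_poly_def b_def)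
        show "x \<in> K"
        proof (rule ccontr)
          assume "x \<notin> K"
          then obtain a \<beta> where "a \<in> A" "\<forall>y\<in>K. a \<bullet> y \<le> \<beta>" "\<beta> < a \<bullet> x" using sep by blast
          then show False using le[of a] ym(1)[of a] by fastforce
        qed
      qed (use ym(2) in \<open>simp add: slab_poly_def b_def\<close>)
      have enl1: "\<bar>x $ j - y $ j\<bar> \<le> 1 + s / c"
        if "0 \<le> s" "x \<in> slab_poly (\<lambda>a. b a + s)" "y \<in> K" for s x y j
        by (rule enlarged_polyhedron(1)[where ym = ym and K = K])
          (fact c norm_A axis_A ym(1) bd diam that that[unfolded b_def])+
      have enl2: "b a + s - a \<bullet> x \<le> 1"
        if "0 \<le> s" "x \<in> slab_poly (\<lambda>a. b a + s)" "a \<in> A" "s \<le> c" for s x a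
        unfolding b_def
        by (rule enlarged_polyhedron(2)[where ym = ym and K = K and c = c])
          (fact c norm_A axis_A ym(1) bd diam that that[unfolded b_def])+
      have adm: "admissible (\<lambda>a. b a + s)" if "0 \<le> s" "s \<le> c" for s
        unfolding admissible_def using enl2[OF that(1) _ _ that(2)] by (simp add: slab_poly_def)
      have adm2: "admissible b" "admissible (\<lambda>a. b a + 1 / 2 ^ n)"
        using adm[of 0] adm[of "1 / 2 ^ n"] c0 dyad cm by auto
      define p where "p = ym 0 - (\<chi> i. 2 + real D)"
      have sub: "slab_poly (\<lambda>a. b a + \<delta>) \<subseteq> cbox p (p + (\<chi> i. R))"
      proof
        fix x assume x: "x \<in> slab_poly (\<lambda>a. b a + \<delta>)"
        have "\<delta> / c \<le> 1 + real D"
        proof -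
          have "\<delta> / c \<le> 1 / c" using \<delta>1 c0 by (intro divide_right_mono) auto
          moreover have "1 / c = real D" by (simp add: c D(2))
          ultimately show ?thesis by linarith
        qed
        then have "\<bar>x $ j - ym 0 $ j\<bar> \<le> 2 + real D" for j
          using enl1[OF less_imp_le[OF \<delta>(1)] x ym(1)[of 0], of j] by linarith
        then show "x \<in> cbox p (p + (\<chi> i. R))"
          unfolding mem_box_cart p_def R_def by (simp add: abs_le_iff) (smt (verit, best))
      qed
      have "\<bar>measure lebesgue (slab_poly b) - (\<Sum>z | pt M z \<in> slab_poly b. real (lat_count m (m ^ 4) g z)) / real m\<bar> \<le>
        C2 * real (n + 1) ^ ?d / real m + C3 * \<delta>"
        unfolding \<delta>_def
        by (rule C3'[rule_format, OF M1 \<delta>1[unfolded \<delta>_def] sub[unfolded \<delta>_def]])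
          (use err adm2 in \<open>auto simp: M_def\<close>)
      also have "\<dots> \<le> C2 * (C1 * ln m) ^ ?d / real m + C3 * (2 / m * (ln m / ln 2) ^ ?d)"
      proof (intro add_mono mult_left_mono divide_right_mono power_mono C2 C3)
        \<comment> \<open>As m \<ge> 2, the error of order 1/m fits under the logarithmic
          bound.\<close>
        have "1 \<le> ln (real m) / ln 2" using m2 by simp
        then have "1 \<le> (ln (real m) / ln 2) ^ ?d" by (rule one_le_power)
        then have "2 / real m * 1 \<le> 2 / m * (ln m / ln 2) ^ ?d" by (intro mult_left_mono) auto
        then show "\<delta> \<le> 2 / m * (ln m / ln 2) ^ ?d" using \<delta> by linarith
      qed (use n(3) in auto)
      also have "\<dots> = C4 * inverse (real m) * ln (real m) ^ ?d"
        by (simp add: C4_def power_mult_distrib divide_inverse power_inverse algebra_simps)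
      finally show "\<bar>measure lebesgue K - (\<Sum>z | pt (m ^ 5) z \<in> K. real (lat_count m (m ^ 4) g z)) / real m\<bar> \<le>
        C4 * inverse (real m) * ln (real m) ^ ?d"
        by (simp only: Kb M_def)
    qed
  qed
qed

end

lemma hyperspace_normal:
  fixes H :: "(real ^ 'n) set"
  assumes "hyperspace H"
  shows "\<exists>u. u \<noteq> 0 \<and> H = {x. u \<bullet> x = 0}"
proof -
  have "dim H = DIM(real ^ 'n) - 1" "span H = H"
    using assms by (auto simp: hyperspace_def)
  then show ?thesis using dim_eq_hyperplane[of H] by metis
qed


theorem theorem4:
  fixes X :: "(real ^ 'n) set set"
  assumes "finite X"
    and "\<And>H. H \<in> X \<Longrightarrow> hyperspace H"
  shows "\<exists>c::real. \<forall>m::nat. prime m \<longrightarrow>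
    (\<exists>g :: int ^ 'n. (\<forall>j. 1 \<le> g $ j \<and> g $ j \<le> int m - 1) \<and>
      (SUP \<Omega>\<in>torus_polyhedra X.
        ereal \<bar>measure torus_lebesgue \<Omega> -
          inverse (real m) *
            (\<Sum>j = 1..m. indicator \<Omega> (to_torus ((real j * inverse (real m)) *\<^sub>R int_vec_to_real g)))\<bar>)
      \<le> ereal (c * inverse (real m) * ln (real m) ^ CARD('n)))"
proof -
  define c where "c = 1 / (4 * real CARD('n))"
  have c0: "0 < c" by (simp add: c_def)
  have "\<forall>H\<in>X. \<exists>u. u \<noteq> 0 \<and> H = {x. u \<bullet> x = 0}" using hyperspace_normal assms(2) by blast
  then obtain u where u: "\<And>H. H \<in> X \<Longrightarrow> u H \<noteq> 0 \<and> H = {x. u H \<bullet> x = 0}" by metis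
  have u0: "u H \<noteq> 0" if "H \<in> X" for H by (rule conjunct1[OF u[OF that]])
  \<comment> \<open>Both signs of each normal, since the side of \<open>K\<close> is not determined
    by the hyperspace, all scaled to length c. The axis vectors make \<open>A\<close> span and
    confine the enlarged polyhedra.\<close>
  define A where "A = (\<lambda>H. (c / norm (u H)) *\<^sub>R u H) ` X \<union> (\<lambda>H. (- c / norm (u H)) *\<^sub>R u H) ` X \<union>
    range (\<lambda>i. axis i c) \<union> range (\<lambda>i. axis i (- c))"
  have norm_A: "norm a = c" if "a \<in> A" for a
    using that u0 c0 by (auto simp: A_def norm_eq_sqrt_inner[of "axis _ _"] inner_axis_axis)
  have axis_A: "axis i c \<in> A" "axis i (- c) \<in> A" for i by (auto simp: A_def)
  obtain S C0 where S: "smooth_upto (2 * CARD('n)) C0 S" "\<And>t. 0 \<le> S t \<and> S t \<le> 1"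
    "\<And>t. t \<le> 0 \<Longrightarrow> S t = 0" "\<And>t. t \<ge> real (2 * CARD('n)) + 1 \<Longrightarrow> S t = 1"
    using smooth_step_exists by metis
  \<comment> \<open>The transition of \<open>S\<close> has length r; t \<mapsto> r (t - 1) maps
    [1, 2] onto it.\<close>
  define r where "r = real (2 * CARD('n)) + 1"
  define th where "th t = S (r * t + - r)" for t
  have r: "1 \<le> r" by (simp add: r_def)
  interpret step_frame A th "C0 * r ^ (2 * CARD('n))"
  proof
    show "finite A" using assms(1) by (simp add: A_def)
    have "x \<in> span A" for x
    proof -
      have "x = (\<Sum>i\<in>UNIV. (x $ i / c) *\<^sub>R axis i c)"
        using c0 by (simp add: vec_eq_iff axis_def if_distrib cong: if_cong)
      also have "\<dots> \<in> span A" by (intro span_sum span_scale span_base axis_A)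
      finally show ?thesis .
    qed
    then show "span A = UNIV" by blast
    show "\<bar>a $ i\<bar> \<le> 1 / real CARD('n)" if "a \<in> A" for a i
    proof -
      have "\<bar>a $ i\<bar> \<le> c" using component_le_norm_cart[of a i] norm_A[OF that] by simp
      also have "c \<le> 1 / real CARD('n)" by (simp add: c_def field_simps)
      finally show ?thesis .
    qed
    show "th t = 0" if "t \<le> 1" for t
      unfolding th_def by (rule S(3)) (use mult_left_mono[OF that, of r] r in simp)
    show "th t = 1" if "2 \<le> t" for t
      unfolding th_def by (rule S(4)) (use mult_left_mono[OF that, of r] r in \<open>simp add: r_def\<close>)
    show "0 \<le> th t \<and> th t \<le> 1" for t unfolding th_def by (rule S(2))
    show "smooth_upto (2 * CARD('n)) (C0 * r ^ (2 * CARD('n))) th"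
      unfolding smooth_upto_def
    proof (intro allI impI)
      fix ts :: "real list" assume len: "length ts \<le> 2 * CARD('n)"
      let ?ps = "map (\<lambda>t. (t, \<bar>t\<bar>)) ts"
      have "diff_bounded C0 (map (\<lambda>t. (t, \<bar>t\<bar>)) (map (\<lambda>t. r * t) ts)) S"
        using S(1) len unfolding smooth_upto_def by (metis length_map)
      then have "diff_bounded C0 (map (\<lambda>p. (fst p, r * snd p)) ?ps) th"
        unfolding th_def[abs_def]
        by (intro diff_bounded_compose) (use r in \<open>auto simp: distrib_left comp_def abs_mult\<close>)
      then have "diff_bounded (C0 * r ^ length ?ps) ?ps th"
        by (rule diff_bounded_scale[OF _ r]) auto
      then show "diff_bounded (C0 * r ^ (2 * CARD('n))) ?ps th"
        by (rule diff_bounded_mono)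
          (use r len diff_bounded_nonneg S(1)[unfolded smooth_upto_def, rule_format, of "[]"] in
            \<open>auto intro!: mult_left_mono power_increasing intro: diff_bounded_nonneg\<close>)
    qed
  qed
  from polyhedra_discrepancy[OF c_def norm_A axis_A] obtain C where
    C: "\<forall>m. prime m \<longrightarrow> (\<exists>g\<in>gen_box m. \<forall>K. compact K \<longrightarrow> K \<noteq> {} \<longrightarrow> diameter K < 1 \<longrightarrow>
    (\<forall>x. x \<notin> K \<longrightarrow> (\<exists>a\<in>A. \<exists>\<beta>. (\<forall>y\<in>K. a \<bullet> y \<le> \<beta>) \<and> \<beta> < a \<bullet> x)) \<longrightarrow>
    \<bar>measure lebesgue K - (\<Sum>z | pt (m ^ 5) z \<in> K. real (lat_count m (m ^ 4) g z)) / real m\<bar> \<le>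
      C * inverse (real m) * ln (real m) ^ CARD('n))" by blast
  show ?thesis
  proof (intro exI[of _ C] allI impI)
    fix m :: nat assume m: "prime m"
    have m1: "1 \<le> m" using prime_ge_2_nat[OF m] by simp
    from C m obtain g where g: "g \<in> gen_box m" and
      gK: "\<forall>K. compact K \<longrightarrow> K \<noteq> {} \<longrightarrow> diameter K < 1 \<longrightarrow>
      (\<forall>x. x \<notin> K \<longrightarrow> (\<exists>a\<in>A. \<exists>\<beta>. (\<forall>y\<in>K. a \<bullet> y \<le> \<beta>) \<and> \<beta> < a \<bullet> x)) \<longrightarrow>
      \<bar>measure lebesgue K - (\<Sum>z | pt (m ^ 5) z \<in> K. real (lat_count m (m ^ 4) g z)) / real m\<bar> \<le>
        C * inverse (real m) * ln (real m) ^ CARD('n)" by blast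
    show "\<exists>g :: int ^ 'n. (\<forall>j. 1 \<le> g $ j \<and> g $ j \<le> int m - 1) \<and>
      (SUP \<Omega>\<in>torus_polyhedra X.
        ereal \<bar>measure torus_lebesgue \<Omega> -
          inverse (real m) *
            (\<Sum>j = 1..m. indicator \<Omega> (to_torus ((real j * inverse (real m)) *\<^sub>R int_vec_to_real g)))\<bar>)
      \<le> ereal (C * inverse (real m) * ln (real m) ^ CARD('n))"
    proof (intro exI[of _ g] conjI)
      show "\<forall>j. 1 \<le> g $ j \<and> g $ j \<le> int m - 1" using g by (auto simp: gen_box_def)
      show "(SUP \<Omega>\<in>torus_polyhedra X.
        ereal \<bar>measure torus_lebesgue \<Omega> -
          inverse (real m) *
            (\<Sum>j = 1..m. indicator \<Omega> (to_torus ((real j * inverse (real m)) *\<^sub>R int_vec_to_real g)))\<bar>)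
        \<le> ereal (C * inverse (real m) * ln (real m) ^ CARD('n))"
      \<comment> \<open>In \<open>ereal\<close> a common upper bound is enough; an empty family has
        supremum -infinity.\<close>
      proof (rule SUP_least)
        fix \<Omega> assume "\<Omega> \<in> torus_polyhedra X"
        then obtain K where K: "\<Omega> = to_torus ` K" "convex_polyhedron K" "diameter K < 1"
          "\<forall>F. F facet_of K \<longrightarrow> (\<exists>H\<in>X. affine_parallel H (affine hull F))"
          by (auto simp: torus_polyhedra_def)
        have comp: "compact K" "K \<noteq> {}" using K(2) by (auto simp: convex_polyhedron_def)
        have sep: "\<exists>a\<in>A. \<exists>\<beta>. (\<forall>y\<in>K. a \<bullet> y \<le> \<beta>) \<and> \<beta> < a \<bullet> x" if x: "x \<notin> K" for x
        proof -
          obtain H l \<beta> where H: "H \<in> X" and *: "\<forall>y\<in>K. (l *\<^sub>R u H) \<bullet> y \<le> \<beta>" "\<beta> < (l *\<^sub>R u H) \<bullet> x"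
            using polyhedron_separating_normal[OF K(2,4) u x] by blast
          have l: "l \<noteq> 0" using * comp(2) by force
          \<comment> \<open>Rescales the separating normal to length c while keeping the sign of
            \<open>l\<close>, which gives an element of \<open>A\<close>.\<close>
          define \<kappa> where "\<kappa> = c / (\<bar>l\<bar> * norm (u H))"
          have \<kappa>: "0 < \<kappa>" using l u0[OF H] c0 by (simp add: \<kappa>_def)
          define a where "a = \<kappa> *\<^sub>R (l *\<^sub>R u H)"
          have "a \<in> A"
          proof (cases "0 < l")
            case True
            then have "a = (c / norm (u H)) *\<^sub>R u H" by (simp add: a_def \<kappa>_def)
            then show ?thesis using H by (simp add: A_def)
          next
            case False
            then have "a = (- c / norm (u H)) *\<^sub>R u H" using l by (simp add: a_def \<kappa>_def)
            then show ?thesis using H by (simp add: A_def)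
          qed
          moreover have "a \<bullet> y \<le> \<kappa> * \<beta>" if "y \<in> K" for y
            using *(1) that \<kappa> by (simp only: a_def inner_scaleR_left[of \<kappa>]) (simp add: mult_left_mono)
          moreover have "\<kappa> * \<beta> < a \<bullet> x"
            using *(2) \<kappa> by (simp only: a_def inner_scaleR_left[of \<kappa>] mult_less_cancel_left_pos)
          ultimately show ?thesis by blast
        qed
        have bd: "bounded K" using comp(1) by (rule compact_imp_bounded)
        have "K \<in> sets lebesgue" using lmeasurable_compact[OF comp(1)] by (rule fmeasurableD)
        then have vol: "measure torus_lebesgue \<Omega> = measure lebesgue K"
          unfolding K(1) using bd K(3) by (rule measure_torus_image)
        have "m ^ 5 = m * m ^ 4" "1 \<le> m ^ 4" using m1 by (simp_all add: eval_nat_numeral)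
        from sum_indicator_torus_image[OF bd K(3) m1 this(2,1), of g]
        have pts: "(\<Sum>j = 1..m. indicator \<Omega> (to_torus ((real j * inverse (real m)) *\<^sub>R int_vec_to_real g))) =
          (\<Sum>z | pt (m ^ 5) z \<in> K. real (lat_count m (m ^ 4) g z))" by (simp only: K(1))
        show "ereal \<bar>measure torus_lebesgue \<Omega> -
          inverse (real m) *
            (\<Sum>j = 1..m. indicator \<Omega> (to_torus ((real j * inverse (real m)) *\<^sub>R int_vec_to_real g)))\<bar>
          \<le> ereal (C * inverse (real m) * ln (real m) ^ CARD('n))"
          using gK[rule_format, OF comp K(3) sep] unfolding vol pts
          by (simp add: divide_inverse mult.commute)
      qed
    qed
  qed
qed

end
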